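(* Let $\Omega\subset \mathbb{C}$ be an infinitely connected domain, let $N\geq 2$, and let $\phi_1,\dots,\phi_N$ be injective holomorphic self-maps of $\Omega$. Then the following assertions are equivalent: (1) The composition operators $C_{\phi_1},\dots,C_{\phi_N}$ on $H(\Omega)$ are disjoint topologically transitive. (2) For every $\Omega$-convex compact subset $K$ of $\Omega$, there is some $n\in \mathbb{N}$ such that the sets $\phi_{1,n}(K),\dots,\phi_{N,n}(K)$ are $\Omega$-convex and the sets $K,\phi_{1,n}(K),\dots,\phi_{N,n}(K)$ are pairwise disjoint.
   Context: $\mathbb{N}$ denotes the set of positive integers and $\hat{\mathbb{C}}=\mathbb{C}\cup\{\infty\}$. A domain is a non-empty connected open subset $\Omega$ of $\mathbb{C}$; it is finitely connected if $\hat{\mathbb{C}}\setminus\Omega$ has at most finitely many connected components, and infinitely connected otherwise. For $M\subset\mathbb{C}$, a hole of $M$ is a bounded connected component of $\hat{\mathbb{C}}\setminus M$ (in particular, one not containing $\infty$). A compact subset $M$ of $\Omega$ is $\Omega$-convex if every hole of $M$ contains a point of $\mathbb{C}\setminus\Omega$. $H(\Omega)$ is the space of holomorphic functions on $\Omega$ with the topology of uniform convergence on compact subsets. For a holomorphic self-map $\phi$ of $\Omega$, $C_\phi(f)=f\circ\phi$ for $f\in H(\Omega)$. $\phi_{i,n}$ denotes the $n$-th iterate of $\phi_i$. Continuous linear operators $T_1,\dots,T_N$ ($N\ge2$) on a topological vector space $X$ are disjoint topologically transitive (d-topologically transitive) if for all non-empty open subsets $U_0,\dots,U_N$ of $X$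 there exists $n\in\mathbb{N}$ such that $U_0\cap T_1^{-n}(U_1)\cap\dots\cap T_N^{-n}(U_N)\neq\emptyset$, where $T_i^{-n}(U_i)$ is the preimage of $U_i$ under $T_i^n$. *)

theory Defs
  imports "HOL-Complex_Analysis.Complex_Analysis"
begin

text \<open>The extended plane has \<open>Some z\<close> for the finite points and \<open>None\<close> for \<open>\<infinity>\<close>.\<close>

abbreviation Chat :: "complex option topology" where
  "Chat \<equiv> Alexandroff_compactification euclidean"

definition Chat_complement_components :: "complex set \<Rightarrow> complex option set set" where
  "Chat_complement_components M =
     connected_components_of (subtopology Chat (topspace Chat - Some ` M))"

definition domain_in_plane :: "complex set \<Rightarrow> bool" where
  "domain_in_plane \<Omega> \<longleftrightarrow> \<Omega> \<noteq> {} \<and> open \<Omega> \<and> connected \<Omega>"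

definition finitely_connected :: "complex set \<Rightarrow> bool" where
  "finitely_connected \<Omega> \<longleftrightarrow> finite (Chat_complement_components \<Omega>)"

text \<open>A hole is returned as a set of complex numbers; the component \<open>Some ` H\<close> of the
  complement then automatically omits \<open>\<infinity>\<close>.\<close>

definition holes :: "complex set \<Rightarrow> complex set set" where
  "holes M = {H. bounded H \<and> Some ` H \<in> Chat_complement_components M}"

definition convex_relative :: "complex set \<Rightarrow> complex set \<Rightarrow> bool" where
  "convex_relative \<Omega> M \<longleftrightarrow>
     compact M \<and> M \<subseteq> \<Omega> \<and> (\<forall>H\<in>holes M. H \<inter> (UNIV - \<Omega>) \<noteq> {})"

text \<open>Functions on \<open>\<Omega>\<close> are represented by total functions that are \<open>undefined\<close> off \<open>\<Omega>\<close>, so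
  that functions which agree on \<open>\<Omega>\<close> are equal.\<close>

definition holo_fun :: "complex set \<Rightarrow> (complex \<Rightarrow> complex) set" where
  "holo_fun \<Omega> = {f \<in> extensional \<Omega>. f holomorphic_on \<Omega>}"

definition holo_topology :: "complex set \<Rightarrow> (complex \<Rightarrow> complex) topology" where
  "holo_topology \<Omega> = topology (\<lambda>U. U \<subseteq> holo_fun \<Omega> \<and>
     (\<forall>f\<in>U. \<exists>K e. compact K \<and> K \<subseteq> \<Omega> \<and> e > 0 \<and>
        {g \<in> holo_fun \<Omega>. \<forall>z\<in>K. dist (g z) (f z) < e} \<subseteq> U))"

lemma openin_holo_topology:
  "openin (holo_topology \<Omega>) U \<longleftrightarrow> U \<subseteq> holo_fun \<Omega> \<and>
     (\<forall>f\<in>U. \<exists>K e. compact K \<and> K \<subseteq> \<Omega> \<and> e > 0 \<and>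
        {g \<in> holo_fun \<Omega>. \<forall>z\<in>K. dist (g z) (f z) < e} \<subseteq> U)"
    (is "_ \<longleftrightarrow> ?P U")
proof -
  have istop: "istopology P"
    if "\<And>S T. P S \<Longrightarrow> P T \<Longrightarrow> P (S \<inter> T)" "\<And>\<K>. \<forall>S\<in>\<K>. P S \<Longrightarrow> P (\<Union>\<K>)"
    for P :: "(complex \<Rightarrow> complex) set \<Rightarrow> bool"
    using that by (simp add: istopology_def)
  have int: "?P (S \<inter> T)" if S: "?P S" and T: "?P T" for S T
  proof (intro conjI ballI)
    show "S \<inter> T \<subseteq> holo_fun \<Omega>" using S by blast
    fix f assume f: "f \<in> S \<inter> T"
    obtain K e where K: "compact K" "K \<subseteq> \<Omega>" "e > 0"
      "{g \<in> holo_fun \<Omega>. \<forall>z\<in>K. dist (g z) (f z) < e} \<subseteq> S"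
      using bspec[OF conjunct2[OF S] IntD1[OF f]] by blast
    obtain L d where L: "compact L" "L \<subseteq> \<Omega>" "d > 0"
      "{g \<in> holo_fun \<Omega>. \<forall>z\<in>L. dist (g z) (f z) < d} \<subseteq> T"
      using bspec[OF conjunct2[OF T] IntD2[OF f]] by blast
    have "{g \<in> holo_fun \<Omega>. \<forall>z\<in>K \<union> L. dist (g z) (f z) < min e d} \<subseteq> S \<inter> T"
      using K(4) L(4) by auto
    moreover have "compact (K \<union> L)" "K \<union> L \<subseteq> \<Omega>" "min e d > 0"
      using K L by auto
    ultimately show "\<exists>K e. compact K \<and> K \<subseteq> \<Omega> \<and> e > 0 \<and>
        {g \<in> holo_fun \<Omega>. \<forall>z\<in>K. dist (g z) (f z) < e} \<subseteq> S \<inter> T"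
      by blast
  qed
  have un: "?P (\<Union>\<K>)" if all: "\<forall>S\<in>\<K>. ?P S" for \<K>
  proof (intro conjI ballI)
    show "\<Union>\<K> \<subseteq> holo_fun \<Omega>" using all by blast
    fix f assume "f \<in> \<Union>\<K>"
    then obtain S where S: "S \<in> \<K>" "f \<in> S" by blast
    obtain K e where "compact K" "K \<subseteq> \<Omega>" "e > 0"
      "{g \<in> holo_fun \<Omega>. \<forall>z\<in>K. dist (g z) (f z) < e} \<subseteq> S"
      using bspec[OF conjunct2[OF bspec[OF all S(1)]] S(2)] by blast
    moreover have "S \<subseteq> \<Union>\<K>" using S(1) by blast
    ultimately show "\<exists>K e. compact K \<and> K \<subseteq> \<Omega> \<and> e > 0 \<and>
        {g \<in> holo_fun \<Omega>. \<forall>z\<in>K. dist (g z) (f z) < e} \<subseteq> \<Union>\<K>"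
      by (meson subset_trans)
  qed
  have "istopology ?P"
    by (rule istop[of ?P, OF int un])
  then show ?thesis
    unfolding holo_topology_def by (simp only: topology_inverse')
qed

lemma topspace_holo_topology [simp]: "topspace (holo_topology \<Omega>) = holo_fun \<Omega>"
proof
  have "openin (holo_topology \<Omega>) (holo_fun \<Omega>)"
    unfolding openin_holo_topology
    by (intro conjI ballI exI[of _ "{}"] exI[of _ "1::real"]) auto
  then show "holo_fun \<Omega> \<subseteq> topspace (holo_topology \<Omega>)"
    by (rule openin_subset)
  show "topspace (holo_topology \<Omega>) \<subseteq> holo_fun \<Omega>"
    using openin_topspace[of "holo_topology \<Omega>", unfolded openin_holo_topology]
    by (rule conjunct1)
qed

definition comp_operator ::
    "complex set \<Rightarrow> (complex \<Rightarrow> complex) \<Rightarrow> (complex \<Rightarrow> complex) \<Rightarrow> (complex \<Rightarrow> complex)" where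
  "comp_operator \<Omega> \<phi> f = restrict (f \<circ> \<phi>) \<Omega>"

lemma comp_operator_linear:
  assumes "\<phi> ` \<Omega> \<subseteq> \<Omega>"
  shows "comp_operator \<Omega> \<phi> (restrict (\<lambda>z. a * f z + b * g z) \<Omega>) =
    restrict (\<lambda>z. a * comp_operator \<Omega> \<phi> f z + b * comp_operator \<Omega> \<phi> g z) \<Omega>"
  using assms by (auto simp: comp_operator_def fun_eq_iff restrict_def)

lemma comp_operator_continuous:
  assumes hol: "\<phi> holomorphic_on \<Omega>" and maps: "\<phi> ` \<Omega> \<subseteq> \<Omega>"
  shows "continuous_map (holo_topology \<Omega>) (holo_topology \<Omega>) (comp_operator \<Omega> \<phi>)"
proof -
  have H: "comp_operator \<Omega> \<phi> f \<in> holo_fun \<Omega>" if "f \<in> holo_fun \<Omega>" for f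
  proof -
    have "(f \<circ> \<phi>) holomorphic_on \<Omega>"
      using that hol maps by (auto simp: holo_fun_def intro: holomorphic_on_compose_gen)
    then have "restrict (f \<circ> \<phi>) \<Omega> holomorphic_on \<Omega>"
      by (rule holomorphic_transform) auto
    then show ?thesis by (simp add: holo_fun_def comp_operator_def)
  qed
  have "openin (holo_topology \<Omega>) {f \<in> holo_fun \<Omega>. comp_operator \<Omega> \<phi> f \<in> U}"
    if U: "openin (holo_topology \<Omega>) U" for U
    unfolding openin_holo_topology
  proof (intro conjI ballI)
    fix f assume f: "f \<in> {f \<in> holo_fun \<Omega>. comp_operator \<Omega> \<phi> f \<in> U}"
    then have "comp_operator \<Omega> \<phi> f \<in> U" by simp
    from bspec[OF conjunct2[OF U[unfolded openin_holo_topology]] this]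
    obtain K e where K: "compact K" "K \<subseteq> \<Omega>" "e > 0"
      and sub: "{g \<in> holo_fun \<Omega>. \<forall>z\<in>K. dist (g z) (comp_operator \<Omega> \<phi> f z) < e} \<subseteq> U"
      by blast
    have "continuous_on K \<phi>"
      using continuous_on_subset[OF holomorphic_on_imp_continuous_on[OF hol] K(2)] .
    then have "compact (\<phi> ` K)"
      using K(1) by (rule compact_continuous_image)
    moreover have "\<phi> ` K \<subseteq> \<Omega>"
      using K(2) maps by blast
    moreover have "comp_operator \<Omega> \<phi> g \<in> U"
      if g: "g \<in> holo_fun \<Omega>" and lt: "\<forall>z\<in>\<phi> ` K. dist (g z) (f z) < e" for g
    proof -
      have "dist (comp_operator \<Omega> \<phi> g z) (comp_operator \<Omega> \<phi> f z) < e" if "z \<in> K" for z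
        using that K(2) lt by (auto simp: comp_operator_def)
      with sub H[OF g] show ?thesis by blast
    qed
    then have "{g \<in> holo_fun \<Omega>. \<forall>z\<in>\<phi> ` K. dist (g z) (f z) < e}
        \<subseteq> {f \<in> holo_fun \<Omega>. comp_operator \<Omega> \<phi> f \<in> U}"
      by blast
    ultimately show "\<exists>K e. compact K \<and> K \<subseteq> \<Omega> \<and> e > 0 \<and>
        {g \<in> holo_fun \<Omega>. \<forall>z\<in>K. dist (g z) (f z) < e}
          \<subseteq> {f \<in> holo_fun \<Omega>. comp_operator \<Omega> \<phi> f \<in> U}"
      using K(3) by (intro exI[of _ "\<phi> ` K"] exI[of _ e] conjI)
  qed auto
  then show ?thesis
    using H by (auto simp: continuous_map_def)
qed

text \<open>The operators are \<open>T 1, \<dots>, T N\<close>; linearity and continuity are not part of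
  the predicate, as composition operators have both by the lemmas above.\<close>

definition d_topologically_transitive ::
    "'a topology \<Rightarrow> nat \<Rightarrow> (nat \<Rightarrow> 'a \<Rightarrow> 'a) \<Rightarrow> bool" where
  "d_topologically_transitive X N T \<longleftrightarrow>
     (\<forall>U. (\<forall>i\<in>{0..N}. openin X (U i) \<and> U i \<noteq> {}) \<longrightarrow>
        (\<exists>n\<ge>1. U 0 \<inter> (\<Inter>i\<in>{1..N}. {x \<in> topspace X. (T i ^^ n) x \<in> U i}) \<noteq> {}))"

end

theory Submission
  imports Defs "HOL-Library.Ramsey"
begin

text \<open>
  (1) implies (2): test transitivity on neighbourhoods of \<open>0\<close> and of \<open>2 i + g\<close>, where \<open>g\<close> is small
  on \<open>K\<close> and close to \<open>1\<close> at one point of each component of \<open>- K\<close>. The constants separate the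
  sets, and by the maximum principle \<open>g\<close> rules out holes inside \<open>\<Omega>\<close>.

  For the converse, Runge's theorem asks for an exponent \<open>n\<close> such that the union of \<open>K\<close> and its
  images \<open>A i\<close> is \<open>\<Omega>\<close>-convex; (2) only gives this for the sets separately. Suppose the union has a
  hole \<open>V\<close> inside \<open>\<Omega>\<close>. If \<open>V\<close> touches \<open>A i\<close>, it contains the image of the part near \<open>K\<close> of some
  component \<open>C\<close> of \<open>- K\<close>. As \<open>- V\<close> has at most \<open>N + 1\<close> components, \<open>C \<inter> \<Omega>\<close> does not contain
  \<open>N + 2\<close> loops with linearly independent period functionals on \<open>H(\<Omega>)\<close>. As \<open>\<Omega>\<close> does, no \<open>A j\<close>
  lies in \<open>C\<close>; hence \<open>V\<close> does not touch \<open>K\<close>, some touched \<open>A i\<close> separates \<open>V\<close> from \<open>K \<union> C\<close>, and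
  some \<open>A j\<close> lies on the side of \<open>A i\<close> that contains \<open>V\<close>. So every bad exponent gets one of finitely
  many colours \<open>(i, j, C)\<close>. Choosing exponents whose differences are all admissible for a large set,
  Ramsey's theorem gives bad exponents \<open>p\<close>, \<open>y\<close>, \<open>y + p\<close> of one colour, which is impossible.
\<close>

section \<open>Holes\<close>

text \<open>What passes from \<open>K\<close> to its images is the linear independence of periods:
  each \<open>h\<close> on \<open>\<Omega>\<close> is matched along the image loops by a function on
  the image of \<open>\<Omega>\<close>, and convexity of the images of \<open>L\<close> lets Runge's
  theorem replace that by functions on \<open>\<Omega>\<close>. A hole \<open>V\<close> is poor
  because winding numbers of loops in \<open>V\<close> about points outside are determined by
  \<open>N + 1\<close> sample points: among \<open>N + 2\<close> loops some nontrivial combination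
  has winding number zero about all of them and, by Cauchy's theorem, no periods. Infinite
  connectivity supplies \<open>N + 2\<close> independent loops in \<open>\<Omega>\<close>.

  A bad triangle fails for this reason. Applying \<open>iter i y\<close> to the position of
  \<open>K\<close> relative to its image at exponent \<open>p\<close> shows that the sides of the
  \<open>i\<close>-th images at \<open>y\<close> and at \<open>y + p\<close> are disjoint. Each side
  contains a \<open>j\<close>-th image, and the exponents are spaced so that the two
  \<open>j\<close>-th images lie in a connected set missing both \<open>i\<close>-th images. That
  set would have to lie in both sides.\<close>

lemma closure_component_subset:
  fixes A :: "'a::real_normed_vector set"
  assumes "Q \<in> components (- A)" "closed A"
  shows "closure Q \<subseteq> Q \<union> A"
proof -
  obtain T where "closed T" "Q = - A \<inter> T"
    using closedin_component[OF assms(1)] by (auto simp: closedin_closed)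
  then have "closure Q \<subseteq> T" by (metis closure_minimal inf_le2)
  then show ?thesis using \<open>Q = - A \<inter> T\<close> by auto
qed

text \<open>\<open>convex_relative\<close> with components of \<open>- M\<close> in the plane
  instead of the extended plane, so that separation theorems of the plane apply directly.\<close>

definition plane_convex :: "complex set \<Rightarrow> complex set \<Rightarrow> bool" where
  "plane_convex \<Omega> M \<longleftrightarrow> compact M \<and> M \<subseteq> \<Omega> \<and> (\<forall>C\<in>components (- M). bounded C \<longrightarrow> \<not> C \<subseteq> \<Omega>)"

text \<open>The closure of a bounded component \<open>H\<close> of \<open>- M\<close> is compact and
  adds only points of \<open>M\<close>. Hence the copy of \<open>H\<close> in the extended plane is
  clopen in the complement of \<open>M\<close>, and the point \<open>\<infinity>\<close> cannot
  enlarge it.\<close>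

lemma holes_eq_components:
  assumes "compact M"
  shows "holes M = {H \<in> components (- M). bounded H}"
proof -
  define Y where "Y = subtopology Chat (topspace Chat - Some ` M)"
  have conn: "connectedin Y (Some ` H)" if "connected H" "H \<subseteq> - M" for H
    unfolding Y_def connectedin_subtopology
    using that connectedin_continuous_map_image[OF continuous_map_Some, of euclidean H] by auto
  have 1: "Some ` H \<in> connected_components_of Y" if "H \<in> components (- M)" "bounded H" for H
  proof -
    have H: "connected H" "H \<subseteq> - M" "H \<noteq> {}" "open H"
      using that(1) in_components_connected in_components_subset in_components_nonempty
        open_components[OF open_Compl[OF compact_imp_closed[OF assms]]] by blast+
    have cl: "closure H \<subseteq> H \<union> M"
      by (rule closure_component_subset[OF that(1) compact_imp_closed[OF assms]])
    have eq: "Some ` H = (topspace Chat - Some ` M) \<inter> Some ` closure H"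
      using cl H(2) closure_subset[of H] by auto
    have "closedin Chat (Some ` closure H)" using that(2) by simp
    then have clo: "closedin Y (Some ` H)"
      unfolding Y_def closedin_subtopology by (subst eq) blast
    have "openin Chat (Some ` H)" using H by simp
    then have ope: "openin Y (Some ` H)"
      unfolding Y_def openin_subtopology using H(2) by (intro exI[of _ "Some ` H"]) auto
    obtain c where c: "c \<in> connected_components_of Y" "Some ` H \<subseteq> c"
      using exists_connected_component_of_superset[OF conn[OF H(1,2)]] H(3) closedin_subset[OF clo]
      by (metis image_is_empty subset_empty null_topspace_iff_trivial)
    have "c = Some ` H"
      using connectedin_clopen_cases[OF connectedin_connected_components_of[OF c(1)] clo ope] c(2) H(3)
      by (auto simp: disjnt_iff)
    then show ?thesis using c by simp
  qed
  have 2: "H \<in> components (- M)" if "bounded H" "Some ` H \<in> connected_components_of Y" for H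
  proof -
    have ci: "connectedin Y (Some ` H)" using that(2) connectedin_connected_components_of by blast
    then have "connectedin Chat (Some ` H)" "Some ` H \<subseteq> topspace Chat - Some ` M"
      unfolding Y_def connectedin_subtopology by auto
    then have "connected H" "H \<subseteq> - M"
      using homeomorphic_map_connectedness_eq[OF
          embedding_map_Some[of "euclidean::complex topology", unfolded embedding_map_def], of H]
      by (auto simp: connectedin_subtopology)
    have "H \<noteq> {}" using nonempty_connected_components_of[OF that(2)] by auto
    then obtain x where "x \<in> H" by auto
    define C where "C = connected_component_set (- M) x"
    have C: "C \<in> components (- M)" using \<open>x \<in> H\<close> \<open>H \<subseteq> - M\<close> by (auto simp: C_def components_def)
    have "H \<subseteq> C" unfolding C_def using \<open>x \<in> H\<close> \<open>H \<subseteq> - M\<close> \<open>connected H\<close> by (simp add: connected_component_maximal)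
    have "connectedin Y (Some ` C)"
      using conn C in_components_connected in_components_subset by blast
    then have "Some ` C \<subseteq> Some ` H"
      by (rule connected_components_of_maximal[OF that(2)])
        (use \<open>H \<subseteq> C\<close> \<open>x \<in> H\<close> in \<open>auto simp: disjnt_iff\<close>)
    then have "Some ` C = Some ` H" using \<open>H \<subseteq> C\<close> by blast
    then have "C = H" by (simp add: inj_image_eq_iff)
    then show ?thesis using C by simp
  qed
  show ?thesis
    unfolding holes_def Chat_complement_components_def using 1 2 by (auto simp: Y_def)
qed

lemma convex_relative_iff: "convex_relative \<Omega> M \<longleftrightarrow> plane_convex \<Omega> M"
proof (cases "compact M")
  case True
  have "C \<inter> (UNIV - \<Omega>) \<noteq> {} \<longleftrightarrow> \<not> C \<subseteq> \<Omega>" for C by blast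
  then show ?thesis
    unfolding convex_relative_def plane_convex_def holes_eq_components[OF True] by blast
qed (simp add: convex_relative_def plane_convex_def)


text \<open>The complement of \<open>\<Omega>\<close> in the extended plane is compact Hausdorff, so
  its components are its quasi-components, and points of different components are separated by
  clopen sets. Avoiding the component of \<open>\<infinity>\<close> makes these sets compact in the
  plane; their relative openness becomes openness of \<open>\<Omega> \<union> P k\<close>.\<close>

lemma infinite_separated_points:
  assumes "domain_in_plane \<Omega>" and "\<not> finitely_connected \<Omega>"
  obtains p :: "nat \<Rightarrow> complex" and P :: "nat \<Rightarrow> complex set" where
    "\<And>k. k < m \<Longrightarrow> p k \<in> P k" "\<And>k. k < m \<Longrightarrow> compact (P k)" "\<And>k. k < m \<Longrightarrow> P k \<subseteq> - \<Omega>"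
    "\<And>k. k < m \<Longrightarrow> open (\<Omega> \<union> P k)"
    "\<And>k l. k < m \<Longrightarrow> l < m \<Longrightarrow> l \<noteq> k \<Longrightarrow> p l \<notin> P k"
proof -
  have op: "open \<Omega>" using assms by (auto simp: domain_in_plane_def)
  define Y where "Y = subtopology Chat (topspace Chat - Some ` \<Omega>)"
  have top: "topspace Y = topspace Chat - Some ` \<Omega>" by (auto simp: Y_def)
  have clY: "closedin Chat (topspace Chat - Some ` \<Omega>)"
    using op by (intro closedin_diff closedin_topspace) simp
  have cs: "compact_space Y" unfolding Y_def
    by (intro compact_space_subtopology closedin_compact_space clY) auto
  have hs: "Hausdorff_space Y" unfolding Y_def
    by (intro Hausdorff_space_subtopology)
      (simp add: Hausdorff_space_Alexandroff_compactification locally_compact_space_euclidean)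
  have "C \<in> quasi_components_of Y \<longleftrightarrow> C \<in> connected_components_of Y" if "closedin Y C" for C
    using compact_quasi_eq_connected_components_of[OF compact_imp_locally_compact_space[OF cs] hs]
      closedin_compact_space[OF cs that] by blast
  then have qc: "quasi_components_of Y = connected_components_of Y"
    using closedin_quasi_components_of closedin_connected_components_of by (metis subsetI subset_antisym)
  have "infinite (connected_components_of Y)"
    using assms(2) unfolding finitely_connected_def Chat_complement_components_def Y_def .
  then have inf: "infinite (quasi_components_of Y)"
    unfolding qc .
  have None_Y: "None \<in> topspace Y" by (auto simp: top)
  obtain \<C> where \<C>: "\<C> \<subseteq> quasi_components_of Y - {quasi_component_of_set Y None}" "card \<C> = m" "finite \<C>"
    using infinite_arbitrarily_large[OF infinite_remove[OF inf]] by metis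
  obtain f where f: "bij_betw f {..<m} \<C>"
    using \<C>(2,3) bij_betw_from_nat_into_finite by blast
  have "\<exists>z. Some z \<in> f k" if "k < m" for k
  proof -
    have fk: "f k \<in> quasi_components_of Y" "f k \<noteq> quasi_component_of_set Y None"
      using f that \<C>(1) by (auto simp: bij_betw_def)
    then obtain x where x: "x \<in> topspace Y" "f k = quasi_component_of_set Y x"
      by (auto simp: quasi_components_of_def)
    then have "x \<noteq> None" using fk by auto
    then obtain z where "x = Some z" by auto
    then show ?thesis using x by (intro exI[of _ z]) (simp add: quasi_component_of_refl)
  qed
  then obtain p where p: "\<And>k. k < m \<Longrightarrow> Some (p k) \<in> f k" by metis
  have fq: "f k = quasi_component_of_set Y (Some (p k))" if "k < m" for k
  proof -
    have "f k \<in> quasi_components_of Y" using f that \<C>(1) by (auto simp: bij_betw_def)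
    then obtain x where x: "x \<in> topspace Y" "f k = quasi_component_of_set Y x"
      by (auto simp: quasi_components_of_def)
    then have "quasi_component_of Y x (Some (p k))" using p[OF that] by auto
    then show ?thesis using x by (metis quasi_component_of_equiv)
  qed
  have pY: "Some (p k) \<in> topspace Y" if "k < m" for k
    using p[OF that] fq[OF that] by (auto dest: quasi_component_in_topspace)
  have nq: "\<not> quasi_component_of Y (Some (p k)) (Some (p l))" if "k < m" "l < m" "l \<noteq> k" for k l
  proof
    assume "quasi_component_of Y (Some (p k)) (Some (p l))"
    then have "f k = f l" using fq that by (metis quasi_component_of_equiv)
    then show False using f that by (auto simp: bij_betw_def inj_on_def)
  qed
  have nq': "\<not> quasi_component_of Y (Some (p k)) None" if "k < m" for k
  proof
    assume "quasi_component_of Y (Some (p k)) None"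
    then have "f k = quasi_component_of_set Y None" using fq that by (metis quasi_component_of_equiv)
    then show False using f that \<C>(1) by (auto simp: bij_betw_def)
  qed
  have "\<exists>T. closedin Y T \<and> openin Y T \<and> Some (p k) \<in> T \<and> q \<notin> T"
    if "k < m" "q = None \<or> (\<exists>l<m. l \<noteq> k \<and> q = Some (p l))" for k q
  proof -
    have q: "q \<in> topspace Y" using that(2) pY None_Y by auto
    have "\<not> quasi_component_of Y (Some (p k)) q" using that nq nq' by auto
    then show ?thesis unfolding quasi_component_of using q pY[OF that(1)] by blast
  qed
  then obtain T where T: "\<And>k q. k < m \<Longrightarrow> q = None \<or> (\<exists>l<m. l \<noteq> k \<and> q = Some (p l)) \<Longrightarrow>
      closedin Y (T k q) \<and> openin Y (T k q) \<and> Some (p k) \<in> T k q \<and> q \<notin> T k q"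
    by metis
  \<comment> \<open>Each clopen set \<open>T k q\<close> excludes one point \<open>q\<close>; the
    finite intersection excludes \<open>\<infinity>\<close> and all other \<open>p l\<close> at
    once.\<close>
  define Q where "Q k = (\<Inter>q\<in>insert None ((\<lambda>l. Some (p l)) ` ({..<m} - {k})). T k q)" for k
  have Q: "closedin Y (Q k)" "openin Y (Q k)" "Some (p k) \<in> Q k" "None \<notin> Q k"
    "\<And>l. l < m \<Longrightarrow> l \<noteq> k \<Longrightarrow> Some (p l) \<notin> Q k" if "k < m" for k
  proof -
    show "closedin Y (Q k)" unfolding Q_def
      by (rule closedin_Inter) (use T that in auto)
    show "openin Y (Q k)" unfolding Q_def
      by (rule openin_Inter) (use T that in auto)
    show "Some (p k) \<in> Q k" "None \<notin> Q k"
    "\<And>l. l < m \<Longrightarrow> l \<noteq> k \<Longrightarrow> Some (p l) \<notin> Q k"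
      unfolding Q_def using T[OF that] by auto
  qed
  define P where "P k = {z. Some z \<in> Q k}" for k
  have QP: "Q k = Some ` P k" if "k < m" for k
    using Q(4)[OF that] by (auto simp: P_def image_iff) (metis not_None_eq)
  show thesis
  proof
    fix k assume k: "k < m"
    show "p k \<in> P k" using Q(3)[OF k] by (simp add: P_def)
    have "closedin Chat (Q k)"
      using Q(1)[OF k] clY unfolding Y_def by (rule closedin_trans_full)
    then show "compact (P k)" by (simp add: QP[OF k])
    have "Q k \<subseteq> topspace Y" by (rule openin_subset[OF Q(2)[OF k]])
    then show sub: "P k \<subseteq> - \<Omega>" by (auto simp: P_def top)
    obtain G where G: "openin Chat G" "Q k = G \<inter> (topspace Chat - Some ` \<Omega>)"
      using Q(2)[OF k] unfolding Y_def openin_subtopology by blast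
    have "open {z. Some z \<in> G}"
      using openin_continuous_map_preimage[OF continuous_map_Some G(1)] by simp
    moreover have "\<Omega> \<union> P k = \<Omega> \<union> {z. Some z \<in> G}"
      using G(2) by (auto simp: P_def)
    ultimately show "open (\<Omega> \<union> P k)" using op by auto
    show "p l \<notin> P k" if "l < m" "l \<noteq> k" for l
      using Q(5)[OF k that] by (simp add: P_def)
  qed
qed

section \<open>Grid cycles\<close>

text \<open>Summing over the boundaries of the unit squares with corner in \<open>S\<close>: an edge shared by two
  of the squares cancels.\<close>

lemma sum_square_boundaries:
  fixes H V :: "int \<times> int \<Rightarrow> 'a::comm_ring_1"
  assumes "finite S"
  defines "ind \<equiv> \<lambda>q. if q \<in> S then 1 else 0"
  defines "T \<equiv> S \<union> (\<lambda>(i,j). (i,j+1)) ` S \<union> (\<lambda>(i,j). (i+1,j)) ` S"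
  shows "(\<Sum>(i,j)\<in>S. H (i,j) + V (i+1,j) - H (i,j+1) - V (i,j)) =
    (\<Sum>(i,j)\<in>T. (ind (i,j) - ind (i,j-1)) * H (i,j)) + (\<Sum>(i,j)\<in>T. (ind (i-1,j) - ind (i,j)) * V (i,j))"
proof -
  have T: "finite T" using assms by (auto simp: T_def)
  have 1: "(\<Sum>q\<in>S. F q) = (\<Sum>q\<in>T. ind q * F q)" for F :: "int \<times> int \<Rightarrow> 'a"
    by (rule sum.mono_neutral_cong_left) (use T in \<open>auto simp: T_def ind_def\<close>)
  have 2: "(\<Sum>(i,j)\<in>S. H (i,j+1)) = (\<Sum>(i,j)\<in>T. ind (i,j-1) * H (i,j))"
  proof -
    have "(\<Sum>(i,j)\<in>S. H (i,j+1)) = (\<Sum>q\<in>(\<lambda>(i,j). (i,j+1)) ` S. H q)"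
      by (subst sum.reindex) (auto simp: inj_on_def case_prod_unfold)
    also have "\<dots> = (\<Sum>(i,j)\<in>T. ind (i,j-1) * H (i,j))"
      by (rule sum.mono_neutral_cong_left) (use T in \<open>force simp: T_def ind_def image_iff\<close>)+
    finally show ?thesis .
  qed
  have 3: "(\<Sum>(i,j)\<in>S. V (i+1,j)) = (\<Sum>(i,j)\<in>T. ind (i-1,j) * V (i,j))"
  proof -
    have "(\<Sum>(i,j)\<in>S. V (i+1,j)) = (\<Sum>q\<in>(\<lambda>(i,j). (i+1,j)) ` S. V q)"
      by (subst sum.reindex) (auto simp: inj_on_def case_prod_unfold)
    also have "\<dots> = (\<Sum>(i,j)\<in>T. ind (i-1,j) * V (i,j))"
      by (rule sum.mono_neutral_cong_left) (use T in \<open>force simp: T_def ind_def image_iff\<close>)+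
    finally show ?thesis .
  qed
  have "(\<Sum>(i,j)\<in>S. H (i,j) + V (i+1,j) - H (i,j+1) - V (i,j)) =
    (\<Sum>(i,j)\<in>S. H (i,j)) + (\<Sum>(i,j)\<in>S. V (i+1,j)) - (\<Sum>(i,j)\<in>S. H (i,j+1)) - (\<Sum>(i,j)\<in>S. V (i,j))"
    by (simp add: sum.distrib sum_subtractf case_prod_unfold)
  then show ?thesis
    using 1[of H] 1[of V] 2 3
    by (simp add: case_prod_unfold algebra_simps sum.distrib sum_subtractf)
qed

lemma rectpath_contour_integral:
  assumes "continuous_on (path_image (rectpath (Complex x y) (Complex x' y'))) f" "x \<le> x'" "y \<le> y'"
  shows "contour_integral (rectpath (Complex x y) (Complex x' y')) f =
    contour_integral (linepath (Complex x y) (Complex x' y)) f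
    + contour_integral (linepath (Complex x' y) (Complex x' y')) f
    - contour_integral (linepath (Complex x y') (Complex x' y')) f
    - contour_integral (linepath (Complex x y) (Complex x y')) f"
proof -
  have img: "path_image (rectpath (Complex x y) (Complex x' y')) =
     closed_segment (Complex x y) (Complex x' y) \<union> closed_segment (Complex x' y) (Complex x' y')
     \<union> closed_segment (Complex x' y') (Complex x y') \<union> closed_segment (Complex x y') (Complex x y)"
    unfolding rectpath_def Let_def by (auto simp: path_image_join)
  note c = assms(1)[unfolded img]
  have i: "f contour_integrable_on linepath (Complex x y) (Complex x' y)"
    "f contour_integrable_on linepath (Complex x' y) (Complex x' y')"
    "f contour_integrable_on linepath (Complex x' y') (Complex x y')"
    "f contour_integrable_on linepath (Complex x y') (Complex x y)"
    by (rule contour_integrable_continuous_linepath, rule continuous_on_subset[OF c], blast)+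
  have r: "contour_integral (linepath (Complex x' y') (Complex x y')) f = - contour_integral (linepath (Complex x y') (Complex x' y')) f"
    "contour_integral (linepath (Complex x y') (Complex x y)) f = - contour_integral (linepath (Complex x y) (Complex x y')) f"
    by (rule contour_integral_reverse_linepath, rule continuous_on_subset[OF c], auto simp: closed_segment_commute)+
  show ?thesis
    unfolding rectpath_def Let_def
    using i by (simp add: r)
qed

lemma cauchy_kernel_integral_holomorphic:
  assumes "continuous_on (closed_segment a b) f"
  shows "(\<lambda>z. contour_integral (linepath a b) (\<lambda>w. f w / (w - z))) holomorphic_on - closed_segment a b"
proof -
  have "(\<lambda>z. contour_integral (linepath a b) (\<lambda>w. f w / (w - z))) field_differentiable at z"
    if "z \<notin> closed_segment a b" for z
  proof -
    have "((\<lambda>z. contour_integral (linepath a b) (\<lambda>w. f w / (w - z))) has_field_derivative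
      (of_nat 1 * contour_integral (linepath a b) (\<lambda>u. f u / (u - z)^(Suc 1)))) (at z)"
    proof (rule Cauchy_next_derivative(2)[where S = UNIV and k = 1 and B = "norm (b - a)"])
      show "((\<lambda>u. f u / (u - w) ^ 1) has_contour_integral
         contour_integral (linepath a b) (\<lambda>u. f u / (u - w))) (linepath a b)"
        if "w \<in> UNIV - path_image (linepath a b)" for w
        unfolding power_one_right
        by (intro has_contour_integral_integral contour_integrable_continuous_linepath
            continuous_intros assms) (use that in auto)
    qed (use assms that in \<open>auto simp: vector_derivative_linepath_within\<close>)
    then show ?thesis using field_differentiable_def by blast
  qed
  then show ?thesis
    by (simp add: holomorphic_on_def field_differentiable_at_within)
qed

text \<open>The union of the closed squares of a fine grid that meet \<open>M\<close> lies in \<open>U\<close>, and its boundary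
  edges avoid \<open>M\<close>.\<close>

lemma grid_cycle:
  fixes M U :: "complex set"
  assumes M: "compact M" and U: "open U" and MU: "M \<subseteq> U"
  obtains E :: "(bool \<times> int \<times> int) set" and a b c :: "bool \<times> int \<times> int \<Rightarrow> complex" where
    "finite E"
    "\<And>e. e \<in> E \<Longrightarrow> closed_segment (a e) (b e) \<subseteq> U - M"
    "\<And>f z. f holomorphic_on U \<Longrightarrow> z \<in> M \<Longrightarrow>
       (\<Sum>e\<in>E. c e * contour_integral (linepath (a e) (b e)) (\<lambda>w. f w / (w - z))) = 2 * of_real pi * \<i> * f z"
    "\<And>z. z \<notin> U \<Longrightarrow> (\<Sum>e\<in>E. c e * contour_integral (linepath (a e) (b e)) (\<lambda>w. 1 / (w - z))) = 0"
    "\<And>F. (\<Sum>e\<in>E. c e * (F (b e) - F (a e))) = 0"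
proof -
  obtain d where d: "d > 0" "(\<Union>x\<in>M. cball x d) \<subseteq> U"
    using compact_subset_open_imp_cball_epsilon_subset[OF M U MU] by blast
  \<comment> \<open>Two points of a square of side \<open>\<delta>\<close> differ by at most
    \<open>\<delta>\<close> in each coordinate, hence by at most \<open>2 * \<delta> = d\<close> in
    modulus.\<close>
  define \<delta> where "\<delta> = d / 2"
  have \<delta>: "\<delta> > 0" using d by (simp add: \<delta>_def)
  define v where "v i j = Complex (\<delta> * of_int i) (\<delta> * of_int j)" for i j :: int
  define Q where "Q = (\<lambda>(i,j). cbox (v i j) (v (i+1) (j+1)))"
  have inQ: "z \<in> Q (i,j) \<longleftrightarrow> \<delta> * of_int i \<le> Re z \<and> Re z \<le> \<delta> * (of_int i + 1)
      \<and> \<delta> * of_int j \<le> Im z \<and> Im z \<le> \<delta> * (of_int j + 1)" for z i j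
    by (auto simp: Q_def v_def in_cbox_complex_iff)
  have QU: "Q q \<subseteq> U" if "Q q \<inter> M \<noteq> {}" for q
  proof
    fix y assume y: "y \<in> Q q"
    from that obtain x where x: "x \<in> Q q" "x \<in> M" by blast
    obtain i j where q: "q = (i,j)" by (cases q)
    have "\<bar>Re (x - y)\<bar> \<le> \<delta>" "\<bar>Im (x - y)\<bar> \<le> \<delta>"
      using x(1) y by (auto simp: q inQ algebra_simps abs_le_iff)
    then have "cmod (x - y) \<le> d" using cmod_le[of "x - y"] by (simp add: \<delta>_def)
    then have "y \<in> cball x d" by (simp add: dist_norm)
    then show "y \<in> U" using d x by blast
  qed
  define S where "S = {q. Q q \<inter> M \<noteq> {}}"
  have fS: "finite S"
  proof -
    obtain B where B: "\<And>x. x \<in> M \<Longrightarrow> cmod x \<le> B"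
      using compact_imp_bounded[OF M] bounded_iff by blast
    define R where "R = \<lceil>B / \<delta>\<rceil> + 1"
    have "q \<in> {-R..R} \<times> {-R..R}" if "q \<in> S" for q
    proof -
      obtain i j where q: "q = (i,j)" by (cases q)
      from that obtain x where x: "x \<in> Q q" "x \<in> M" unfolding S_def by blast
      have xB: "\<bar>Re x\<bar> \<le> B" "\<bar>Im x\<bar> \<le> B"
        using B[OF x(2)] abs_Re_le_cmod[of x] abs_Im_le_cmod[of x] by linarith+
      have *: "k \<in> {-R..R}" if "\<delta> * of_int k \<le> t" "t \<le> \<delta> * (of_int k + 1)" "\<bar>t\<bar> \<le> B" for k :: int and t
      proof -
        have "\<delta> * of_int k \<le> B" "- B \<le> \<delta> * (of_int k + 1)" using that by linarith+
        then have "of_int k \<le> B / \<delta>" "- (B / \<delta>) \<le> of_int k + 1"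
          using \<delta> by (simp_all add: field_simps)
        then show ?thesis unfolding R_def by simp linarith
      qed
      show ?thesis using *[of i "Re x"] *[of j "Im x"] x xB by (auto simp: q inQ)
    qed
    then show ?thesis by (meson finite_SigmaI finite_atLeastAtMost_int finite_subset subsetI)
  qed
  define ind :: "int \<times> int \<Rightarrow> complex" where "ind q = (if q \<in> S then 1 else 0)" for q
  define T where "T = S \<union> (\<lambda>(i,j). (i,j+1)) ` S \<union> (\<lambda>(i,j). (i+1,j)) ` S"
  have fT: "finite T" using fS by (simp add: T_def)
  \<comment> \<open>An edge is named by its lower or left endpoint and by whether it is horizontal.
    With counterclockwise squares, \<open>c\<close> counts how often the edge is run through from
    \<open>a\<close> to \<open>b\<close>, minus how often it is run through backwards.\<close>
  define a where "a = (\<lambda>(h::bool,i,j). v i j)"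
  define b where "b = (\<lambda>(h,i,j). if h then v (i+1) j else v i (j+1))"
  define c where "c = (\<lambda>(h,i,j). if h then ind (i,j) - ind (i,j-1) else ind (i-1,j) - ind (i,j))"
  define E where "E = {e \<in> UNIV \<times> T. c e \<noteq> 0}"
  have fE: "finite E" using fT by (simp add: E_def)
  have W: "(\<Sum>e\<in>E. c e * W e) =
     (\<Sum>(i,j)\<in>S. W (True,i,j) + W (False,i+1,j) - W (True,i,j+1) - W (False,i,j))" for W
  proof -
    have "(\<Sum>e\<in>E. c e * W e) = (\<Sum>e\<in>UNIV \<times> T. c e * W e)"
      by (rule sum.mono_neutral_left) (use fT in \<open>auto simp: E_def\<close>)
    also have "\<dots> = (\<Sum>h\<in>UNIV. \<Sum>q\<in>T. c (h,q) * W (h,q))"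
      by (simp add: sum.cartesian_product)
    also have "\<dots> = (\<Sum>q\<in>T. c (True,q) * W (True,q)) + (\<Sum>q\<in>T. c (False,q) * W (False,q))"
      by (simp add: UNIV_bool)
    also have "\<dots> = (\<Sum>(i,j)\<in>S. W (True,i,j) + W (False,i+1,j) - W (True,i,j+1) - W (False,i,j))"
      using sum_square_boundaries[OF fS, of "\<lambda>q. W (True,q)" "\<lambda>q. W (False,q)"]
      by (simp add: c_def ind_def T_def case_prod_unfold)
    finally show ?thesis .
  qed
  \<comment> \<open>A nonzero coefficient means that exactly one of the two squares at the edge
    belongs to \<open>S\<close>: that one lies in \<open>U\<close>, and the other misses
    \<open>M\<close>.\<close>
  have seg: "closed_segment (a e) (b e) \<subseteq> U - M" if e: "e \<in> E" for e
  proof -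
    obtain h i j where hij: "e = (h,i,j)" by (cases e)
    obtain q q' where q: "q \<in> S" "q' \<notin> S" "closed_segment (a e) (b e) \<subseteq> Q q" "closed_segment (a e) (b e) \<subseteq> Q q'"
    proof (cases h)
      case True
      have *: "closed_segment (a e) (b e) \<subseteq> Q (i,j)" "closed_segment (a e) (b e) \<subseteq> Q (i,j-1)"
        unfolding Q_def prod.case using \<delta>
        by (intro closed_segment_subset convex_box;
            simp add: hij True a_def b_def in_cbox_complex_iff v_def)+
      have "ind (i,j) \<noteq> ind (i,j-1)" using e by (auto simp: E_def hij c_def True)
      then show thesis using * that by (auto simp: ind_def split: if_splits)
    next
      case False
      have *: "closed_segment (a e) (b e) \<subseteq> Q (i,j)" "closed_segment (a e) (b e) \<subseteq> Q (i-1,j)"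
        unfolding Q_def prod.case using \<delta>
        by (intro closed_segment_subset convex_box;
            simp add: hij False a_def b_def in_cbox_complex_iff v_def)+
      have "ind (i-1,j) \<noteq> ind (i,j)" using e by (auto simp: E_def hij c_def False)
      then show thesis using * that by (auto simp: ind_def split: if_splits)
    qed
    then show ?thesis using QU unfolding S_def by blast
  qed
  define R where "R = (\<lambda>(i,j). rectpath (v i j) (v (i+1) (j+1)))"
  have Rimg: "path_image (R (i,j)) = Q (i,j) - box (v i j) (v (i+1) (j+1))" for i j
    unfolding R_def Q_def prod.case
    by (rule path_image_rectpath_cbox_minus_box) (use \<delta> in \<open>auto simp: v_def\<close>)
  have Rval: "valid_path (R q)" "pathfinish (R q) = pathstart (R q)" for q
    by (auto simp: R_def case_prod_unfold)
  have edge_sum: "(\<Sum>e\<in>E. c e * contour_integral (linepath (a e) (b e)) g) = (\<Sum>q\<in>S. contour_integral (R q) g)"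
    if "\<And>q. q \<in> S \<Longrightarrow> continuous_on (path_image (R q)) g" for g
    unfolding W
  proof (rule sum.cong[OF refl])
    fix q assume q: "q \<in> S"
    obtain i j where ij: "q = (i,j)" by (cases q)
    show "(case q of (i, j) \<Rightarrow> contour_integral (linepath (a (True, i, j)) (b (True, i, j))) g
        + contour_integral (linepath (a (False, i + 1, j)) (b (False, i + 1, j))) g
        - contour_integral (linepath (a (True, i, j + 1)) (b (True, i, j + 1))) g
        - contour_integral (linepath (a (False, i, j)) (b (False, i, j))) g) = contour_integral (R q) g"
      using rectpath_contour_integral[of "\<delta> * of_int i" "\<delta> * of_int j" "\<delta> * of_int (i+1)" "\<delta> * of_int (j+1)" g]
        that[OF q] \<delta> by (simp add: ij R_def a_def b_def v_def)
  qed
  have outside: "contour_integral (R q) (\<lambda>w. f w / (w - z)) = 0"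
    if "q \<in> S" "f holomorphic_on U" "z \<notin> Q q" for q f z
  proof (rule contour_integral_unique, rule Cauchy_theorem_convex_simple[where S = "Q q"])
    show "(\<lambda>w. f w / (w - z)) holomorphic_on Q q"
      using that QU by (intro holomorphic_intros holomorphic_on_subset[OF that(2)]) (auto simp: S_def)
    show "path_image (R q) \<subseteq> Q q" by (cases q) (auto simp: Rimg)
  qed (auto simp: Q_def Rval convex_box case_prod_unfold)
  have cont: "continuous_on (path_image (R q)) (\<lambda>w. f w / (w - z))"
    if "q \<in> S" "f holomorphic_on U" "z \<notin> path_image (R q)" for q f z
  proof -
    have "path_image (R q) \<subseteq> U" using that(1) QU[of q] by (cases q) (auto simp: S_def Rimg)
    then have "continuous_on (path_image (R q)) f"
      using that(2) by (meson continuous_on_subset holomorphic_on_imp_continuous_on)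
    then show ?thesis using that(3) by (intro continuous_intros) auto
  qed
  have off: "(\<Sum>e\<in>E. c e * contour_integral (linepath (a e) (b e)) (\<lambda>w. f w / (w - z))) = 0"
    if "f holomorphic_on U" "z \<notin> U" for f z
  proof -
    have "z \<notin> Q q" if "q \<in> S" for q using QU[of q] that \<open>z \<notin> U\<close> by (auto simp: S_def)
    moreover from this have "z \<notin> path_image (R q)" if "q \<in> S" for q
      using that by (cases q) (auto simp: Rimg)
    ultimately show ?thesis
      using cont[OF _ that(1)] outside[OF _ that(1)] by (subst edge_sum) (simp_all add: sum.neutral)
  qed
  have inside: "(\<Sum>e\<in>E. c e * contour_integral (linepath (a e) (b e)) (\<lambda>w. f w / (w - z))) = 2 * of_real pi * \<i> * f z"
    if f: "f holomorphic_on U" and q: "(i,j) \<in> S" and z: "z \<in> box (v i j) (v (i+1) (j+1))" for f z i j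
  proof -
    have zin: "\<delta> * of_int i < Re z" "Re z < \<delta> * (of_int i + 1)" "\<delta> * of_int j < Im z" "Im z < \<delta> * (of_int j + 1)"
      using z by (auto simp: v_def in_box_complex_iff)
    have other: "z \<notin> Q q'" if "q' \<noteq> (i,j)" for q'
    proof
      assume "z \<in> Q q'"
      obtain i' j' where q': "q' = (i',j')" by (cases q')
      have eq: "k = l" if "\<delta> * of_int k < t" "t < \<delta> * (of_int k + 1)" "\<delta> * of_int l \<le> t" "t \<le> \<delta> * (of_int l + 1)" for k l :: int and t
      proof -
        have "\<delta> * of_int k < \<delta> * (of_int l + 1)" "\<delta> * of_int l < \<delta> * (of_int k + 1)" using that by linarith+
        then have "real_of_int k < of_int l + 1" "real_of_int l < of_int k + 1" using \<delta> by simp_all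
        then show "k = l" by linarith
      qed
      have "i = i'" "j = j'" using \<open>z \<in> Q q'\<close> zin eq unfolding q' inQ by blast+
      then show False using that q' by simp
    qed
    have nz: "z \<notin> path_image (R q')" for q'
    proof (cases "q' = (i,j)")
      case False
      then show ?thesis using other by (cases q') (auto simp: Rimg)
    qed (use z in \<open>auto simp: Rimg\<close>)
    have "(\<Sum>e\<in>E. c e * contour_integral (linepath (a e) (b e)) (\<lambda>w. f w / (w - z)))
      = (\<Sum>q\<in>S. contour_integral (R q) (\<lambda>w. f w / (w - z)))"
      by (rule edge_sum) (rule cont[OF _ f nz])
    also have "\<dots> = (\<Sum>q\<in>S. if q = (i,j) then contour_integral (R q) (\<lambda>w. f w / (w - z)) else 0)"
      by (rule sum.cong[OF refl]) (simp add: outside[OF _ f other] del: split_paired_All)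
    also have "\<dots> = contour_integral (R (i,j)) (\<lambda>w. f w / (w - z))"
      using q fS by simp
    also have "\<dots> = 2 * of_real pi * \<i> * f z"
    proof (rule contour_integral_unique)
      have "((\<lambda>w. f w / (w - z)) has_contour_integral (2*pi * \<i> * winding_number (R (i,j)) z * f z)) (R (i,j))"
      proof (rule Cauchy_integral_formula_convex_simple[where S = "Q (i,j)"])
        show "f holomorphic_on Q (i,j)" using f QU q unfolding S_def by (blast intro: holomorphic_on_subset)
        show "z \<in> interior (Q (i,j))" using z by (simp add: Q_def)
        show "path_image (R (i,j)) \<subseteq> Q (i,j) - {z}" using z by (auto simp: Rimg)
      qed (auto simp: Rval, auto simp: Q_def convex_box)
      then show "((\<lambda>w. f w / (w - z)) has_contour_integral 2 * of_real pi * \<i> * f z) (R (i,j))"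
        using winding_number_rectpath[OF z] by (simp add: R_def)
    qed
    finally show ?thesis .
  qed
  show thesis
  proof (rule that[OF fE seg])
    show "(\<Sum>e\<in>E. c e * (F (b e) - F (a e))) = 0" for F
      unfolding W by (auto simp: a_def b_def intro!: sum.neutral)
    show "(\<Sum>e\<in>E. c e * contour_integral (linepath (a e) (b e)) (\<lambda>w. 1 / (w - z))) = 0" if "z \<notin> U" for z
      using off[of "\<lambda>_. 1" z] that by simp
    fix f z assume f: "f holomorphic_on U" and z: "z \<in> M"
    \<comment> \<open>A point of \<open>M\<close> may lie on the boundary of a square, where
      \<open>inside\<close> does not apply. Since both sides of the identity are continuous off the
      edges in \<open>E\<close>, it extends from the open square \<open>X\<close> to such a
      point.\<close>
    define G where "G z = (\<Sum>e\<in>E. c e * contour_integral (linepath (a e) (b e)) (\<lambda>w. f w / (w - z)))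
      - 2 * of_real pi * \<i> * f z" for z
    define i where "i = \<lfloor>Re z / \<delta>\<rfloor>"
    define j where "j = \<lfloor>Im z / \<delta>\<rfloor>"
    have *: "\<delta> * of_int \<lfloor>t / \<delta>\<rfloor> \<le> t" "t \<le> \<delta> * (of_int \<lfloor>t / \<delta>\<rfloor> + 1)" for t
    proof -
      define k where "k = \<lfloor>t / \<delta>\<rfloor>"
      have "of_int k \<le> t / \<delta>" "t / \<delta> \<le> of_int k + 1" unfolding k_def by linarith+
      then show "\<delta> * of_int \<lfloor>t / \<delta>\<rfloor> \<le> t" "t \<le> \<delta> * (of_int \<lfloor>t / \<delta>\<rfloor> + 1)"
        unfolding k_def[symmetric] using \<delta> by (simp_all add: pos_le_divide_eq pos_divide_le_eq mult.commute)
    qed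
    have zQ: "z \<in> Q (i,j)" using *[of "Re z"] *[of "Im z"] by (simp add: inQ i_def j_def)
    then have q: "(i,j) \<in> S" using z by (auto simp: S_def)
    define X where "X = box (v i j) (v (i+1) (j+1))"
    have "X \<noteq> {}" using \<delta> by (auto simp: X_def box_ne_empty v_def Basis_complex_def algebra_simps)
    then have "z \<in> closure X" using zQ by (simp add: X_def Q_def closure_box)
    then obtain x where x: "\<And>n. x n \<in> X" "x \<longlonglongrightarrow> z" unfolding closure_sequential by blast
    have XU: "X \<subseteq> U" using QU[of "(i,j)"] q by (auto simp: S_def Q_def X_def dest: subsetD[OF box_subset_cbox])
    have eM: "X \<inter> closed_segment (a e) (b e) = {}" if "e \<in> E" for e
    proof (rule ccontr)
      assume "X \<inter> closed_segment (a e) (b e) \<noteq> {}"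
      then obtain y where y: "y \<in> X" "y \<in> closed_segment (a e) (b e)" by auto
      obtain h k l where hkl: "e = (h,k,l)" by (cases e)
      have X: "\<delta> * of_int i < Re y" "Re y < \<delta> * (of_int i + 1)" "\<delta> * of_int j < Im y" "Im y < \<delta> * (of_int j + 1)"
        using y(1) by (auto simp: X_def v_def in_box_complex_iff)
      have no: False if "\<delta> * of_int m < \<delta> * of_int k" "\<delta> * of_int k < \<delta> * (of_int m + 1)" for k m :: int
      proof -
        have "real_of_int m < of_int k" "real_of_int k < of_int m + 1" using that \<delta> by simp_all
        then have "m < k" "k < m + 1" by linarith+
        then show False by simp
      qed
      have "Im y = \<delta> * of_int l" if h
        using y(2) that by (simp add: hkl a_def b_def v_def closed_segment_same_Im)
      moreover have "Re y = \<delta> * of_int k" if "\<not> h"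
        using y(2) that by (simp add: hkl a_def b_def v_def closed_segment_same_Re)
      ultimately show False using X no by (cases h) auto
    qed
    have "continuous_on (insert z X) G"
      unfolding G_def
    proof (intro continuous_intros)
      show "continuous_on (insert z X) f"
        using f XU z MU by (meson continuous_on_subset holomorphic_on_imp_continuous_on insert_subset subsetD)
      show "continuous_on (insert z X) (\<lambda>z. contour_integral (linepath (a e) (b e)) (\<lambda>w. f w / (w - z)))" if "e \<in> E" for e
      proof (rule continuous_on_subset[OF holomorphic_on_imp_continuous_on[OF cauchy_kernel_integral_holomorphic]])
        show "continuous_on (closed_segment (a e) (b e)) f"
          using f seg[OF that] by (meson Diff_subset continuous_on_subset holomorphic_on_imp_continuous_on order_trans)
        show "insert z X \<subseteq> - closed_segment (a e) (b e)"
          using eM[OF that] seg[OF that] z by blast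
      qed
    qed
    then have "(\<lambda>n. G (x n)) \<longlonglongrightarrow> G z"
      using x unfolding continuous_on_sequentially o_def by blast
    moreover have "G (x n) = 0" for n
      using inside[OF f q] x(1)[of n] by (simp add: G_def X_def)
    ultimately have "G z = 0" by (simp add: LIMSEQ_const_iff)
    then show "(\<Sum>e\<in>E. c e * contour_integral (linepath (a e) (b e)) (\<lambda>w. f w / (w - z))) = 2 * of_real pi * \<i> * f z"
      by (simp add: G_def)
  qed
qed

section \<open>Runge's theorem\<close>

text \<open>The error depends on the oscillation of \<open>g\<close> alone, so that one
  \<open>n\<close> serves a whole family of integrands.\<close>

lemma left_riemann_sum:
  fixes g :: "real \<Rightarrow> complex"
  assumes g: "continuous_on {0..1} g" and n: "n > 0"
    and osc: "\<And>s t. s \<in> {0..1} \<Longrightarrow> t \<in> {0..1} \<Longrightarrow> \<bar>s - t\<bar> \<le> 1 / real n \<Longrightarrow> norm (g s - g t) \<le> e"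
  shows "norm (integral {0..1} g - (\<Sum>k<n. g (real k / real n) / of_nat n)) \<le> e"
proof -
  have "norm (integral {0..real m / real n} g - (\<Sum>k<m. g (real k / real n) / of_nat n)) \<le> real m * e / real n"
    if "m \<le> n" for m
    using that
  proof (induction m)
    case 0 then show ?case by simp
  next
    case (Suc m)
    let ?s = "real m / real n" and ?t = "real (Suc m) / real n"
    have st: "0 \<le> ?s" "?s \<le> ?t" "?t \<le> 1" using Suc.prems n by (auto simp: field_simps)
    have ts: "?t - ?s = 1 / real n" using n by (simp add: field_simps)
    have int: "g integrable_on {x..y}" if "0 \<le> x" "y \<le> 1" for x y
      by (rule integrable_continuous_real, rule continuous_on_subset[OF g]) (use that in auto)
    have "integral {?s..?t} (\<lambda>x. g x - g ?s) = integral {?s..?t} g - integral {?s..?t} (\<lambda>x. g ?s)"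
      by (rule integral_diff) (use int st in auto)
    also have "integral {?s..?t} (\<lambda>x. g ?s) = g ?s / of_nat n"
      using st(2) ts by (simp add: scaleR_conv_of_real del: of_nat_Suc)
    finally have eq: "integral {?s..?t} g - g ?s / of_nat n = integral {?s..?t} (\<lambda>x. g x - g ?s)" by simp
    have "norm (integral {?s..?t} (\<lambda>x. g x - g ?s)) \<le> e * (?t - ?s)"
    proof (rule integral_bound)
      show "continuous_on {?s..?t} (\<lambda>x. g x - g ?s)"
        by (intro continuous_intros continuous_on_subset[OF g]) (use st in auto)
      show "norm (g x - g ?s) \<le> e" if "x \<in> {?s..?t}" for x
      proof (rule osc)
        have x: "?s \<le> x" "x \<le> ?t" using that by auto
        then have "0 \<le> x" "x \<le> 1" using st by linarith+
        then show "x \<in> {0..1}" by simp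
        have "?s \<le> 1" using st by linarith
        then show "?s \<in> {0..1}" using st(1) by simp
        show "\<bar>x - ?s\<bar> \<le> 1 / real n" using x ts by linarith
      qed
    qed (use st in simp)
    then have 1: "norm (integral {?s..?t} g - g ?s / of_nat n) \<le> e / real n"
      unfolding eq ts by simp
    have "integral {0..?t} g = integral {0..?s} g + integral {?s..?t} g"
      by (rule Henstock_Kurzweil_Integration.integral_combine[symmetric]) (use st int in auto)
    then have "integral {0..?t} g - (\<Sum>k<Suc m. g (real k / real n) / of_nat n) =
      (integral {0..?s} g - (\<Sum>k<m. g (real k / real n) / of_nat n)) + (integral {?s..?t} g - g ?s / of_nat n)"
      by simp
    also have "norm \<dots> \<le> real m * e / real n + e / real n"
      using norm_triangle_mono[OF _ 1] Suc by (metis Suc_leD)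
    also have "real m * e / real n + e / real n = real (Suc m) * e / real n"
      by (simp add: add_divide_distrib distrib_right)
    finally show ?case .
  qed
  from this[of n] show ?thesis using n by simp
qed

text \<open>Each term of a Riemann sum of the Cauchy integral is, as a function of \<open>z\<close>,
  a multiple of a simple pole on the segment. Uniform continuity of the integrand on the product of
  \<open>{0..1}\<close> and \<open>M\<close> makes one subdivision good for all
  \<open>z\<close>.\<close>

lemma cauchy_kernel_integral_simple_poles:
  assumes f: "continuous_on (closed_segment a b) f" and M: "compact M" "M \<inter> closed_segment a b = {}"
    and e: "e > (0::real)"
  obtains n :: nat and q l :: "nat \<Rightarrow> complex" where "\<And>j. j < n \<Longrightarrow> l j \<notin> M"
    "\<And>z. z \<in> M \<Longrightarrow> norm ((\<Sum>j<n. q j * (1 / (z - l j))) - contour_integral (linepath a b) (\<lambda>w. f w / (w - z))) < e"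
proof -
  define F where "F = (\<lambda>(t,z). f (linepath a b t) / (linepath a b t - z) * (b - a))"
  have lp: "linepath a b t \<in> closed_segment a b" if "t \<in> {0..1}" for t
    using that by (metis imageI path_image_def path_image_linepath)
  have "continuous_on ({0..1} \<times> M) F"
    unfolding F_def case_prod_unfold
    by (intro continuous_intros continuous_on_compose2[OF f] continuous_on_compose2[OF continuous_on_linepath[of UNIV a b]])
      (use lp M(2) in auto)
  then have "uniformly_continuous_on ({0..1} \<times> M) F"
    by (intro compact_uniformly_continuous compact_Times M) auto
  then obtain d where d: "d > 0" "\<And>p q. p \<in> {0..1} \<times> M \<Longrightarrow> q \<in> {0..1} \<times> M \<Longrightarrow> dist q p < d \<Longrightarrow> dist (F q) (F p) < e / 2"
    unfolding uniformly_continuous_on_def using e by (metis half_gt_zero)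
  obtain n where n: "n > 0" "1 / real n < d"
    using d(1) by (metis nat_approx_posE neq0_conv of_nat_Suc zero_less_Suc)
  define l where "l k = linepath a b (real k / real n)" for k
  define q where "q k = - f (l k) * (b - a) / of_nat n" for k
  show thesis
  proof (rule that[of n l q])
    show "l k \<notin> M" if "k < n" for k
      using lp[of "real k / real n"] M(2) that by (auto simp: l_def)
    fix z assume z: "z \<in> M"
    have "norm (integral {0..1} (\<lambda>t. F (t,z)) - (\<Sum>k<n. F (real k / real n, z) / of_nat n)) \<le> e / 2"
    proof (rule left_riemann_sum[OF _ n(1)])
      show "continuous_on {0..1} (\<lambda>t. F (t,z))"
        by (rule continuous_on_compose2[OF \<open>continuous_on ({0..1} \<times> M) F\<close>])
          (use z in \<open>auto intro!: continuous_intros\<close>)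
      show "norm (F (s,z) - F (t,z)) \<le> e / 2" if "s \<in> {0..1}" "t \<in> {0..1}" "\<bar>s - t\<bar> \<le> 1 / real n" for s t
        using d(2)[of "(t,z)" "(s,z)"] that z n(2) by (auto simp: dist_Pair_Pair dist_norm)
    qed
    moreover have "contour_integral (linepath a b) (\<lambda>w. f w / (w - z)) = integral {0..1} (\<lambda>t. F (t,z))"
      by (simp add: contour_integral_integral F_def)
    moreover have "F (real k / real n, z) / of_nat n = q k * (1 / (z - l k))" for k
      by (simp add: F_def q_def l_def divide_simps) (simp add: algebra_simps)
    ultimately show "norm ((\<Sum>k<n. q k * (1 / (z - l k))) - contour_integral (linepath a b) (\<lambda>w. f w / (w - z))) < e"
      using e by (simp add: norm_minus_commute)
  qed
qed

text \<open>Membership in the uniform closure on \<open>M\<close> of the functions holomorphic on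
  \<open>\<Omega>\<close>. For compact \<open>M\<close> in \<open>\<Omega>\<close> this closure is
  an algebra, and Runge's theorem is obtained by generating enough of its members.\<close>

definition approximable :: "complex set \<Rightarrow> complex set \<Rightarrow> (complex \<Rightarrow> complex) \<Rightarrow> bool" where
  "approximable \<Omega> M f \<longleftrightarrow> (\<forall>e>0. \<exists>g. g holomorphic_on \<Omega> \<and> (\<forall>z\<in>M. norm (g z - f z) < e))"

lemma approximable_holomorphic: "f holomorphic_on \<Omega> \<Longrightarrow> approximable \<Omega> M f"
  unfolding approximable_def by (intro allI impI exI[of _ f]) auto

lemma approximable_limit:
  assumes "\<And>e. e > 0 \<Longrightarrow> \<exists>h. approximable \<Omega> M h \<and> (\<forall>z\<in>M. norm (h z - f z) < e)"
  shows "approximable \<Omega> M f"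
  unfolding approximable_def
proof (intro allI impI)
  fix e :: real assume "e > 0"
  then obtain h where h: "approximable \<Omega> M h" "\<And>z. z \<in> M \<Longrightarrow> norm (h z - f z) < e / 2"
    using assms[of "e/2"] by auto
  obtain g where g: "g holomorphic_on \<Omega>" "\<And>z. z \<in> M \<Longrightarrow> norm (g z - h z) < e / 2"
    using h(1) \<open>e > 0\<close> unfolding approximable_def by (metis half_gt_zero)
  have "norm (g z - f z) < e" if "z \<in> M" for z
    using norm_triangle_ineq[of "g z - h z" "h z - f z"] g(2)[OF that] h(2)[OF that] by simp
  with g show "\<exists>g. g holomorphic_on \<Omega> \<and> (\<forall>z\<in>M. norm (g z - f z) < e)" by blast
qed

lemma approximable_cong: "approximable \<Omega> M f \<Longrightarrow> (\<And>z. z \<in> M \<Longrightarrow> f z = h z) \<Longrightarrow> approximable \<Omega> M h"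
  unfolding approximable_def by simp

lemma approximable_add:
  assumes "approximable \<Omega> M f" "approximable \<Omega> M h"
  shows "approximable \<Omega> M (\<lambda>z. f z + h z)"
  unfolding approximable_def
proof (intro allI impI)
  fix e :: real assume "e > 0"
  then have "e / 2 > 0" by simp
  then obtain g1 g2 where g: "g1 holomorphic_on \<Omega>" "\<And>z. z \<in> M \<Longrightarrow> norm (g1 z - f z) < e / 2"
    "g2 holomorphic_on \<Omega>" "\<And>z. z \<in> M \<Longrightarrow> norm (g2 z - h z) < e / 2"
    using assms unfolding approximable_def by metis
  have "norm ((g1 z + g2 z) - (f z + h z)) < e" if "z \<in> M" for z
    using norm_triangle_ineq[of "g1 z - f z" "g2 z - h z"] g(2,4)[OF that] by (simp add: algebra_simps)
  then show "\<exists>g. g holomorphic_on \<Omega> \<and> (\<forall>z\<in>M. norm (g z - (f z + h z)) < e)"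
    using g by (intro exI[of _ "\<lambda>z. g1 z + g2 z"]) (auto intro!: holomorphic_intros)
qed

lemma approximable_bounded:
  assumes "approximable \<Omega> M f" "compact M" "M \<subseteq> \<Omega>"
  obtains B where "B > 0" "\<And>z. z \<in> M \<Longrightarrow> norm (f z) \<le> B"
proof -
  obtain g where g: "g holomorphic_on \<Omega>" "\<And>z. z \<in> M \<Longrightarrow> norm (g z - f z) < 1"
    using assms(1) unfolding approximable_def by (metis zero_less_one)
  have "compact (g ` M)"
    using g(1) assms by (meson compact_continuous_image continuous_on_subset holomorphic_on_imp_continuous_on)
  then obtain B where B: "B > 0" "\<And>z. z \<in> M \<Longrightarrow> norm (g z) \<le> B"
    using compact_imp_bounded bounded_pos by (metis imageI)
  show thesis
  proof
    show "B + 1 > 0" using B by simp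
    show "norm (f z) \<le> B + 1" if "z \<in> M" for z
      using norm_triangle_ineq2[of "f z" "g z"] g(2)[OF that] B(2)[OF that] by (simp add: norm_minus_commute)
  qed
qed

lemma approximable_mult:
  assumes fh: "approximable \<Omega> M f" "approximable \<Omega> M h" and M: "compact M" "M \<subseteq> \<Omega>"
  shows "approximable \<Omega> M (\<lambda>z. f z * h z)"
  unfolding approximable_def
proof (intro allI impI)
  fix e :: real assume e: "e > 0"
  obtain A where A: "A > 0" "\<And>z. z \<in> M \<Longrightarrow> norm (f z) \<le> A"
    using approximable_bounded[OF fh(1) M] by metis
  obtain g2 where g2: "g2 holomorphic_on \<Omega>" "\<And>z. z \<in> M \<Longrightarrow> norm (g2 z - h z) < e / (2 * A)"
    using fh(2) e A(1) unfolding approximable_def by (metis divide_pos_pos mult_pos_pos zero_less_numeral)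
  obtain B where B: "B > 0" "\<And>z. z \<in> M \<Longrightarrow> norm (g2 z) \<le> B"
    using approximable_bounded[OF approximable_holomorphic[OF g2(1)] M] by metis
  obtain g1 where g1: "g1 holomorphic_on \<Omega>" "\<And>z. z \<in> M \<Longrightarrow> norm (g1 z - f z) < e / (2 * B)"
    using fh(1) e B(1) unfolding approximable_def by (metis divide_pos_pos mult_pos_pos zero_less_numeral)
  have "norm (g1 z * g2 z - f z * h z) < e" if z: "z \<in> M" for z
  proof -
    have "g1 z * g2 z - f z * h z = (g1 z - f z) * g2 z + f z * (g2 z - h z)" by (simp add: algebra_simps)
    also have "norm \<dots> \<le> norm (g1 z - f z) * norm (g2 z) + norm (f z) * norm (g2 z - h z)"
      by (metis norm_mult norm_triangle_ineq)
    also have "\<dots> \<le> norm (g1 z - f z) * B + A * norm (g2 z - h z)"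
      using A(2)[OF z] B(2)[OF z] by (intro add_mono mult_mono) (use A B in auto)
    also have "\<dots> < e / (2 * B) * B + A * (e / (2 * A))"
      using g1(2)[OF z] g2(2)[OF z] A(1) B(1) by (intro add_strict_mono mult_strict_right_mono mult_strict_left_mono) auto
    also have "\<dots> = e" using A(1) B(1) by (simp add: field_simps)
    finally show ?thesis .
  qed
  then show "\<exists>g. g holomorphic_on \<Omega> \<and> (\<forall>z\<in>M. norm (g z - f z * h z) < e)"
    using g1 g2 by (intro exI[of _ "\<lambda>z. g1 z * g2 z"]) (auto intro!: holomorphic_intros)
qed

lemma approximable_power:
  assumes "approximable \<Omega> M f" "compact M" "M \<subseteq> \<Omega>"
  shows "approximable \<Omega> M (\<lambda>z. f z ^ n)"
proof (induction n)
  case 0 show ?case by (simp add: approximable_holomorphic)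
next
  case (Suc n) then show ?case using approximable_mult[OF assms(1) Suc assms(2,3)] by simp
qed

lemma approximable_sum:
  assumes "\<And>i. i \<in> I \<Longrightarrow> approximable \<Omega> M (f i)"
  shows "approximable \<Omega> M (\<lambda>z. \<Sum>i\<in>I. f i z)"
  using assms
proof (induction I rule: infinite_finite_induct)
  case (insert i I)
  then have "approximable \<Omega> M (\<lambda>z. f i z + (\<Sum>i\<in>I. f i z))" by (intro approximable_add) auto
  with insert show ?case by simp
qed (simp_all add: approximable_holomorphic)

lemma approximable_cmult:
  assumes "approximable \<Omega> M f" "compact M" "M \<subseteq> \<Omega>"
  shows "approximable \<Omega> M (\<lambda>z. c * f z)"
  by (intro approximable_mult assms approximable_holomorphic) auto

text \<open>The bound 1/2 makes the geometric series converge uniformly on \<open>M\<close>.\<close>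

lemma approximable_geometric:
  assumes q: "approximable \<Omega> M q" and M: "compact M" "M \<subseteq> \<Omega>" and half: "\<And>z. z \<in> M \<Longrightarrow> norm (q z) \<le> 1/2"
  shows "approximable \<Omega> M (\<lambda>z. 1 / (1 - q z))"
proof (rule approximable_limit)
  fix e :: real assume e: "e > 0"
  obtain n where n: "(1/2) ^ n < e / 2"
    using real_arch_pow_inv[of "e/2" "1/2"] e by auto
  have "norm ((\<Sum>k<n. q z ^ k) - 1 / (1 - q z)) < e" if z: "z \<in> M" for z
  proof -
    have 1: "norm (1 - q z) \<ge> 1/2"
      using norm_triangle_ineq2[of 1 "q z"] half[OF z] by simp
    then have ne: "q z \<noteq> 1" by auto
    have "(\<Sum>k<n. q z ^ k) - 1 / (1 - q z) = - (q z ^ n / (1 - q z))"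
      using ne by (simp add: sum_gp_strict diff_divide_distrib)
    then have "norm ((\<Sum>k<n. q z ^ k) - 1 / (1 - q z)) = norm (q z) ^ n / norm (1 - q z)"
      by (simp add: norm_divide norm_power)
    also have "\<dots> \<le> (1/2) ^ n / (1/2)"
      using half[OF z] 1 by (intro frac_le power_mono) auto
    also have "\<dots> < e" using n by simp
    finally show ?thesis .
  qed
  then show "\<exists>h. approximable \<Omega> M h \<and> (\<forall>z\<in>M. norm (h z - 1 / (1 - q z)) < e)"
    by (intro exI[of _ "\<lambda>z. \<Sum>k<n. q z ^ k"] conjI approximable_sum approximable_power q M) auto
qed

text \<open>Expansion of \<open>1 / (z - b')\<close> in powers of \<open>(b' - b) / (z - b)\<close>,
  which has norm at most 1/2 on \<open>M\<close>.\<close>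

lemma approximable_move_pole:
  assumes M: "compact M" "M \<subseteq> \<Omega>" and b: "approximable \<Omega> M (\<lambda>z. 1 / (z - b))"
    and near: "\<And>z. z \<in> M \<Longrightarrow> 2 * norm (b' - b) \<le> norm (z - b)" and bM: "b \<notin> M"
  shows "approximable \<Omega> M (\<lambda>z. 1 / (z - b'))"
proof -
  have "approximable \<Omega> M (\<lambda>z. 1 / (z - b) * (1 / (1 - (b' - b) * (1 / (z - b)))))"
  proof (intro approximable_mult[OF b] approximable_geometric approximable_cmult[OF b] M)
    show "norm ((b' - b) * (1 / (z - b))) \<le> 1/2" if "z \<in> M" for z
    proof -
      have "norm (z - b) > 0" using bM that by auto
      then show ?thesis using near[OF that] by (simp add: norm_mult norm_divide pos_divide_le_eq)
    qed
  qed
  then show ?thesis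
  proof (rule approximable_cong)
    fix z assume z: "z \<in> M"
    have "z \<noteq> b" using bM z by auto
    then show "1 / (z - b) * (1 / (1 - (b' - b) * (1 / (z - b)))) = 1 / (z - b')"
      by (simp add: field_simps)
  qed
qed

text \<open>Pole pushing: approximability is inherited by nearby poles and hence spreads through the
  component of \<open>- M\<close> that contains \<open>w\<close>. It starts at a point outside
  \<open>\<Omega>\<close> if the component is bounded, and otherwise at a point far away, where
  \<open>1 / (z - b)\<close> is a power series in \<open>z / b\<close>.\<close>

lemma approximable_simple_pole:
  assumes M: "plane_convex \<Omega> M" and w: "w \<notin> M"
  shows "approximable \<Omega> M (\<lambda>z. 1 / (z - w))"
proof -
  have cM: "compact M" "M \<subseteq> \<Omega>" using M by (auto simp: plane_convex_def)
  define C where "C = connected_component_set (- M) w"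
  have C: "C \<in> components (- M)" "w \<in> C" "C \<subseteq> - M" "connected C"
    using w by (auto simp: C_def components_def connected_component_subset)
  obtain b where b: "b \<in> C" "approximable \<Omega> M (\<lambda>z. 1 / (z - b))"
  proof (cases "bounded C")
    case True
    then obtain b where b: "b \<in> C" "b \<notin> \<Omega>" using M C(1) unfolding plane_convex_def by blast
    then have "(\<lambda>z. 1 / (z - b)) holomorphic_on \<Omega>" by (intro holomorphic_intros) auto
    then show thesis using that b approximable_holomorphic by blast
  next
    case False
    obtain B where B: "B > 0" "\<And>z. z \<in> M \<Longrightarrow> norm z \<le> B"
      using compact_imp_bounded[OF cM(1)] bounded_pos by metis
    obtain b where b: "b \<in> C" "norm b > 2 * B"
      using False unfolding bounded_iff by (meson not_le)
    then have b0: "b \<noteq> 0" using B by auto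
    have "approximable \<Omega> M (\<lambda>z. (- 1 / b) * (1 / (1 - z / b)))"
    proof (intro approximable_cmult approximable_geometric cM approximable_holomorphic)
      show "(\<lambda>z. z / b) holomorphic_on \<Omega>" using b0 by (intro holomorphic_intros) auto
      show "norm (z / b) \<le> 1/2" if "z \<in> M" for z
        using B(2)[OF that] b by (simp add: norm_divide field_simps b0)
    qed
    then have "approximable \<Omega> M (\<lambda>z. 1 / (z - b))"
    proof (rule approximable_cong)
      fix z assume "z \<in> M"
      then have "z \<noteq> b" using C(3) b by auto
      then show "(- 1 / b) * (1 / (1 - z / b)) = 1 / (z - b)"
        using b0 by (simp add: divide_simps)
    qed
    then show thesis using that b by blast
  qed
  show ?thesis
  proof (rule connected_induction_simple[OF C(4) b(1) C(2), where P = "\<lambda>b. approximable \<Omega> M (\<lambda>z. 1 / (z - b))"])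
    show "approximable \<Omega> M (\<lambda>z. 1 / (z - b))" by fact
    fix a assume a: "a \<in> C"
    show "\<exists>T. openin (top_of_set C) T \<and> a \<in> T \<and> (\<forall>x\<in>T. \<forall>y\<in>T. approximable \<Omega> M (\<lambda>z. 1 / (z - x)) \<longrightarrow> approximable \<Omega> M (\<lambda>z. 1 / (z - y)))"
    proof -
      obtain r where r: "r > 0" "\<And>z. z \<in> M \<Longrightarrow> r \<le> dist a z"
        using separate_point_closed[OF compact_imp_closed[OF cM(1)], of a] a C(3) by blast
      \<comment> \<open>Poles within \<open>r / 6\<close> of \<open>a\<close> are less than
        \<open>r / 3\<close> apart, while \<open>M\<close> stays more than
        \<open>2 * (r / 3)\<close> away from them; this is the ratio needed for moving a
        pole.\<close>
      have "approximable \<Omega> M (\<lambda>z. 1 / (z - y))"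
        if x: "x \<in> C \<inter> ball a (r/6)" and y: "y \<in> C \<inter> ball a (r/6)" and ap: "approximable \<Omega> M (\<lambda>z. 1 / (z - x))" for x y
      proof (rule approximable_move_pole[OF cM ap])
        show "x \<notin> M" using x C(3) by auto
        fix z assume z: "z \<in> M"
        have "dist y x < r/3" using x y dist_triangle3[of y x a] by simp
        moreover have "dist z x > 2 * (r / 3)"
          using r(1) r(2)[OF z] x dist_triangle[of a z x] by (auto simp: dist_commute)
        ultimately show "2 * norm (y - x) \<le> norm (z - x)" by (simp add: dist_norm)
      qed
      moreover have "openin (top_of_set C) (C \<inter> ball a (r/6))" "a \<in> C \<inter> ball a (r/6)"
        using a r(1) by (auto simp: openin_open_Int)
      ultimately show ?thesis by blast
    qed
  qed
qed

text \<open>On \<open>M\<close>, Cauchy's formula over a grid cycle writes \<open>f\<close> through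
  Cauchy integrals over segments off \<open>M\<close>. These are uniform limits of simple poles off
  \<open>M\<close>, which convexity makes approximable.\<close>

theorem runge:
  assumes M: "plane_convex \<Omega> M" and U: "open U" "M \<subseteq> U" and f: "f holomorphic_on U"
  shows "approximable \<Omega> M f"
proof -
  have cM: "compact M" "M \<subseteq> \<Omega>" using M by (auto simp: plane_convex_def)
  obtain E :: "(bool \<times> int \<times> int) set" and a b c where E: "finite E"
    "\<And>e. e \<in> E \<Longrightarrow> closed_segment (a e) (b e) \<subseteq> U - M"
    and cauchy: "\<And>f z. f holomorphic_on U \<Longrightarrow> z \<in> M \<Longrightarrow>
       (\<Sum>e\<in>E. c e * contour_integral (linepath (a e) (b e)) (\<lambda>w. f w / (w - z))) = 2 * of_real pi * \<i> * f z"
    by (rule grid_cycle[OF cM(1) U]) (rule that; assumption)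
  have "approximable \<Omega> M (\<lambda>z. contour_integral (linepath (a e) (b e)) (\<lambda>w. f w / (w - z)))" if "e \<in> E" for e
  proof (rule approximable_limit)
    fix \<epsilon> :: real assume "\<epsilon> > 0"
    have seg: "closed_segment (a e) (b e) \<subseteq> U - M" using E(2)[OF that] .
    have c1: "continuous_on (closed_segment (a e) (b e)) f"
      using f seg by (meson Diff_subset continuous_on_subset holomorphic_on_imp_continuous_on order_trans)
    have c2: "M \<inter> closed_segment (a e) (b e) = {}" using seg by blast
    obtain n :: nat and q l where l: "\<And>j. j < n \<Longrightarrow> l j \<notin> M"
      and n: "\<And>z. z \<in> M \<Longrightarrow> norm ((\<Sum>j<n. q j * (1 / (z - l j))) -
         contour_integral (linepath (a e) (b e)) (\<lambda>w. f w / (w - z))) < \<epsilon>"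
      by (rule cauchy_kernel_integral_simple_poles[OF c1 cM(1) c2 \<open>\<epsilon> > 0\<close>]) (rule that; assumption)
    have "approximable \<Omega> M (\<lambda>z. \<Sum>j<n. q j * (1 / (z - l j)))"
      by (intro approximable_sum approximable_cmult cM approximable_simple_pole[OF M] l) simp
    then show "\<exists>h. approximable \<Omega> M h \<and> (\<forall>z\<in>M. norm (h z - contour_integral (linepath (a e) (b e)) (\<lambda>w. f w / (w - z))) < \<epsilon>)"
      using n by (intro exI[of _ "\<lambda>z. \<Sum>j<n. q j * (1 / (z - l j))"]) simp
  qed
  then have "approximable \<Omega> M (\<lambda>z. 1 / (2 * of_real pi * \<i>) *
      (\<Sum>e\<in>E. c e * contour_integral (linepath (a e) (b e)) (\<lambda>w. f w / (w - z))))"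
    by (intro approximable_cmult approximable_sum cM) auto
  then show ?thesis
    by (rule approximable_cong) (simp add: cauchy[OF f])
qed

section \<open>Cauchy's theorem for combinations of loops\<close>

text \<open>Gaussian elimination, by induction on the equations. It yields combinations of loops
  without winding numbers and combinations of poles without periods along given loops.\<close>

lemma homogeneous_system:
  fixes A :: "'i \<Rightarrow> 'j \<Rightarrow> 'a::field"
  assumes "finite J" "finite K" "card J < card K"
  obtains c where "\<exists>k\<in>K. c k \<noteq> 0" "\<And>j. j \<in> J \<Longrightarrow> (\<Sum>k\<in>K. c k * A k j) = 0"
proof -
  have "\<exists>c. (\<exists>k\<in>K. c k \<noteq> 0) \<and> (\<forall>j\<in>J. (\<Sum>k\<in>K. c k * A k j) = 0)"
    using assms
  proof (induction J arbitrary: K A rule: finite_induct)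
    case empty
    then have "K \<noteq> {}" by auto
    then show ?case by (intro exI[of _ "\<lambda>_. 1"]) auto
  next
    case (insert j J)
    show ?case
    proof (cases "\<forall>k\<in>K. A k j = 0")
      case True
      obtain c where "\<exists>k\<in>K. c k \<noteq> 0" "\<forall>j\<in>J. (\<Sum>k\<in>K. c k * A k j) = 0"
        using insert.IH[of K A] insert.prems insert.hyps by auto
      with True show ?thesis by (intro exI[of _ c]) auto
    next
      case False
      then obtain k0 where k0: "k0 \<in> K" "A k0 j \<noteq> 0" by auto
      define K' where "K' = K - {k0}"
      define B where "B k i = A k i - A k j / A k0 j * A k0 i" for k i
      have K': "finite K'" "card J < card K'"
        using insert.prems insert.hyps k0 by (auto simp: K'_def card_Diff_singleton)
      obtain c where c: "\<exists>k\<in>K'. c k \<noteq> 0" "\<forall>j\<in>J. (\<Sum>k\<in>K'. c k * B k j) = 0"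
        using insert.IH[OF K', of B] by auto
      define c' where "c' = c(k0 := - (\<Sum>k\<in>K'. c k * A k j / A k0 j))"
      have split: "(\<Sum>k\<in>K. c' k * A k i) = (\<Sum>k\<in>K'. c k * B k i)" for i
      proof -
        have "(\<Sum>k\<in>K. c' k * A k i) = c' k0 * A k0 i + (\<Sum>k\<in>K'. c' k * A k i)"
          using insert.prems k0(1) unfolding K'_def by (simp add: sum.remove)
        also have "(\<Sum>k\<in>K'. c' k * A k i) = (\<Sum>k\<in>K'. c k * A k i)"
          by (rule sum.cong) (auto simp: K'_def c'_def)
        also have "c' k0 * A k0 i = - ((\<Sum>k\<in>K'. c k * A k j / A k0 j) * A k0 i)"
          by (simp add: c'_def)
        also have "\<dots> = - (\<Sum>k\<in>K'. c k * (A k j / A k0 j * A k0 i))"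
          by (simp add: sum_distrib_right mult.assoc)
        finally show ?thesis
          by (simp add: B_def right_diff_distrib sum_subtractf)
      qed
      have "(\<Sum>k\<in>K'. c k * B k j) = 0" using k0 by (simp add: B_def)
      then have "\<forall>i\<in>insert j J. (\<Sum>k\<in>K. c' k * A k i) = 0" using c(2) split by auto
      moreover have "\<exists>k\<in>K. c' k \<noteq> 0" using c(1) by (auto simp: K'_def c'_def)
      ultimately show ?thesis by blast
    qed
  qed
  then show thesis using that by blast
qed

section \<open>Periods of holomorphic functions along loops\<close>

definition loop_in :: "complex set \<Rightarrow> (real \<Rightarrow> complex) \<Rightarrow> bool" where
  "loop_in S \<gamma> \<longleftrightarrow> valid_path \<gamma> \<and> pathfinish \<gamma> = pathstart \<gamma> \<and> path_image \<gamma> \<subseteq> S"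

lemma loop_in_mono: "loop_in S \<gamma> \<Longrightarrow> S \<subseteq> T \<Longrightarrow> loop_in T \<gamma>"
  by (auto simp: loop_in_def)

definition indep_loops :: "complex set \<Rightarrow> nat \<Rightarrow> (nat \<Rightarrow> real \<Rightarrow> complex) \<Rightarrow> bool" where
  "indep_loops \<Omega> m \<gamma> \<longleftrightarrow> (\<forall>c. (\<forall>h. h holomorphic_on \<Omega> \<longrightarrow> (\<Sum>k<m. c k * contour_integral (\<gamma> k) h) = 0)
     \<longrightarrow> (\<forall>k<m. c k = 0))"

text \<open>The loops stay in \<open>G\<close>, but their periods are tested on functions
  holomorphic on all of \<open>\<Omega>\<close>. The intersection with \<open>\<Omega>\<close> is
  there because \<open>G\<close> will be a component of \<open>- K\<close>, which may leave
  \<open>\<Omega>\<close>.\<close>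

definition rich :: "complex set \<Rightarrow> nat \<Rightarrow> complex set \<Rightarrow> bool" where
  "rich \<Omega> m G \<longleftrightarrow> (\<exists>\<gamma>. (\<forall>k<m. loop_in (G \<inter> \<Omega>) (\<gamma> k)) \<and> indep_loops \<Omega> m \<gamma>)"

text \<open>On an open set around the loops every period is bounded by a constant times the supremum
  norm, so relations between periods survive uniform limits.\<close>

lemma contour_integral_combination_limit:
  fixes \<gamma> :: "nat \<Rightarrow> real \<Rightarrow> complex"
  assumes S: "open S" and loops: "\<And>k. k < m \<Longrightarrow> loop_in S (\<gamma> k)" and h: "h holomorphic_on S"
    and ap: "\<And>e. e > 0 \<Longrightarrow> \<exists>R. R holomorphic_on S \<and> (\<forall>z\<in>S. norm (R z - h z) \<le> e) \<and>
      (\<Sum>k<m. c k * contour_integral (\<gamma> k) R) = 0"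
  shows "(\<Sum>k<m. c k * contour_integral (\<gamma> k) h) = 0"
proof -
  have "\<exists>L. 0 < L \<and> (\<forall>f B. f holomorphic_on S \<and> (\<forall>z \<in> S. norm(f z) \<le> B)
               \<longrightarrow> norm(contour_integral (\<gamma> k) f) \<le> L*B)" if "k < m" for k
    using contour_integral_bound_exists[OF S] loops[OF that] by (auto simp: loop_in_def)
  then obtain L where L: "\<And>k. k < m \<Longrightarrow> 0 < L k" "\<And>k f B. k < m \<Longrightarrow> f holomorphic_on S \<Longrightarrow>
      (\<And>z. z \<in> S \<Longrightarrow> norm (f z) \<le> B) \<Longrightarrow> norm (contour_integral (\<gamma> k) f) \<le> L k * B"
    by metis
  define C where "C = (\<Sum>k<m. norm (c k) * L k)"
  have C: "C \<ge> 0" unfolding C_def by (intro sum_nonneg mult_nonneg_nonneg) (auto intro: less_imp_le L)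
  have int: "f contour_integrable_on \<gamma> k" if "f holomorphic_on S" "k < m" for f k
    using contour_integrable_holomorphic_simple[OF that(1) S] loops[OF that(2)] by (auto simp: loop_in_def)
  have "norm (\<Sum>k<m. c k * contour_integral (\<gamma> k) h) \<le> 0 + e" if "e > 0" for e
  proof -
    obtain R where R: "R holomorphic_on S" "\<And>z. z \<in> S \<Longrightarrow> norm (R z - h z) \<le> e / (C + 1)"
      "(\<Sum>k<m. c k * contour_integral (\<gamma> k) R) = 0"
      using ap[of "e / (C+1)"] \<open>e > 0\<close> C by auto
    have "(\<Sum>k<m. c k * contour_integral (\<gamma> k) h) =
      (\<Sum>k<m. c k * contour_integral (\<gamma> k) h) - (\<Sum>k<m. c k * contour_integral (\<gamma> k) R)"
      using R(3) by simp
    also have "\<dots> = (\<Sum>k<m. c k * contour_integral (\<gamma> k) (\<lambda>z. h z - R z))"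
      unfolding sum_subtractf[symmetric]
      by (rule sum.cong) (auto simp: contour_integral_diff int h R(1) algebra_simps)
    also have "norm \<dots> \<le> (\<Sum>k<m. norm (c k) * (L k * (e / (C + 1))))"
    proof (rule sum_norm_le)
      fix k assume "k \<in> {..<m}"
      then have "norm (contour_integral (\<gamma> k) (\<lambda>z. h z - R z)) \<le> L k * (e / (C + 1))"
        by (intro L holomorphic_intros h R) (auto simp: R(2) norm_minus_commute)
      then show "norm (c k * contour_integral (\<gamma> k) (\<lambda>z. h z - R z)) \<le> norm (c k) * (L k * (e / (C + 1)))"
        unfolding norm_mult by (rule mult_left_mono) simp
    qed
    also have "\<dots> = C * (e / (C + 1))"
      unfolding C_def by (simp only: sum_distrib_right mult.assoc)
    also have "\<dots> \<le> e" using C \<open>e > 0\<close> by (simp add: field_simps)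
    finally show ?thesis by simp
  qed
  then have "norm (\<Sum>k<m. c k * contour_integral (\<gamma> k) h) \<le> 0" by (rule field_le_epsilon)
  then show ?thesis by simp
qed

text \<open>The homology form of Cauchy's theorem, for formal sums of loops with complex
  coefficients. Near the loops \<open>h\<close> is a limit of combinations of poles \<open>w\<close>
  off a compact set \<open>M\<close> that contains all points of nonzero total winding number; the
  period of \<open>1 / (z - w)\<close> is a multiple of that number and so vanishes.\<close>

lemma Cauchy_theorem_cycle:
  fixes \<gamma> :: "nat \<Rightarrow> real \<Rightarrow> complex"
  assumes V: "open V" and loops: "\<And>k. k < m \<Longrightarrow> loop_in V (\<gamma> k)" and h: "h holomorphic_on V"
    and zero: "\<And>w. w \<notin> V \<Longrightarrow> (\<Sum>k<m. c k * winding_number (\<gamma> k) w) = 0"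
  shows "(\<Sum>k<m. c k * contour_integral (\<gamma> k) h) = 0"
proof -
  define P where "P = (\<Union>k<m. path_image (\<gamma> k))"
  have lp: "path (\<gamma> k)" "valid_path (\<gamma> k)" "pathfinish (\<gamma> k) = pathstart (\<gamma> k)" "path_image (\<gamma> k) \<subseteq> V" if "k < m" for k
    using loops[OF that] by (auto simp: loop_in_def valid_path_imp_path)
  have P: "compact P" "P \<subseteq> V"
    unfolding P_def using lp(1,4) by (blast intro!: compact_UN compact_path_image)+
  define W where "W w = (\<Sum>k<m. c k * winding_number (\<gamma> k) w)" for w
  define Z where "Z = {w. w \<notin> P \<and> W w \<noteq> 0}"
  \<comment> \<open>The total winding number \<open>W\<close> is locally constant off
    \<open>P\<close> and zero near infinity, which makes \<open>P \<union> Z\<close> closed and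
    bounded.\<close>
  have "open (- (P \<union> Z))"
    unfolding open_contains_ball
  proof
    fix w assume w: "w \<in> - (P \<union> Z)"
    then have "w \<in> - P" "open (- P)" using P(1) by (auto simp: compact_imp_closed open_Compl)
    then obtain r where r: "r > 0" "ball w r \<subseteq> - P" by (meson open_contains_ball)
    have "W y = W w" if "y \<in> ball w r" for y
      unfolding W_def
    proof (rule sum.cong[OF refl])
      fix k assume "k \<in> {..<m}"
      then have "winding_number (\<gamma> k) y = winding_number (\<gamma> k) w"
        using r that by (intro winding_number_eq[where S = "ball w r"] lp) (auto simp: P_def)
      then show "c k * winding_number (\<gamma> k) y = c k * winding_number (\<gamma> k) w" by simp
    qed
    then have "ball w r \<subseteq> - (P \<union> Z)" using r(2) w by (auto simp: Z_def)
    then show "\<exists>e>0. ball w e \<subseteq> - (P \<union> Z)" using r(1) by blast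
  qed
  then have "closed (P \<union> Z)" by (simp add: closed_def)
  moreover have "bounded (P \<union> Z)"
  proof -
    have "\<exists>B. \<forall>z. B \<le> norm z \<longrightarrow> winding_number (\<gamma> k) z = 0" if "k < m" for k
      using winding_number_zero_at_infinity lp[OF that] by blast
    then obtain B where B: "\<And>k z. k < m \<Longrightarrow> B k \<le> norm z \<Longrightarrow> winding_number (\<gamma> k) z = 0" by metis
    have "Z \<subseteq> ball 0 (Max (insert 0 (B ` {..<m})) + 1)"
    proof
      fix z assume "z \<in> Z"
      then have "\<exists>k<m. winding_number (\<gamma> k) z \<noteq> 0"
        unfolding Z_def W_def using sum.neutral[of "{..<m}" "\<lambda>k. c k * winding_number (\<gamma> k) z"] by fastforce
      then obtain k where "k < m" "norm z < B k" using B by force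
      moreover have "B k \<le> Max (insert 0 (B ` {..<m}))"
        using \<open>k < m\<close> by (intro Max_ge) auto
      ultimately have "norm z < Max (insert 0 (B ` {..<m})) + 1" by linarith
      then show "z \<in> ball 0 (Max (insert 0 (B ` {..<m})) + 1)" by (simp only: mem_ball_0)
    qed
    then show ?thesis using P(1) by (meson bounded_Un bounded_ball bounded_subset compact_imp_bounded)
  qed
  ultimately have PZ: "compact (P \<union> Z)" by (simp add: compact_eq_bounded_closed)
  obtain d where d: "d > 0" "(\<Union>x\<in>P. cball x d) \<subseteq> V"
    using compact_subset_open_imp_cball_epsilon_subset[OF P(1) V P(2)] by blast
  \<comment> \<open>\<open>M\<close> contains \<open>Z\<close>, so that poles off \<open>M\<close>
    have no period, and a neighbourhood \<open>S\<close> of the loops, so that approximation on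
    \<open>M\<close> is uniform on an open set.\<close>
  define M where "M = (\<Union>x\<in>P. cball x d) \<union> (P \<union> Z)"
  define S where "S = (\<Union>x\<in>P. ball x d)"
  have S: "open S" "P \<subseteq> S" "S \<subseteq> M" using d(1) by (auto simp: S_def M_def)
  have ZV: "Z \<subseteq> V" using zero by (auto simp: Z_def W_def)
  have M: "compact M" "M \<subseteq> V"
    unfolding M_def using PZ d(2) P(2) ZV compact_minkowski_sum_cball[OF P(1), of d]
    by (auto intro!: compact_Un)
  have loopS: "loop_in S (\<gamma> k)" if "k < m" for k
    using loops[OF that] S(2) that by (auto simp: loop_in_def P_def)
  obtain E :: "(bool \<times> int \<times> int) set" and a b cc where E: "finite E"
    "\<And>e. e \<in> E \<Longrightarrow> closed_segment (a e) (b e) \<subseteq> V - M"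
    and cauchy: "\<And>f z. f holomorphic_on V \<Longrightarrow> z \<in> M \<Longrightarrow>
       (\<Sum>e\<in>E. cc e * contour_integral (linepath (a e) (b e)) (\<lambda>w. f w / (w - z))) = 2 * of_real pi * \<i> * f z"
    by (rule grid_cycle[OF M(1) V M(2)]) (rule that; assumption)
  define I where "I e z = contour_integral (linepath (a e) (b e)) (\<lambda>w. h w / (w - z))" for e z
  have int: "f contour_integrable_on \<gamma> k" if "f holomorphic_on S" "k < m" for f k
    using contour_integrable_holomorphic_simple[OF that(1) S(1)] loopS[OF that(2)] by (auto simp: loop_in_def)
  have pole: "(\<Sum>k<m. c k * contour_integral (\<gamma> k) (\<lambda>z. 1 / (z - w))) = 0" if "w \<notin> M" for w
  proof -
    have w: "w \<notin> P" "W w = 0" using that by (auto simp: M_def Z_def)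
    have "contour_integral (\<gamma> k) (\<lambda>z. 1 / (z - w)) = 2 * pi * \<i> * winding_number (\<gamma> k) w" if "k < m" for k
      using winding_number_valid_path[of "\<gamma> k" w] lp[OF that] w(1) that by (auto simp: P_def)
    then have "(\<Sum>k<m. c k * contour_integral (\<gamma> k) (\<lambda>z. 1 / (z - w))) = 2 * pi * \<i> * W w"
      unfolding W_def sum_distrib_left by (intro sum.cong) auto
    then show ?thesis using w by simp
  qed
  have I_holo: "I e holomorphic_on S" and I_zero: "(\<Sum>k<m. c k * contour_integral (\<gamma> k) (I e)) = 0" if e: "e \<in> E" for e
  proof -
    have seg: "closed_segment (a e) (b e) \<subseteq> V - M" using E(2)[OF that] .
    have c1: "continuous_on (closed_segment (a e) (b e)) h"
      using h seg by (meson Diff_subset continuous_on_subset holomorphic_on_imp_continuous_on order_trans)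
    have c2: "M \<inter> closed_segment (a e) (b e) = {}" using seg by blast
    show I_holo: "I e holomorphic_on S"
      unfolding I_def using c2 S(3)
      by (intro holomorphic_on_subset[OF cauchy_kernel_integral_holomorphic[OF c1]]) blast
    show "(\<Sum>k<m. c k * contour_integral (\<gamma> k) (I e)) = 0"
    proof (rule contour_integral_combination_limit[OF S(1) loopS I_holo])
      fix \<epsilon> :: real assume "\<epsilon> > 0"
      obtain n :: nat and q l where lM: "\<And>j. j < n \<Longrightarrow> l j \<notin> M"
        and n: "\<And>z. z \<in> M \<Longrightarrow> norm ((\<Sum>j<n. q j * (1 / (z - l j))) -
           contour_integral (linepath (a e) (b e)) (\<lambda>w. h w / (w - z))) < \<epsilon>"
        by (rule cauchy_kernel_integral_simple_poles[OF c1 M(1) c2 \<open>\<epsilon> > 0\<close>]) (rule that; assumption)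
      define R where "R z = (\<Sum>j<n. q j * (1 / (z - l j)))" for z
      have hol1: "(\<lambda>z. 1 / (z - l j)) holomorphic_on S" if "j < n" for j
        using lM[OF that] S(3) by (intro holomorphic_intros) auto
      have "R holomorphic_on S"
        unfolding R_def by (intro holomorphic_on_sum holomorphic_on_mult holomorphic_on_const hol1) auto
      moreover have "norm (R z - I e z) \<le> \<epsilon>" if "z \<in> S" for z
        using n[of z] that S(3) unfolding R_def I_def by (blast intro: less_imp_le)
      moreover have "(\<Sum>k<m. c k * contour_integral (\<gamma> k) R) = 0"
      proof -
        have "contour_integral (\<gamma> k) R = (\<Sum>j<n. q j * contour_integral (\<gamma> k) (\<lambda>z. 1 / (z - l j)))" if "k < m" for k
          unfolding R_def
          by (rule contour_integral_unique, intro has_contour_integral_sum has_contour_integral_lmul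
              has_contour_integral_integral int hol1 that) auto
        then have "(\<Sum>k<m. c k * contour_integral (\<gamma> k) R) =
          (\<Sum>k<m. \<Sum>j<n. q j * (c k * contour_integral (\<gamma> k) (\<lambda>z. 1 / (z - l j))))"
          by (intro sum.cong) (auto simp: sum_distrib_left mult_ac)
        also have "\<dots> = (\<Sum>j<n. q j * (\<Sum>k<m. c k * contour_integral (\<gamma> k) (\<lambda>z. 1 / (z - l j))))"
          by (subst sum.swap) (simp add: sum_distrib_left)
        also have "\<dots> = 0" using pole[OF lM] by (intro sum.neutral) auto
        finally show ?thesis .
      qed
      ultimately show "\<exists>R. R holomorphic_on S \<and> (\<forall>z\<in>S. norm (R z - I e z) \<le> \<epsilon>) \<and>
          (\<Sum>k<m. c k * contour_integral (\<gamma> k) R) = 0" by blast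
    qed
  qed
  define r where "r e = cc e / (2 * of_real pi * \<i>)" for e
  have "contour_integral (\<gamma> k) h = (\<Sum>e\<in>E. r e * contour_integral (\<gamma> k) (I e))" if k: "k < m" for k
  proof -
    have "((\<lambda>z. \<Sum>e\<in>E. r e * I e z) has_contour_integral (\<Sum>e\<in>E. r e * contour_integral (\<gamma> k) (I e))) (\<gamma> k)"
      by (intro has_contour_integral_sum has_contour_integral_lmul has_contour_integral_integral int I_holo E k)
    then have "(h has_contour_integral (\<Sum>e\<in>E. r e * contour_integral (\<gamma> k) (I e))) (\<gamma> k)"
    proof (rule has_contour_integral_eq)
      fix z assume "z \<in> path_image (\<gamma> k)"
      then have "z \<in> M" using S k by (auto simp: P_def)
      then have "(\<Sum>e\<in>E. cc e * I e z) = 2 * of_real pi * \<i> * h z"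
        unfolding I_def by (rule cauchy[OF h])
      moreover have "(\<Sum>e\<in>E. r e * I e z) = (\<Sum>e\<in>E. cc e * I e z) / (2 * of_real pi * \<i>)"
        by (simp add: r_def sum_divide_distrib)
      ultimately show "(\<Sum>e\<in>E. r e * I e z) = h z" by simp
    qed
    then show ?thesis by (rule contour_integral_unique)
  qed
  then have "(\<Sum>k<m. c k * contour_integral (\<gamma> k) h) =
      (\<Sum>k<m. \<Sum>e\<in>E. r e * (c k * contour_integral (\<gamma> k) (I e)))"
    by (intro sum.cong) (auto simp: sum_distrib_left mult_ac)
  also have "\<dots> = (\<Sum>e\<in>E. r e * (\<Sum>k<m. c k * contour_integral (\<gamma> k) (I e)))"
    by (subst sum.swap) (simp add: sum_distrib_left)
  also have "\<dots> = 0" using I_zero by (intro sum.neutral) auto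
  finally show ?thesis .
qed

section \<open>Independent loops\<close>

lemma loop_in_compose:
  assumes "open \<Omega>" "\<phi> holomorphic_on \<Omega>" "S \<subseteq> \<Omega>" "loop_in S \<gamma>"
  shows "loop_in (\<phi> ` S) (\<phi> \<circ> \<gamma>)"
  using assms valid_path_compose_holomorphic[of \<gamma> \<phi> \<Omega>]
  by (auto simp: loop_in_def path_image_compose pathstart_compose pathfinish_compose)

text \<open>With \<open>\<psi>\<close> inverse to \<open>\<phi>\<close>, the integral of
  \<open>g = (h \<circ> \<psi>) * deriv \<psi>\<close> along \<open>\<phi> \<circ> \<gamma>\<close>
  is that of \<open>h\<close> along \<open>\<gamma>\<close>. A priori \<open>g\<close> lives on the
  image of \<open>\<Omega>\<close>; Runge's theorem on the convex image of \<open>L\<close> supplies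
  approximants on \<open>\<Omega>\<close>. So every relation between the image loops is one between
  the original loops.\<close>

lemma rich_transfer:
  assumes \<Omega>: "open \<Omega>" and \<phi>: "\<phi> holomorphic_on \<Omega>" "\<phi> ` \<Omega> \<subseteq> \<Omega>" "inj_on \<phi> \<Omega>"
    and L: "plane_convex \<Omega> (\<phi> ` L)" "L \<subseteq> \<Omega>" and S: "open S" "S \<subseteq> L"
    and loops: "\<And>k. k < m \<Longrightarrow> loop_in S (\<gamma> k)" and ind: "indep_loops \<Omega> m \<gamma>"
    and G: "\<phi> ` S \<subseteq> G"
  shows "rich \<Omega> m G"
proof -
  have SO: "S \<subseteq> \<Omega>" using S L by auto
  have loop': "loop_in (\<phi> ` S) (\<phi> \<circ> \<gamma> k)" if "k < m" for k
    by (rule loop_in_compose[OF \<Omega> \<phi>(1) SO loops[OF that]])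
  obtain \<psi> where \<psi>: "\<psi> holomorphic_on \<phi> ` \<Omega>" "\<And>z. z \<in> \<Omega> \<Longrightarrow> deriv \<phi> z * deriv \<psi> (\<phi> z) = 1"
    "\<And>z. z \<in> \<Omega> \<Longrightarrow> \<psi> (\<phi> z) = z"
    by (rule holomorphic_has_inverse[OF \<phi>(1) \<Omega> \<phi>(3)]) (rule that; assumption)
  have oim1: "open (\<phi> ` \<Omega>)" by (rule open_mapping_thm3[OF \<phi>(1) \<Omega> \<phi>(3)])
  have hS: "\<phi> holomorphic_on S" by (rule holomorphic_on_subset[OF \<phi>(1) SO])
  have iS: "inj_on \<phi> S" by (rule inj_on_subset[OF \<phi>(3) SO])
  have oim2: "open (\<phi> ` S)" by (rule open_mapping_thm3[OF hS S(1) iS])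
  note oim = oim1 oim2
  have "indep_loops \<Omega> m (\<lambda>k. \<phi> \<circ> \<gamma> k)"
    unfolding indep_loops_def
  proof (intro allI impI)
    fix c :: "nat \<Rightarrow> complex" and k
    assume zero: "\<forall>h. h holomorphic_on \<Omega> \<longrightarrow> (\<Sum>k<m. c k * contour_integral (\<phi> \<circ> \<gamma> k) h) = 0" and k: "k < m"
    have "(\<Sum>k<m. c k * contour_integral (\<gamma> k) h) = 0" if h: "h holomorphic_on \<Omega>" for h
    proof -
      define g where "g w = h (\<psi> w) * deriv \<psi> w" for w
      have g: "g holomorphic_on \<phi> ` \<Omega>"
      proof -
        have "(h \<circ> \<psi>) holomorphic_on \<phi> ` \<Omega>"
          by (rule holomorphic_on_compose_gen[OF \<psi>(1) h]) (use \<psi>(3) in auto)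
        then show ?thesis
          unfolding g_def o_def by (intro holomorphic_on_mult holomorphic_deriv[OF \<psi>(1) oim(1)])
      qed
      have ap: "approximable \<Omega> (\<phi> ` L) g"
        by (rule runge[OF L(1) oim(1) _ g]) (use L(2) in blast)
      have "(\<Sum>k<m. c k * contour_integral (\<phi> \<circ> \<gamma> k) g) = 0"
      proof (rule contour_integral_combination_limit[OF oim(2) loop'])
        show "g holomorphic_on \<phi> ` S" using g SO by (meson holomorphic_on_subset image_mono)
        fix e :: real assume "e > 0"
        then obtain R where R: "R holomorphic_on \<Omega>" "\<And>z. z \<in> \<phi> ` L \<Longrightarrow> norm (R z - g z) < e"
          using ap unfolding approximable_def by blast
        have "\<phi> ` S \<subseteq> \<Omega>" using SO \<phi>(2) by auto
        then have "R holomorphic_on \<phi> ` S" by (rule holomorphic_on_subset[OF R(1)])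
        moreover have "\<forall>z\<in>\<phi> ` S. norm (R z - g z) \<le> e"
          using R(2) S(2) by (blast intro: less_imp_le)
        ultimately show "\<exists>R. R holomorphic_on \<phi> ` S \<and> (\<forall>z\<in>\<phi> ` S. norm (R z - g z) \<le> e) \<and>
            (\<Sum>k<m. c k * contour_integral (\<phi> \<circ> \<gamma> k) R) = 0"
          using R(1) zero by blast
      qed
      moreover have "contour_integral (\<phi> \<circ> \<gamma> k) g = contour_integral (\<gamma> k) h" if "k < m" for k
      proof -
        have "path_image (\<gamma> k) \<subseteq> \<Omega>" "valid_path (\<gamma> k)" using loops[OF that] SO by (auto simp: loop_in_def)
        moreover have "\<phi> analytic_on \<Omega>" using \<phi>(1) \<Omega> by (simp add: analytic_on_open)
        ultimately have "contour_integral (\<phi> \<circ> \<gamma> k) g = contour_integral (\<gamma> k) (\<lambda>w. deriv \<phi> w * g (\<phi> w))"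
          by (intro contour_integral_comp_analyticW)
        also have "\<dots> = contour_integral (\<gamma> k) h"
        proof (rule contour_integral_eq)
          fix w assume "w \<in> path_image (\<gamma> k)"
          then have "w \<in> \<Omega>" using \<open>path_image (\<gamma> k) \<subseteq> \<Omega>\<close> by auto
          then show "deriv \<phi> w * g (\<phi> w) = h w"
            using \<psi>(2,3)[of w] by (simp add: g_def mult.left_commute)
        qed
        finally show ?thesis .
      qed
      ultimately show ?thesis by simp
    qed
    then show "c k = 0" using ind k unfolding indep_loops_def by blast
  qed
  moreover have "\<phi> ` S \<subseteq> G \<inter> \<Omega>" using G SO \<phi>(2) by auto
  ultimately show ?thesis
    unfolding rich_def using loop_in_mono[OF loop'] by (intro exI[of _ "\<lambda>k. \<phi> \<circ> \<gamma> k"]) blast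
qed

text \<open>The complement of \<open>V\<close> has at most as many components as there are sets \<open>A j\<close>.\<close>

lemma not_rich_if_frontier_covered:
  assumes V: "open V" "V \<subseteq> \<Omega>" and J: "finite J" "card J < m"
    and A: "\<And>j. j \<in> J \<Longrightarrow> connected (A j)" "\<And>j. j \<in> J \<Longrightarrow> A j \<inter> V = {}"
    and fr: "frontier V \<subseteq> (\<Union>j\<in>J. A j)"
  shows "\<not> rich \<Omega> m V"
proof
  assume "rich \<Omega> m V"
  then obtain \<gamma> where loops: "\<And>k. k < m \<Longrightarrow> loop_in V (\<gamma> k)" and ind: "indep_loops \<Omega> m \<gamma>"
    unfolding rich_def using V(2) by (metis inf.absorb1)
  \<comment> \<open>For an empty \<open>A j\<close> the sample point is arbitrary; it merely adds
    one more equation to the linear system.\<close>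
  define a where "a j = (SOME x. x \<in> A j)" for j
  have a: "a j \<in> A j" if "x \<in> A j" for j x using that unfolding a_def by (metis someI)
  obtain c where c: "\<exists>k\<in>{..<m}. c k \<noteq> 0"
    "\<And>j. j \<in> J \<Longrightarrow> (\<Sum>k\<in>{..<m}. c k * winding_number (\<gamma> k) (a j)) = 0"
    using homogeneous_system[OF J(1) finite_lessThan[of m], where A = "\<lambda>k j. winding_number (\<gamma> k) (a j)"] J(2)
    by auto
  have "(\<Sum>k<m. c k * winding_number (\<gamma> k) w) = 0" if w: "w \<notin> V" for w
  proof -
    have "0 < m" using J by auto
    then have "pathstart (\<gamma> 0) \<in> V"
      using loops[of 0] pathstart_in_path_image[of "\<gamma> 0"] by (auto simp: loop_in_def)
    then obtain v where v: "v \<in> V" by blast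
    \<comment> \<open>A path in \<open>- V\<close> leads from \<open>w\<close> to the frontier of
      \<open>V\<close> and ends in some \<open>A j\<close>. Winding numbers of loops in
      \<open>V\<close> are constant on the path and on \<open>A j\<close>, so they agree with those
      at \<open>a j\<close>.\<close>
    obtain h where h: "path h" "pathstart h = w" "path_image h \<subseteq> - V" "pathfinish h \<in> frontier (- V)"
    proof (rule exists_path_subpath_to_frontier_closed[of "- V" "linepath w v"])
      show "closed (- V)" using V(1) by (simp add: closed_def)
    qed (use w v in auto)
    then obtain j where j: "j \<in> J" "pathfinish h \<in> A j" using fr by (auto simp: frontier_complement)
    have "winding_number (\<gamma> k) w = winding_number (\<gamma> k) (a j)" if "k < m" for k
    proof -
      have lp: "path (\<gamma> k)" "pathfinish (\<gamma> k) = pathstart (\<gamma> k)" "path_image (\<gamma> k) \<subseteq> V"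
        using loops[OF that] by (auto simp: loop_in_def valid_path_imp_path)
      have "winding_number (\<gamma> k) w = winding_number (\<gamma> k) (pathfinish h)"
        using h lp(3) by (intro winding_number_eq[OF lp(1,2), where S = "path_image h"])
          (auto simp: connected_path_image)
      also have "\<dots> = winding_number (\<gamma> k) (a j)"
        using j a A lp(3) by (intro winding_number_eq[OF lp(1,2), where S = "A j"]) blast+
      finally show ?thesis .
    qed
    then show ?thesis using c(2)[OF j(1)] by simp
  qed
  then have "(\<Sum>k<m. c k * contour_integral (\<gamma> k) h) = 0" if "h holomorphic_on \<Omega>" for h
    by (intro Cauchy_theorem_cycle[OF V(1) loops holomorphic_on_subset[OF that V(2)]])
  then show False using ind c(1) unfolding indep_loops_def by blast
qed

text \<open>\<open>F\<close> integrates \<open>h\<close> along chosen paths from a base point.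
  Increments over segments are all that a sum over the edges of a grid cycle needs.\<close>

lemma segment_integral_if_loops_zero:
  assumes \<Omega>: "open \<Omega>" "connected \<Omega>" and h: "h holomorphic_on \<Omega>"
    and zero: "\<And>\<gamma>. loop_in \<Omega> \<gamma> \<Longrightarrow> contour_integral \<gamma> h = 0"
  obtains F where "\<And>a b. closed_segment a b \<subseteq> \<Omega> \<Longrightarrow> contour_integral (linepath a b) h = F b - F a"
proof (cases "\<Omega> = {}")
  case True
  then show ?thesis using that[of "\<lambda>_. 0"] by auto
next
  case False
  then obtain z0 where z0: "z0 \<in> \<Omega>" by auto
  have "\<exists>g. valid_path g \<and> path_image g \<subseteq> \<Omega> \<and> pathstart g = z0 \<and> pathfinish g = z" if "z \<in> \<Omega>" for z
    using connected_open_polynomial_connected[OF \<Omega> z0 that] valid_path_polynomial_function by blast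
  then obtain g where g: "\<And>z. z \<in> \<Omega> \<Longrightarrow> valid_path (g z) \<and> path_image (g z) \<subseteq> \<Omega> \<and> pathstart (g z) = z0 \<and> pathfinish (g z) = z"
    by metis
  have int: "h contour_integrable_on p" if "valid_path p" "path_image p \<subseteq> \<Omega>" for p
    using contour_integrable_holomorphic_simple[OF h \<Omega>(1)] that by blast
  show ?thesis
  proof (rule that[of "\<lambda>z. contour_integral (g z) h"])
    fix a b assume ab: "closed_segment a b \<subseteq> \<Omega>"
    then have "a \<in> \<Omega>" "b \<in> \<Omega>" by auto
    note ga = g[OF this(1)] and gb = g[OF this(2)]
    let ?p = "linepath a b +++ reversepath (g b)"
    have p: "valid_path ?p" "path_image ?p \<subseteq> \<Omega>" "pathstart ?p = a" "pathfinish ?p = z0"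
      using ab gb by (auto intro!: valid_path_join simp: path_image_join)
    have "loop_in \<Omega> (g a +++ ?p)"
      unfolding loop_in_def using ga gb p by (auto intro!: valid_path_join simp: path_image_join)
    then have "contour_integral (g a +++ ?p) h = 0" by (rule zero)
    moreover have "contour_integral (g a +++ ?p) h = contour_integral (g a) h + contour_integral ?p h"
      using ga p int by (intro contour_integral_join) auto
    moreover have "contour_integral ?p h = contour_integral (linepath a b) h + contour_integral (reversepath (g b)) h"
      using gb ab int by (intro contour_integral_join) auto
    moreover have "contour_integral (reversepath (g b)) h = - contour_integral (g b) h"
      using gb by (intro contour_integral_reversepath) auto
    ultimately show "contour_integral (linepath a b) h = contour_integral (g b) h - contour_integral (g a) h"
      by (simp add: algebra_simps add_eq_0_iff2)
  qed
qed

text \<open>A nontrivial combination of the poles at the points \<open>p l\<close> has a nonzero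
  period: otherwise its integrals over segments would be increments of some \<open>F\<close>, which
  cancel over the grid cycle around \<open>P k\<close>, although this cycle winds once around
  \<open>p k\<close> and not at all around the other points. Given fewer than \<open>m\<close>
  loops, linear algebra yields a nontrivial combination with zero periods along them, and a loop
  where its period is nonzero can be added.\<close>

lemma rich_infinitely_connected:
  assumes dom: "domain_in_plane \<Omega>" and inf: "\<not> finitely_connected \<Omega>"
  shows "rich \<Omega> m \<Omega>"
proof -
  have \<Omega>: "open \<Omega>" "connected \<Omega>" using dom by (auto simp: domain_in_plane_def)
  obtain p P where p: "\<And>k. k < m \<Longrightarrow> p k \<in> P k" "\<And>k. k < m \<Longrightarrow> compact (P k)" "\<And>k. k < m \<Longrightarrow> P k \<subseteq> - \<Omega>"
    "\<And>k. k < m \<Longrightarrow> open (\<Omega> \<union> P k)"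
    "\<And>k l. k < m \<Longrightarrow> l < m \<Longrightarrow> l \<noteq> k \<Longrightarrow> p l \<notin> P k"
    by (rule infinite_separated_points[OF dom inf, of m]) (rule that; assumption)
  have pO: "p l \<notin> \<Omega>" if "l < m" for l using p(1,3)[OF that] by blast
  have hol: "(\<lambda>z. \<Sum>l<m. b l * (1 / (z - p l))) holomorphic_on \<Omega>" for b
    by (intro holomorphic_intros) (use pO in force)
  have ci: "contour_integral \<gamma> (\<lambda>z. \<Sum>l<m. b l * (1 / (z - p l))) =
      (\<Sum>l<m. b l * contour_integral \<gamma> (\<lambda>z. 1 / (z - p l)))" if "valid_path \<gamma>" "path_image \<gamma> \<subseteq> \<Omega>" for \<gamma> b
  proof (rule contour_integral_unique, intro has_contour_integral_sum has_contour_integral_lmul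
      has_contour_integral_integral finite_lessThan)
    fix l assume "l \<in> {..<m}"
    then show "(\<lambda>z. 1 / (z - p l)) contour_integrable_on \<gamma>"
      using pO[of l] that by (intro contour_integrable_inversediff) auto
  qed
  have nonzero: "\<exists>\<gamma>. loop_in \<Omega> \<gamma> \<and> contour_integral \<gamma> (\<lambda>z. \<Sum>l<m. b l * (1 / (z - p l))) \<noteq> 0"
    if k: "k < m" and bk: "b k \<noteq> 0" for b k
  proof (rule ccontr)
    assume "\<not> ?thesis"
    then obtain F where F: "\<And>x y. closed_segment x y \<subseteq> \<Omega> \<Longrightarrow>
        contour_integral (linepath x y) (\<lambda>z. \<Sum>l<m. b l * (1 / (z - p l))) = F y - F x"
      using segment_integral_if_loops_zero[OF \<Omega> hol] by blast
    obtain E :: "(bool \<times> int \<times> int) set" and a a' cc where E: "finite E"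
      "\<And>e. e \<in> E \<Longrightarrow> closed_segment (a e) (a' e) \<subseteq> (\<Omega> \<union> P k) - P k"
      and cauchy: "\<And>f z. f holomorphic_on (\<Omega> \<union> P k) \<Longrightarrow> z \<in> P k \<Longrightarrow>
       (\<Sum>e\<in>E. cc e * contour_integral (linepath (a e) (a' e)) (\<lambda>w. f w / (w - z))) = 2 * of_real pi * \<i> * f z"
      and off: "\<And>z. z \<notin> \<Omega> \<union> P k \<Longrightarrow> (\<Sum>e\<in>E. cc e * contour_integral (linepath (a e) (a' e)) (\<lambda>w. 1 / (w - z))) = 0"
      and bd: "\<And>F. (\<Sum>e\<in>E. cc e * (F (a' e) - F (a e))) = 0"
      by (rule grid_cycle[OF p(2)[OF k] p(4)[OF k] Un_upper2]) (rule that; assumption)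
    have seg: "closed_segment (a e) (a' e) \<subseteq> \<Omega>" if "e \<in> E" for e
      using E(2)[OF that] p(3)[OF k] by blast
    let ?I = "\<lambda>l. \<Sum>e\<in>E. cc e * contour_integral (linepath (a e) (a' e)) (\<lambda>z. 1 / (z - p l))"
    have "0 = (\<Sum>e\<in>E. cc e * (F (a' e) - F (a e)))" using bd by simp
    also have "\<dots> = (\<Sum>e\<in>E. cc e * contour_integral (linepath (a e) (a' e)) (\<lambda>z. \<Sum>l<m. b l * (1 / (z - p l))))"
      using F seg by (intro sum.cong) auto
    also have "\<dots> = (\<Sum>e\<in>E. cc e * (\<Sum>l<m. b l * contour_integral (linepath (a e) (a' e)) (\<lambda>z. 1 / (z - p l))))"
      using seg by (intro sum.cong refl) (subst ci, auto)
    also have "\<dots> = (\<Sum>e\<in>E. \<Sum>l<m. b l * (cc e * contour_integral (linepath (a e) (a' e)) (\<lambda>z. 1 / (z - p l))))"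
      by (simp add: sum_distrib_left mult_ac)
    also have "\<dots> = (\<Sum>l<m. b l * ?I l)"
      by (subst sum.swap) (simp add: sum_distrib_left)
    also have "\<dots> = (\<Sum>l<m. if l = k then b k * (2 * of_real pi * \<i>) else 0)"
    proof (rule sum.cong[OF refl])
      fix l assume l: "l \<in> {..<m}"
      show "b l * ?I l = (if l = k then b k * (2 * of_real pi * \<i>) else 0)"
      proof (cases "l = k")
        case True
        then show ?thesis using cauchy[of "\<lambda>_. 1" "p k"] p(1)[OF k] by simp
      next
        case False
        then have "p l \<notin> \<Omega> \<union> P k" using pO[of l] p(5)[OF k, of l] l by auto
        then show ?thesis using off False by simp
      qed
    qed
    also have "\<dots> = b k * (2 * of_real pi * \<i>)" using k by simp
    finally show False using bk by simp
  qed
  have "\<exists>\<gamma>. (\<forall>k<j. loop_in \<Omega> (\<gamma> k)) \<and> indep_loops \<Omega> j \<gamma>" if "j \<le> m" for j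
    using that
  proof (induction j)
    case 0
    show ?case by (auto simp: indep_loops_def)
  next
    case (Suc j)
    then obtain \<gamma> where \<gamma>: "\<And>k. k < j \<Longrightarrow> loop_in \<Omega> (\<gamma> k)" "indep_loops \<Omega> j \<gamma>" by auto
    obtain b where b: "\<exists>l\<in>{..<m}. b l \<noteq> 0"
      "\<And>k. k \<in> {..<j} \<Longrightarrow> (\<Sum>l\<in>{..<m}. b l * contour_integral (\<gamma> k) (\<lambda>z. 1 / (z - p l))) = 0"
      using homogeneous_system[of "{..<j}" "{..<m}", where A = "\<lambda>l k. contour_integral (\<gamma> k) (\<lambda>z. 1 / (z - p l))"] Suc.prems
      by auto
    let ?h = "\<lambda>z. \<Sum>l<m. b l * (1 / (z - p l))"
    obtain \<delta> where \<delta>: "loop_in \<Omega> \<delta>" "contour_integral \<delta> ?h \<noteq> 0" using nonzero b(1) by blast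
    have "indep_loops \<Omega> (Suc j) (\<gamma>(j := \<delta>))"
      unfolding indep_loops_def
    proof (rule allI, rule impI)
      fix c :: "nat \<Rightarrow> complex"
      assume c: "\<forall>h. h holomorphic_on \<Omega> \<longrightarrow> (\<Sum>k<Suc j. c k * contour_integral ((\<gamma>(j := \<delta>)) k) h) = 0"
      have c': "(\<Sum>k<j. c k * contour_integral (\<gamma> k) h) + c j * contour_integral \<delta> h = 0" if "h holomorphic_on \<Omega>" for h
        using c that by auto
      have "contour_integral (\<gamma> k) ?h = 0" if "k < j" for k
        using ci[of "\<gamma> k" b] \<gamma>(1)[OF that] b(2)[of k] that by (auto simp: loop_in_def)
      then have "c j = 0" using c'[OF hol[of b]] \<delta>(2) by simp
      moreover from this have "\<forall>k<j. c k = 0" using c' \<gamma>(2) unfolding indep_loops_def by simp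
      ultimately show "\<forall>k<Suc j. c k = 0" by (auto simp: less_Suc_eq)
    qed
    moreover have "\<forall>k<Suc j. loop_in \<Omega> ((\<gamma>(j := \<delta>)) k)" using \<gamma>(1) \<delta>(1) by (auto simp: less_Suc_eq)
    ultimately show ?case by blast
  qed
  from this[of m] show ?thesis unfolding rich_def by simp
qed

section \<open>Convex hulls\<close>

lemma connected_subset_relatively_clopen:
  assumes "connected C" "open Q" "C \<inter> Q \<noteq> {}" "C \<inter> closure Q \<subseteq> Q"
  shows "C \<subseteq> Q"
proof -
  have "C \<subseteq> Q \<union> - closure Q" using assms(4) by auto
  then have "Q \<inter> C = {} \<or> - closure Q \<inter> C = {}"
    using closure_subset[of Q] by (intro connectedD[OF assms(1,2)]) auto
  then show ?thesis using assms(3,4) by auto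
qed

lemma connected_subset_component:
  assumes "connected D" "D \<subseteq> - A" "C \<in> components (- A)" "D \<inter> C \<noteq> {}"
  shows "D \<subseteq> C"
  using components_maximal[OF assms(3,1,2)] assms(4) by (metis inf_commute)

lemma open_plane_component:
  fixes A :: "complex set"
  shows "closed A \<Longrightarrow> C \<in> components (- A) \<Longrightarrow> open C"
  by (meson open_Compl open_components)

lemma component_not_closed:
  fixes A :: "complex set"
  assumes "closed A" "A \<noteq> {}" "Q \<in> components (- A)"
  shows "\<not> closure Q \<subseteq> Q"
proof
  assume "closure Q \<subseteq> Q"
  then have "closed Q" by (metis closure_subset closure_closed closed_closure subset_antisym)
  then have "Q = UNIV"
    using open_plane_component[OF assms(1,3)] clopen[of Q] in_components_nonempty[OF assms(3)] by auto
  then show False using assms(2) in_components_subset[OF assms(3)] by auto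
qed

lemma component_containing:
  assumes "x \<notin> A"
  obtains C where "C \<in> components (- A)" "x \<in> C"
  using assms Union_components[of "- A"] by blast

lemma bounded_component_subset_inside:
  assumes "C \<in> components (- K)" "bounded C"
  shows "C \<subseteq> inside K"
proof
  fix x assume x: "x \<in> C"
  then have "C = connected_component_set (- K) x" using assms(1) by (metis components_iff connected_component_eq)
  then show "x \<in> inside K" using assms x in_components_subset by (auto simp: inside_def)
qed

text \<open>Filling the holes inside \<open>\<Omega>\<close> creates no new one, as each component
  of \<open>- L\<close> contains a component of \<open>- K\<close> that is unbounded or leaves
  \<open>\<Omega>\<close>. The filled part is clopen in \<open>- K\<close>, so connectedness is
  kept.\<close>

lemma plane_convex_hull:
  assumes K: "compact K" "K \<subseteq> \<Omega>" "connected K"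
  defines "L \<equiv> K \<union> \<Union>{C \<in> components (- K). bounded C \<and> C \<subseteq> \<Omega>}"
  shows "plane_convex \<Omega> L" "connected L"
proof -
  define T where "T = \<Union>{C \<in> components (- K). bounded C \<and> C \<subseteq> \<Omega>}"
  define R where "R = \<Union>{C \<in> components (- K). \<not> (bounded C \<and> C \<subseteq> \<Omega>)}"
  have L: "L = K \<union> T" by (simp add: L_def T_def)
  have clK: "closed K" using K(1) by (rule compact_imp_closed)
  have op: "open T" "open R" unfolding T_def R_def using open_plane_component[OF clK] by auto
  have cover: "- K = T \<union> R" unfolding T_def R_def using Union_components[of "- K"] by blast
  have disj: "T \<inter> R = {}"
  proof (rule ccontr)
    assume "T \<inter> R \<noteq> {}"
    then obtain C C' where "C \<in> components (- K)" "C' \<in> components (- K)" "C \<inter> C' \<noteq> {}" "bounded C \<and> C \<subseteq> \<Omega>" "\<not> (bounded C' \<and> C' \<subseteq> \<Omega>)"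
      unfolding T_def R_def by blast
    then show False using components_eq by blast
  qed
  have "closed L"
  proof -
    have "- L = R" using cover disj L by auto
    then show ?thesis using op by (simp add: closed_def)
  qed
  moreover have "T \<subseteq> inside K" unfolding T_def using bounded_component_subset_inside by blast
  then have "bounded L"
    unfolding L using bounded_inside[OF compact_imp_bounded[OF K(1)]] compact_imp_bounded[OF K(1)]
    by (meson bounded_Un bounded_subset)
  ultimately have cL: "compact L" by (simp add: compact_eq_bounded_closed)
  have LO: "L \<subseteq> \<Omega>" unfolding L T_def using K(2) by auto
  show "plane_convex \<Omega> L"
    unfolding plane_convex_def
  proof (intro conjI cL LO ballI impI notI)
    fix D assume D: "D \<in> components (- L)" "bounded D" "D \<subseteq> \<Omega>"
    obtain x where x: "x \<in> D" using in_components_nonempty[OF D(1)] by auto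
    have "x \<in> R" using x in_components_subset[OF D(1)] cover L by auto
    then obtain C where C: "C \<in> components (- K)" "\<not> (bounded C \<and> C \<subseteq> \<Omega>)" "x \<in> C" by (auto simp: R_def)
    have "C \<subseteq> R" using C by (auto simp: R_def)
    then have "C \<subseteq> - L" using disj cover L by auto
    then have "C \<subseteq> D"
      using x C by (intro connected_subset_component[OF in_components_connected[OF C(1)] _ D(1)]) auto
    then show False using C(2) D(2,3) bounded_subset by blast
  qed
  have UNIV_minus: "UNIV - K = - K" by auto
  have "connected (K \<union> T)"
  proof (rule connected_Un_clopen_in_complement[OF K(3) connected_UNIV])
    show "openin (top_of_set (UNIV - K)) T"
      unfolding UNIV_minus using op cover by (simp add: open_subset)
    show "closedin (top_of_set (UNIV - K)) T"
      unfolding UNIV_minus closedin_closed using op(2) cover disj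
      by (intro exI[of _ "- R"]) auto
  qed simp
  then show "connected L" using L by simp
qed

text \<open>Finitely many closed balls cover \<open>K\<close>, and each is tied to one base point by
  a path.\<close>

lemma connected_compact_superset:
  fixes K :: "complex set"
  assumes K: "compact K" "K \<subseteq> \<Omega>" and \<Omega>: "open \<Omega>" "connected \<Omega>" "\<Omega> \<noteq> {}"
  obtains L where "compact L" "connected L" "K \<subseteq> L" "L \<subseteq> \<Omega>"
proof -
  obtain z0 where z0: "z0 \<in> \<Omega>" using \<Omega> by auto
  have "\<exists>r>0. cball x r \<subseteq> \<Omega>" if "x \<in> \<Omega>" for x using \<Omega>(1) that open_contains_cball by blast
  then obtain r where r: "\<And>x. x \<in> \<Omega> \<Longrightarrow> r x > 0 \<and> cball x (r x) \<subseteq> \<Omega>" by metis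
  have "\<exists>g. path g \<and> path_image g \<subseteq> \<Omega> \<and> pathstart g = z0 \<and> pathfinish g = x" if "x \<in> \<Omega>" for x
    using connected_open_path_connected[OF \<Omega>(1,2)] z0 that by (auto simp: path_connected_def)
  then obtain g where g: "\<And>x. x \<in> \<Omega> \<Longrightarrow> path (g x) \<and> path_image (g x) \<subseteq> \<Omega> \<and> pathstart (g x) = z0 \<and> pathfinish (g x) = x"
    by metis
  have "K \<subseteq> (\<Union>x\<in>K. ball x (r x))" using r K(2) by force
  then obtain F where F: "F \<subseteq> K" "finite F" "K \<subseteq> (\<Union>x\<in>F. ball x (r x))"
    by (rule compactE_image[OF K(1), rotated]) auto
  have FO: "F \<subseteq> \<Omega>" using F K by auto
  define Lf where "Lf x = path_image (g x) \<union> cball x (r x)" for x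
  have con: "connected (Lf x)" "z0 \<in> Lf x" if "x \<in> \<Omega>" for x
  proof -
    have "x \<in> path_image (g x)" "z0 \<in> path_image (g x)" using g[OF that] pathfinish_in_path_image pathstart_in_path_image by metis+
    moreover have "x \<in> cball x (r x)" using r[OF that] by simp
    ultimately show "connected (Lf x)" "z0 \<in> Lf x"
      unfolding Lf_def using g[OF that] by (auto intro!: connected_Un connected_path_image)
  qed
  define L where "L = (\<Union>x\<in>insert z0 F. Lf x)"
  show thesis
  proof
    show "compact L"
      unfolding L_def Lf_def using F(2) g z0 FO by (intro compact_UN compact_Un compact_path_image) auto
    show "connected L"
    proof -
      have "z0 \<in> (\<Inter>x\<in>insert z0 F. Lf x)" using con(2) FO z0 by auto
      then show ?thesis unfolding L_def using con(1) FO z0 by (intro connected_Union) blast+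
    qed
    have "ball x (r x) \<subseteq> Lf x" for x unfolding Lf_def by (intro le_supI2 ball_subset_cball)
    then show "K \<subseteq> L" unfolding L_def using F(3) UN_mono[of F "insert z0 F" "\<lambda>x. ball x (r x)" Lf]
      by (meson order_trans subset_insertI)
    have "Lf x \<subseteq> \<Omega>" if "x \<in> \<Omega>" for x unfolding Lf_def using g[OF that] r[OF that] by simp
    then show "L \<subseteq> \<Omega>" unfolding L_def using z0 FO by (intro UN_least) auto
  qed
qed

text \<open>Thickening \<open>K\<close> by closed balls before connecting and filling places
  \<open>K\<close> in the interior of the result.\<close>

lemma plane_convex_connected_superset:
  assumes K: "compact K" "K \<subseteq> \<Omega>" and \<Omega>: "open \<Omega>" "connected \<Omega>" "\<Omega> \<noteq> {}"
  obtains L where "plane_convex \<Omega> L" "connected L" "K \<subseteq> interior L"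
proof -
  obtain d where d: "d > 0" "(\<Union>x\<in>K. cball x d) \<subseteq> \<Omega>"
    using compact_subset_open_imp_cball_epsilon_subset[OF K(1) \<Omega>(1) K(2)] by blast
  obtain L1 where L1: "compact L1" "connected L1" "(\<Union>x\<in>K. cball x d) \<subseteq> L1" "L1 \<subseteq> \<Omega>"
    by (rule connected_compact_superset[OF compact_minkowski_sum_cball[OF K(1), of d] d(2) \<Omega>]) (rule that; assumption)
  have "(\<Union>x\<in>K. ball x d) \<subseteq> L1" using L1(3) by force
  then have "(\<Union>x\<in>K. ball x d) \<subseteq> interior L1" by (intro interior_maximal) auto
  then have "K \<subseteq> interior L1" using d(1) by force
  then show thesis
    using that[OF plane_convex_hull[OF L1(1,4,2)]] interior_mono[of L1] by (meson Un_upper1 order_trans)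
qed

text \<open>Every bounded component contains a point outside \<open>\<Omega>\<close>, which keeps a
  fixed distance from \<open>K\<close>. These points lie in a compact subset of \<open>- K\<close>,
  which meets finitely many of the disjoint open components; at most one component is
  unbounded.\<close>

lemma finite_components_plane_convex:
  assumes K: "plane_convex \<Omega> K" and \<Omega>: "open \<Omega>"
  shows "finite (components (- K))"
proof -
  have cK: "compact K" "K \<subseteq> \<Omega>" using K by (auto simp: plane_convex_def)
  obtain d where d: "d > 0" "(\<Union>x\<in>K. cball x d) \<subseteq> \<Omega>"
    using compact_subset_open_imp_cball_epsilon_subset[OF cK(1) \<Omega> cK(2)] by blast
  obtain R where R: "inside K \<subseteq> cball 0 R"
    using bounded_inside[OF compact_imp_bounded[OF cK(1)]] unfolding bounded_iff by (metis mem_cball_0 subsetI)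
  define T where "T = cball 0 R - (\<Union>x\<in>K. ball x d)"
  have "compact T" unfolding T_def by (intro compact_diff) auto
  moreover have "T \<subseteq> \<Union>(components (- K))" unfolding T_def Union_components using d(1) by force
  moreover have "\<And>B. B \<in> components (- K) \<Longrightarrow> open B"
    using open_plane_component[OF compact_imp_closed[OF cK(1)]] .
  ultimately obtain F where F: "F \<subseteq> components (- K)" "finite F" "T \<subseteq> \<Union>F"
    using compactE by metis
  have "C \<in> F" if C: "C \<in> components (- K)" "bounded C" for C
  proof -
    obtain p where p: "p \<in> C" "p \<notin> \<Omega>" using K C unfolding plane_convex_def by blast
    then have "p \<in> inside K" using bounded_component_subset_inside[OF C] by blast
    then have "p \<in> T" unfolding T_def using R p(2) d(2) by force
    then obtain C' where "C' \<in> F" "p \<in> C'" using F by auto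
    then show ?thesis using components_eq[of C "- K" C'] C p F(1) by auto
  qed
  moreover have "finite {C \<in> components (- K). \<not> bounded C}"
  proof -
    have "C = C'" if "C \<in> components (- K)" "\<not> bounded C" "C' \<in> components (- K)" "\<not> bounded C'" for C C'
      using cobounded_unique_unbounded_components[of "- K" C' C] that cK(1) by (auto simp: compact_imp_bounded)
    then have "\<exists>C0. {C \<in> components (- K). \<not> bounded C} \<subseteq> {C0}" by blast
    then show ?thesis using finite_subset by blast
  qed
  ultimately show ?thesis
    using F(2) finite_subset[of "components (- K)" "F \<union> {C \<in> components (- K). \<not> bounded C}"] by auto
qed

text \<open>A hole \<open>Q\<close> of the smaller image inside \<open>\<Omega>\<close> is covered
  by the image of \<open>L\<close>, which has no such hole. It pulls back to an open subset of
  \<open>L\<close> whose closure adds only points of \<open>K\<close>; a component of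
  \<open>- K\<close> meeting it lies in it and is a hole of \<open>K\<close> inside
  \<open>\<Omega>\<close>.\<close>

lemma plane_convex_image_mono:
  assumes \<Omega>: "open \<Omega>" and \<phi>: "\<phi> holomorphic_on \<Omega>" "inj_on \<phi> \<Omega>"
    and K: "plane_convex \<Omega> K" and L: "compact L" "L \<subseteq> \<Omega>" "K \<subseteq> L" "plane_convex \<Omega> (\<phi> ` L)"
  shows "plane_convex \<Omega> (\<phi> ` K)"
  unfolding plane_convex_def
proof (intro conjI ballI impI notI)
  have cont: "continuous_on \<Omega> \<phi>" using \<phi>(1) by (rule holomorphic_on_imp_continuous_on)
  have cK: "compact K" "K \<subseteq> \<Omega>" using K by (auto simp: plane_convex_def)
  show cpt: "compact (\<phi> ` K)" using compact_continuous_image continuous_on_subset[OF cont cK(2)] cK(1) by blast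
  show "\<phi> ` K \<subseteq> \<Omega>" using L(3,4) by (auto simp: plane_convex_def)
  fix Q assume Q: "Q \<in> components (- (\<phi> ` K))" "bounded Q" "Q \<subseteq> \<Omega>"
  have QL: "Q \<subseteq> \<phi> ` L"
  proof (rule ccontr)
    assume "\<not> Q \<subseteq> \<phi> ` L"
    then obtain q where q: "q \<in> Q" "q \<notin> \<phi> ` L" by auto
    obtain D where D: "D \<in> components (- (\<phi> ` L))" "q \<in> D" using component_containing[OF q(2)] .
    have "D \<subseteq> Q"
      using D q L(3) in_components_subset[OF D(1)]
      by (intro connected_subset_component[OF in_components_connected[OF D(1)] _ Q(1)]) auto
    then show False using D(1) L(4) Q(2,3) unfolding plane_convex_def by (meson bounded_subset order_trans)
  qed
  define Q' where "Q' = {z \<in> \<Omega>. \<phi> z \<in> Q}"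
  have "open Q"
    using open_plane_component[OF compact_imp_closed[OF cpt] Q(1)] .
  then have opQ': "open Q'"
    unfolding Q'_def using continuous_open_preimage[OF cont \<Omega>] by (simp add: vimage_def Int_def)
  have Q'L: "Q' \<subseteq> L"
  proof
    fix z assume z: "z \<in> Q'"
    then obtain l where "l \<in> L" "\<phi> z = \<phi> l" using QL by (auto simp: Q'_def)
    then show "z \<in> L" using \<phi>(2) L(2) z by (metis (mono_tags, lifting) Q'_def inj_onD mem_Collect_eq subsetD)
  qed
  have cl: "closure Q' \<subseteq> Q' \<union> K"
  proof
    fix z assume z: "z \<in> closure Q'"
    then obtain x where x: "\<And>n. x n \<in> Q'" "x \<longlonglongrightarrow> z" unfolding closure_sequential by blast
    have zO: "z \<in> \<Omega>" using z closure_minimal[OF Q'L compact_imp_closed[OF L(1)]] L(2) by auto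
    have "(\<lambda>n. \<phi> (x n)) \<longlonglongrightarrow> \<phi> z"
      using cont x zO unfolding continuous_on_sequentially o_def Q'_def by blast
    then have "\<phi> z \<in> closure Q" using x(1) unfolding closure_sequential Q'_def by (intro exI[of _ "\<lambda>n. \<phi> (x n)"]) auto
    then have "\<phi> z \<in> Q \<or> \<phi> z \<in> \<phi> ` K"
      using closure_component_subset[OF Q(1) compact_imp_closed[OF cpt]] by auto
    then show "z \<in> Q' \<union> K" using zO \<phi>(2) cK(2) by (auto simp: Q'_def dest!: inj_onD)
  qed
  obtain y where "y \<in> Q" using in_components_nonempty[OF Q(1)] by auto
  then obtain x where x: "x \<in> Q'" "\<phi> x \<in> Q" using QL L(2) by (auto simp: Q'_def)
  then have "x \<notin> K" using in_components_subset[OF Q(1)] by auto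
  obtain C where C: "C \<in> components (- K)" "x \<in> C" using component_containing[OF \<open>x \<notin> K\<close>] .
  have "C \<subseteq> Q'"
    using cl C x in_components_subset[OF C(1)]
    by (intro connected_subset_relatively_clopen[OF in_components_connected[OF C(1)] opQ']) auto
  then have "bounded C" "C \<subseteq> \<Omega>"
    using Q'L L(1,2) by (meson bounded_subset compact_imp_bounded order_trans)+
  then show False using C(1) K unfolding plane_convex_def by blast
qed

text \<open>Janiszewski's theorem for the disjoint closed sets \<open>K\<close> and
  \<open>- U\<close>: points separated by neither are not separated by the union.\<close>

lemma connected_component_Int:
  fixes K :: "complex set"
  assumes K: "compact K" "K \<subseteq> U" and U: "open U" "connected U" and C: "C \<in> components (- K)"
  shows "connected (C \<inter> U)"
  unfolding connected_iff_connected_component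
proof (intro ballI)
  fix a b assume a: "a \<in> C \<inter> U" and b: "b \<in> C \<inter> U"
  have CK: "C \<subseteq> - K" using in_components_subset[OF C] .
  have 1: "connected_component (- K) a b"
    unfolding connected_component_def using a b CK in_components_connected[OF C] by blast
  have 2: "connected_component (- (- U)) a b"
    unfolding connected_component_def using a b U by auto
  have cl: "closed (- U)" using U(1) by (simp add: closed_def)
  have "K \<inter> - U = {}" using K(2) by auto
  then have "connected (K \<inter> - U)" by simp
  from Janiszewski[OF K(1) cl this 1 2]
  obtain T where T: "connected T" "T \<subseteq> - (K \<union> - U)" "a \<in> T" "b \<in> T"
    unfolding connected_component_def by blast
  then have "T \<subseteq> C" using a by (intro connected_subset_component[OF _ _ C]) auto
  then show "connected_component (C \<inter> U) a b"
    unfolding connected_component_def using T by (intro exI[of _ T]) auto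
qed

text \<open>Repeated use of Janiszewski's theorem; its condition that the intersection be connected
  holds because the sets are disjoint.\<close>

lemma not_separated_by_disjoint_union:
  fixes A :: "'i \<Rightarrow> complex set"
  assumes "finite J" "\<And>j. j \<in> J \<Longrightarrow> compact (A j)" "disjoint_family_on A J"
    and "\<And>j. j \<in> J \<Longrightarrow> connected_component (- A j) x v"
  shows "connected_component (- (\<Union>j\<in>J. A j)) x v"
  using assms
proof (induction J rule: finite_induct)
  case empty
  show ?case by (auto simp: connected_component_def intro!: exI[of _ UNIV])
next
  case (insert j J)
  have "A j \<inter> (\<Union>i\<in>J. A i) = {}" using insert.prems(2) insert.hyps by (fastforce simp: disjoint_family_on_def)
  then have con: "connected (A j \<inter> (\<Union>i\<in>J. A i))" by simp
  have "compact (\<Union>i\<in>J. A i)" using insert by (intro compact_UN) auto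
  moreover have "connected_component (- (\<Union>i\<in>J. A i)) x v"
    using insert.prems by (intro insert.IH) (auto simp: disjoint_family_on_def)
  ultimately have "connected_component (- (A j \<union> (\<Union>i\<in>J. A i))) x v"
    using insert.prems by (intro Janiszewski[OF _ _ con]) (auto simp: compact_imp_closed)
  then show ?case by simp
qed

section \<open>Injective maps and separation\<close>

text \<open>The value on the diagonal keeps the quotient continuous and, for injective
  \<open>\<phi>\<close>, zero-free, so that \<open>a\<close> may move freely in
  \<open>\<Omega>\<close>, even through \<open>z\<close>.\<close>

definition difference_quotient :: "(complex \<Rightarrow> complex) \<Rightarrow> complex \<Rightarrow> complex \<Rightarrow> complex" where
  "difference_quotient \<phi> a z = (if z = a then deriv \<phi> a else (\<phi> z - \<phi> a) / (z - a))"

text \<open>Near a diagonal point \<open>(a, a)\<close> the mean value inequality for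
  \<open>\<phi> w - deriv \<phi> a * w\<close> on a ball bounds the deviation from
  \<open>deriv \<phi> a\<close> in both arguments at once.\<close>

lemma continuous_on_difference_quotient:
  assumes \<Omega>: "open \<Omega>" and \<phi>: "\<phi> holomorphic_on \<Omega>"
  shows "continuous_on (\<Omega> \<times> \<Omega>) (\<lambda>p. difference_quotient \<phi> (fst p) (snd p))"
proof (rule continuous_at_imp_continuous_on, safe)
  fix a b assume ab: "a \<in> \<Omega>" "b \<in> \<Omega>"
  let ?q = "\<lambda>p. difference_quotient \<phi> (fst p) (snd p)"
  have isc: "isCont \<phi> z" if "z \<in> \<Omega>" for z
    using \<phi> \<Omega> that continuous_on_eq_continuous_at holomorphic_on_imp_continuous_on by blast
  show "isCont ?q (a, b)"
  proof (cases "a = b")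
    case False
    have "isCont (\<lambda>p. (\<phi> (snd p) - \<phi> (fst p)) / (snd p - fst p)) (a, b)"
      using False ab by (intro continuous_intros isCont_o2[OF _ isc]) auto
    moreover have "\<forall>\<^sub>F p in nhds (a, b). (\<phi> (snd p) - \<phi> (fst p)) / (snd p - fst p) = ?q p"
    proof -
      have "open {p :: complex \<times> complex. fst p \<noteq> snd p}"
        by (intro open_Collect_neq continuous_intros)
      then show ?thesis
        unfolding eventually_nhds using False
        by (intro exI[of _ "{p. fst p \<noteq> snd p}"]) (auto simp: difference_quotient_def)
    qed
    ultimately show ?thesis by (rule isCont_cong[THEN iffD1, rotated])
  next
    case True
    show ?thesis
      unfolding continuous_at_eps_delta
    proof (intro allI impI)
      fix e :: real assume e: "e > 0"
      have "continuous_on \<Omega> (deriv \<phi>)"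
        using \<phi> \<Omega> by (intro holomorphic_on_imp_continuous_on holomorphic_deriv)
      then have "isCont (deriv \<phi>) a" using ab \<Omega> continuous_on_eq_continuous_at by blast
      then obtain d1 where d1: "d1 > 0" "\<And>z. dist z a < d1 \<Longrightarrow> dist (deriv \<phi> z) (deriv \<phi> a) < e / 2"
        unfolding continuous_at_eps_delta using e by (metis half_gt_zero)
      obtain d2 where d2: "d2 > 0" "ball a d2 \<subseteq> \<Omega>" using \<Omega> ab(1) open_contains_ball by blast
      define d where "d = min d1 d2"
      have d: "d > 0" using d1 d2 by (simp add: d_def)
      have key: "norm ((\<phi> w - \<phi> z) - deriv \<phi> a * (w - z)) \<le> e / 2 * norm (w - z)"
        if "w \<in> ball a d" "z \<in> ball a d" for w z
      proof -
        have "norm ((\<phi> w - deriv \<phi> a * w) - (\<phi> z - deriv \<phi> a * z)) \<le> e / 2 * norm (w - z)"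
        proof (rule field_differentiable_bound[where S = "ball a d" and f' = "\<lambda>x. deriv \<phi> x - deriv \<phi> a"])
          fix x assume x: "x \<in> ball a d"
          then have "x \<in> \<Omega>" using d2 by (auto simp: d_def)
          then have "(\<phi> has_field_derivative deriv \<phi> x) (at x within ball a d)"
            by (rule holomorphic_derivI[OF \<phi> \<Omega>])
          then show "((\<lambda>w. \<phi> w - deriv \<phi> a * w) has_field_derivative deriv \<phi> x - deriv \<phi> a) (at x within ball a d)"
            by (rule DERIV_diff[OF _ DERIV_cmult_Id])
          show "norm (deriv \<phi> x - deriv \<phi> a) \<le> e / 2"
            using d1(2)[of x] x by (auto simp: d_def dist_norm norm_minus_commute intro: less_imp_le)
        qed (use that in auto)
        then show ?thesis by (simp add: algebra_simps)
      qed
      have "dist (?q p) (?q (a, b)) < e" if p: "dist p (a, b) < d" for p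
      proof -
        have pb: "fst p \<in> ball a d" "snd p \<in> ball a d"
          using p True dist_fst_le[of p "(a,b)"] dist_snd_le[of p "(a,b)"] by (auto simp: dist_commute)
        have qa: "?q (a, b) = deriv \<phi> a" using True by (simp add: difference_quotient_def)
        show ?thesis
        proof (cases "fst p = snd p")
          case eq: True
          have "?q p = deriv \<phi> (fst p)" using eq by (simp add: difference_quotient_def)
          then show ?thesis using d1(2)[of "fst p"] pb(1) e unfolding qa by (auto simp: d_def dist_commute)
        next
          case ne: False
          then have n0: "norm (snd p - fst p) > 0" by simp
          have "norm (?q p - deriv \<phi> a) = norm ((\<phi> (snd p) - \<phi> (fst p)) - deriv \<phi> a * (snd p - fst p)) / norm (snd p - fst p)"
            using ne unfolding difference_quotient_def norm_divide[symmetric] by (simp add: diff_divide_distrib)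
          also have "\<dots> \<le> e / 2" using key[OF pb(2,1)] n0 by (simp add: pos_divide_le_eq)
          finally show ?thesis unfolding qa dist_norm using e by simp
        qed
      qed
      then show "\<exists>d>0. \<forall>x'. dist x' (a, b) < d \<longrightarrow> dist (?q x') (?q (a, b)) < e" using d by blast
    qed
  qed
qed

lemma homotopic_circle_divide:
  fixes S :: "'a::topological_space set" and f g f' g' :: "'a \<Rightarrow> complex"
  assumes "homotopic_with_canon (\<lambda>x. True) S (sphere 0 1) f f'"
    and "homotopic_with_canon (\<lambda>x. True) S (sphere 0 1) g g'"
  shows "homotopic_with_canon (\<lambda>x. True) S (sphere 0 1) (\<lambda>x. f x / g x) (\<lambda>x. f' x / g' x)"
proof -
  obtain h k where h: "continuous_on ({0..1::real} \<times> S) h" "h \<in> {0..1} \<times> S \<rightarrow> sphere 0 1"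
      "\<And>x. h (0, x) = f x" "\<And>x. h (1, x) = f' x"
    and k: "continuous_on ({0..1::real} \<times> S) k" "k \<in> {0..1} \<times> S \<rightarrow> sphere 0 1"
      "\<And>x. k (0, x) = g x" "\<And>x. k (1, x) = g' x"
    using assms unfolding homotopic_with_def by (auto simp: image_subset_iff_funcset)
  have k0: "k p \<noteq> 0" if "p \<in> {0..1} \<times> S" for p using k(2) that by force
  have "continuous_on ({0..1::real} \<times> S) (\<lambda>p. h p / k p)"
    using h(1) k(1) k0 by (intro continuous_intros) auto
  moreover have "(\<lambda>p. h p / k p) \<in> {0..1} \<times> S \<rightarrow> sphere 0 1"
  proof
    fix p :: "real \<times> 'a" assume "p \<in> {0..1} \<times> S"
    then have "norm (h p) = 1" "norm (k p) = 1" using h(2) k(2) by (auto simp: Pi_iff)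
    then show "h p / k p \<in> sphere 0 1" by (simp add: norm_divide)
  qed
  ultimately show ?thesis
    unfolding homotopic_with_def using h(3,4) k(3,4)
    by (intro exI[of _ "\<lambda>p. h p / k p"]) (auto simp: image_subset_iff_funcset)
qed

text \<open>By Borsuk's criterion, \<open>K\<close> separates \<open>x\<close> from \<open>y\<close> iff the maps \<open>z \<mapsto> (z - x) / |z - x|\<close> and
  \<open>z \<mapsto> (z - y) / |z - y|\<close> on \<open>K\<close> are not homotopic. Dividing by the difference quotient of \<open>\<phi>\<close> at a
  point that moves from \<open>x\<close> to \<open>y\<close> in \<open>\<Omega>\<close> relates this criterion for \<open>K\<close> to the one for \<open>\<phi> ` K\<close>.\<close>

lemma connected_component_injective_image:
  assumes \<Omega>: "open \<Omega>" "connected \<Omega>" and \<phi>: "\<phi> holomorphic_on \<Omega>" "inj_on \<phi> \<Omega>"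
    and K: "compact K" "K \<subseteq> \<Omega>" and x: "x \<in> \<Omega>" "x \<notin> K" and y: "y \<in> \<Omega>" "y \<notin> K"
    and cc: "connected_component (- (\<phi> ` K)) (\<phi> x) (\<phi> y)"
  shows "connected_component (- K) x y"
proof -
  have cont: "continuous_on K \<phi>"
    using \<phi>(1) K(2) by (meson continuous_on_subset holomorphic_on_imp_continuous_on)
  have cK: "compact (\<phi> ` K)" using cont K(1) by (rule compact_continuous_image)
  have nin: "\<phi> x \<notin> \<phi> ` K" "\<phi> y \<notin> \<phi> ` K"
    using \<phi>(2) K(2) x y by (auto dest!: inj_onD)
  have "homotopic_with_canon (\<lambda>x. True) (\<phi> ` K) (sphere 0 1)
       (\<lambda>w. (w - \<phi> x) /\<^sub>R norm (w - \<phi> x)) (\<lambda>w. (w - \<phi> y) /\<^sub>R norm (w - \<phi> y))"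
    using Borsuk_maps_homotopic_in_connected_component_eq[OF cK nin] cc by simp
  then have "homotopic_with_canon (\<lambda>x. True) K (sphere 0 1)
       ((\<lambda>w. (w - \<phi> x) /\<^sub>R norm (w - \<phi> x)) \<circ> \<phi>) ((\<lambda>w. (w - \<phi> y) /\<^sub>R norm (w - \<phi> y)) \<circ> \<phi>)"
    by (rule homotopic_with_compose_continuous_right) (use cont in auto)
  then have h1: "homotopic_with_canon (\<lambda>x. True) K (sphere 0 1) (\<lambda>z. sgn (\<phi> z - \<phi> x)) (\<lambda>z. sgn (\<phi> z - \<phi> y))"
    by (simp add: o_def sgn_div_norm)
  obtain g where g: "path g" "path_image g \<subseteq> \<Omega>" "pathstart g = x" "pathfinish g = y"
    using connected_open_path_connected[OF \<Omega>] x(1) y(1) unfolding path_connected_def by blast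
  let ?q = "difference_quotient \<phi>"
  have q0: "?q a z \<noteq> 0" if "a \<in> \<Omega>" "z \<in> \<Omega>" for a z
  proof (cases "z = a")
    case True
    then show ?thesis
      using holomorphic_injective_imp_regular[OF \<phi>(1) \<Omega>(1) \<phi>(2) that(1)] by (simp add: difference_quotient_def)
  next
    case False
    then have "\<phi> z \<noteq> \<phi> a" using \<phi>(2) that by (auto dest: inj_onD)
    then show ?thesis using False by (simp add: difference_quotient_def)
  qed
  define H where "H p = sgn (?q (g (fst p)) (snd p))" for p
  have gO: "g t \<in> \<Omega>" if "t \<in> {0..1}" for t using g(2) that by (auto simp: path_image_def)
  have "continuous_on ({0..1} \<times> K) (\<lambda>p. (g (fst p), snd p))"
    using g(1) unfolding path_def
    by (intro continuous_intros continuous_on_compose2[OF _ continuous_on_fst[OF continuous_on_id], of "{0..1}" g]) auto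
  then have "continuous_on ({0..1} \<times> K) (\<lambda>p. ?q (g (fst p)) (snd p))"
    by (rule continuous_on_compose2[OF continuous_on_difference_quotient[OF \<Omega>(1) \<phi>(1)], where f = "\<lambda>p. (g (fst p), snd p)", simplified])
      (use gO K in auto)
  then have "continuous_on ({0..1} \<times> K) H"
    unfolding H_def using q0 gO K by (intro continuous_on_sgn) auto
  moreover have "H \<in> {0..1} \<times> K \<rightarrow> sphere 0 1"
    unfolding H_def using q0 gO K by (auto simp: norm_sgn)
  moreover have "H (0, z) = sgn (?q x z)" "H (1, z) = sgn (?q y z)" for z
    using g(3,4) by (auto simp: H_def pathstart_def pathfinish_def)
  ultimately have h2: "homotopic_with_canon (\<lambda>x. True) K (sphere 0 1) (\<lambda>z. sgn (?q x z)) (\<lambda>z. sgn (?q y z))"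
    unfolding homotopic_with_def by (intro exI[of _ H]) (auto simp: image_subset_iff_funcset)
  have eq: "sgn (\<phi> z - \<phi> a) / sgn (?q a z) = (z - a) /\<^sub>R norm (z - a)" if "z \<in> K" "a \<notin> K" "a \<in> \<Omega>" for a z
  proof -
    have za: "z \<noteq> a" using that by auto
    then have "\<phi> z \<noteq> \<phi> a" using that \<phi>(2) K(2) by (auto dest: inj_onD)
    then have "(\<phi> z - \<phi> a) / ?q a z = z - a" using za by (simp add: difference_quotient_def)
    then have "sgn (\<phi> z - \<phi> a) / sgn (?q a z) = sgn (z - a)" by (metis sgn_divide)
    then show ?thesis by (simp add: sgn_div_norm)
  qed
  have "homotopic_with_canon (\<lambda>x. True) K (sphere 0 1)
       (\<lambda>z. (z - x) /\<^sub>R norm (z - x)) (\<lambda>z. (z - y) /\<^sub>R norm (z - y))"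
    by (rule homotopic_with_eq[OF homotopic_circle_divide[OF h1 h2]]) (use eq x y in auto)
  then show ?thesis
    using Borsuk_maps_homotopic_in_connected_component_eq[OF K(1) x(2) y(2)] by simp
qed

section \<open>Sides of iterated images\<close>

lemma connected_Un_component:
  fixes K :: "complex set"
  assumes K: "compact K" "connected K" and C: "C \<in> components (- K)"
  shows "connected (K \<union> C)"
proof (rule connected_Un_clopen_in_complement[OF K(2) connected_UNIV])
  have eq: "UNIV - K = - K" by auto
  show "openin (top_of_set (UNIV - K)) C"
    unfolding eq using open_plane_component[OF compact_imp_closed[OF K(1)] C] in_components_subset[OF C]
    by (simp add: open_subset)
  show "closedin (top_of_set (UNIV - K)) C"
    unfolding eq by (rule closedin_component[OF C])
qed simp

text \<open>If the component of \<open>- f ` K\<close> at \<open>f c\<close> met that of \<open>- f ` h ` K\<close> at \<open>f (h c)\<close>, the two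
  would coincide, and this open set would have its frontier in both of the disjoint sets
  \<open>f ` K\<close> and \<open>f ` h ` K\<close>.\<close>

lemma iterated_sides_disjoint:
  assumes \<Omega>: "open \<Omega>" "connected \<Omega>"
    and f: "f holomorphic_on \<Omega>" "inj_on f \<Omega>" and h: "h holomorphic_on \<Omega>" "inj_on h \<Omega>" "h ` \<Omega> \<subseteq> \<Omega>"
    and K: "compact K" "K \<subseteq> \<Omega>" "K \<noteq> {}" and C: "C \<in> components (- K)" and c: "c \<in> C" "c \<in> \<Omega>"
    and hK: "h ` K \<inter> (K \<union> C) = {}" and side: "connected_component_set (- (h ` K)) (h c) \<inter> K = {}"
  shows "connected_component_set (- (f ` K)) (f c) \<inter> connected_component_set (- (f ` h ` K)) (f (h c)) = {}"
proof (rule ccontr)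
  assume meet: "\<not> ?thesis"
  have CK: "C \<subseteq> - K" using in_components_subset[OF C] .
  have cK: "c \<notin> K" using CK c by auto
  have compK: "connected_component_set (- K) c = C" using C c by (metis components_iff connected_component_eq)
  have comph: "compact (h ` K)"
    using h(1) K by (meson compact_continuous_image continuous_on_subset holomorphic_on_imp_continuous_on)
  have hKO: "h ` K \<subseteq> \<Omega>" using h(3) K(2) by auto
  have hc: "h c \<in> \<Omega>" "h c \<notin> h ` K" using c h K(2) cK by (auto dest!: inj_onD)
  define s where "s = connected_component_set (- (f ` K)) (f c)"
  define s' where "s' = connected_component_set (- (f ` h ` K)) (f (h c))"
  have fc: "f c \<notin> f ` K" using f(2) K(2) c cK by (auto dest!: inj_onD)
  have fhc: "f (h c) \<notin> f ` h ` K" using f(2) hKO hc by (auto dest!: inj_onD)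
  have s: "s \<in> components (- (f ` K))" "f c \<in> s" and s': "s' \<in> components (- (f ` h ` K))" "f (h c) \<in> s'"
    using fc fhc by (auto simp: s_def s'_def components_def)
  have "s \<inter> f ` h ` K = {}"
  proof (rule ccontr)
    assume "s \<inter> f ` h ` K \<noteq> {}"
    then obtain z where z: "z \<in> K" "f (h z) \<in> s" by auto
    \<comment> \<open>Joining points off the image under \<open>f\<close> is pulled back through
      \<open>f\<close>, which turns a meeting of the sides into a statement about \<open>K\<close>
      and its image under \<open>h\<close>.\<close>
    have "connected_component (- K) c (h z)"
    proof (rule connected_component_injective_image[OF \<Omega> f K(1,2) c(2) cK])
      show "connected_component (- (f ` K)) (f c) (f (h z))" using z(2) by (simp add: s_def)
    qed (use z hKO hK in auto)
    then have "h z \<in> C" using compK by auto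
    then show False using hK z by auto
  qed
  moreover have "s' \<inter> f ` K = {}"
  proof (rule ccontr)
    assume "s' \<inter> f ` K \<noteq> {}"
    then obtain z where z: "z \<in> K" "f z \<in> s'" by auto
    have "connected_component (- (h ` K)) (h c) z"
    proof (rule connected_component_injective_image[OF \<Omega> f comph hKO hc])
      show "connected_component (- (f ` h ` K)) (f (h c)) (f z)" using z(2) by (simp add: s'_def)
    qed (use z K hK in auto)
    then show False using side z by auto
  qed
  moreover have "s \<inter> s' \<noteq> {}" using meet by (simp add: s_def s'_def)
  moreover have "s \<subseteq> - (f ` K)" "s' \<subseteq> - (f ` h ` K)" "connected s" "connected s'"
    using s s' in_components_subset in_components_connected by blast+
  ultimately have "s \<subseteq> s'" "s' \<subseteq> s"
    using connected_subset_component[OF _ _ s'(1), of s] connected_subset_component[OF _ _ s(1), of s'] by blast+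
  then have ss': "s = s'" by auto
  have comp: "compact (f ` K)" "compact (f ` h ` K)"
    using f(1) K comph hKO by (meson compact_continuous_image continuous_on_subset holomorphic_on_imp_continuous_on)+
  have "f ` K \<inter> f ` h ` K = f ` (K \<inter> h ` K)"
    using inj_on_image_Int[OF f(2) K(2) hKO] by simp
  then have "f ` K \<inter> f ` h ` K = {}" using hK by auto
  then have "closure s \<subseteq> s"
    using closure_component_subset[OF s(1) compact_imp_closed[OF comp(1)]]
      closure_component_subset[OF s'(1) compact_imp_closed[OF comp(2)]] ss' by blast
  then show False
    using component_not_closed[OF compact_imp_closed[OF comp(1)] _ s(1)] K(3) by blast
qed

section \<open>Iterates of the self-maps and bad exponents\<close>

locale self_maps =
  fixes \<Omega> :: "complex set" and N :: nat and \<phi> :: "nat \<Rightarrow> complex \<Rightarrow> complex"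
  assumes dom: "domain_in_plane \<Omega>"
    and holo: "\<And>i. i \<in> {1..N} \<Longrightarrow> \<phi> i holomorphic_on \<Omega>"
    and maps: "\<And>i. i \<in> {1..N} \<Longrightarrow> \<phi> i ` \<Omega> \<subseteq> \<Omega>"
    and inj: "\<And>i. i \<in> {1..N} \<Longrightarrow> inj_on (\<phi> i) \<Omega>"
begin

lemma \<Omega>: "open \<Omega>" "connected \<Omega>" "\<Omega> \<noteq> {}"
  using dom by (auto simp: domain_in_plane_def)

text \<open>The index \<open>0\<close> stands for the identity, so that the sets in assertion (2) form one family
  over \<open>{0..N}\<close>.\<close>

definition iter :: "nat \<Rightarrow> nat \<Rightarrow> complex \<Rightarrow> complex" where
  "iter i n = (if i = 0 then id else \<phi> i ^^ n)"

lemma iter_0 [simp]: "iter 0 n = id" "iter i 0 = id"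
  by (simp_all add: iter_def)

lemma iter_add: "iter i (m + n) = iter i m \<circ> iter i n"
  by (simp add: iter_def funpow_add)

lemma iter_self_map:
  assumes "i \<le> N"
  shows "iter i n holomorphic_on \<Omega>" "iter i n ` \<Omega> \<subseteq> \<Omega>" "inj_on (iter i n) \<Omega>"
proof -
  have "iter i n holomorphic_on \<Omega> \<and> iter i n ` \<Omega> \<subseteq> \<Omega> \<and> inj_on (iter i n) \<Omega>"
  proof (cases "i = 0")
    case True
    then show ?thesis by (simp add: id_def)
  next
    case False
    then have i: "i \<in> {1..N}" using assms by auto
    show ?thesis
    proof (induction n)
      case 0 show ?case by (simp add: id_def)
    next
      case (Suc n)
      have eq: "iter i (Suc n) = \<phi> i \<circ> iter i n" using False by (simp add: iter_def)
      have "(\<phi> i \<circ> iter i n) holomorphic_on \<Omega>"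
        using Suc holo[OF i] by (intro holomorphic_on_compose_gen[where t = \<Omega>]) auto
      moreover have "inj_on (\<phi> i \<circ> iter i n) \<Omega>"
        using Suc inj[OF i] by (intro comp_inj_on) (auto intro: inj_on_subset)
      moreover have "(\<phi> i \<circ> iter i n) ` \<Omega> \<subseteq> \<Omega>" using Suc maps[OF i] by auto
      ultimately show ?case unfolding eq by blast
    qed
  qed
  then show "iter i n holomorphic_on \<Omega>" "iter i n ` \<Omega> \<subseteq> \<Omega>" "inj_on (iter i n) \<Omega>" by auto
qed

lemma iter_continuous: "i \<le> N \<Longrightarrow> S \<subseteq> \<Omega> \<Longrightarrow> continuous_on S (iter i n)"
  using iter_self_map(1) by (meson continuous_on_subset holomorphic_on_imp_continuous_on)

lemma iter_compact: "i \<le> N \<Longrightarrow> compact S \<Longrightarrow> S \<subseteq> \<Omega> \<Longrightarrow> compact (iter i n ` S)"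
  using iter_continuous compact_continuous_image by blast

lemma iter_connected: "i \<le> N \<Longrightarrow> connected S \<Longrightarrow> S \<subseteq> \<Omega> \<Longrightarrow> connected (iter i n ` S)"
  using iter_continuous connected_continuous_image by blast

definition admissible :: "nat \<Rightarrow> complex set \<Rightarrow> bool" where
  "admissible n L \<longleftrightarrow> n \<ge> 1 \<and> (\<forall>i\<le>N. plane_convex \<Omega> (iter i n ` L)) \<and>
     disjoint_family_on (\<lambda>i. iter i n ` L) {..N}"

lemma admissible_disjoint:
  assumes "admissible n L" "i \<le> N" "j \<le> N" "i \<noteq> j" "S \<subseteq> L" "T \<subseteq> L"
  shows "iter i n ` S \<inter> iter j n ` T = {}"
proof -
  have "iter i n ` L \<inter> iter j n ` L = {}"
    using assms(1-4) unfolding admissible_def disjoint_family_on_def by auto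
  then show ?thesis using assms(5,6) by blast
qed

lemma plane_convex_iter_mono:
  assumes "i \<le> N" "plane_convex \<Omega> K" "compact L" "L \<subseteq> \<Omega>" "K \<subseteq> L" "plane_convex \<Omega> (iter i n ` L)"
  shows "plane_convex \<Omega> (iter i n ` K)"
  using plane_convex_image_mono[OF \<Omega>(1) iter_self_map(1,3)[OF assms(1)] assms(2-6)] .

text \<open>Indexing the components by a point \<open>c\<close> makes components for different
  exponents correspond to each other.\<close>

definition side :: "complex set \<Rightarrow> nat \<Rightarrow> nat \<Rightarrow> complex \<Rightarrow> complex set" where
  "side K i n c = connected_component_set (- (iter i n ` K)) (iter i n c)"

end

text \<open>The loops that witness richness are collected in \<open>U\<close>, where they are
  controlled by admissibility for \<open>L\<close>: images of \<open>U\<close> are connected, avoid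
  the images of \<open>K\<close> with other indices and lie in convex images of
  \<open>L\<close>.\<close>

locale test_sets = self_maps +
  fixes K U L :: "complex set"
  assumes K: "plane_convex \<Omega> K" "connected K" "K \<noteq> {}"
    and U: "open U" "connected U" "K \<subseteq> U" "U \<subseteq> L"
    and L: "compact L" "L \<subseteq> \<Omega>"
    and rich_component: "\<And>C. C \<in> components (- K) \<Longrightarrow> rich \<Omega> (N + 2) C \<Longrightarrow>
      \<exists>\<gamma>. (\<forall>k<N + 2. loop_in (C \<inter> U) (\<gamma> k)) \<and> indep_loops \<Omega> (N + 2) \<gamma>"
    and rich_U: "\<exists>\<gamma>. (\<forall>k<N + 2. loop_in U (\<gamma> k)) \<and> indep_loops \<Omega> (N + 2) \<gamma>"
begin

text \<open>\<open>C\<close> stands for the component of \<open>- K\<close> whose part near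
  \<open>K\<close> is carried into the hole. Quantifying over all \<open>c\<close> in that part lets
  one \<open>c\<close> serve every exponent of the same colour.\<close>

definition bad :: "nat \<Rightarrow> nat \<Rightarrow> nat \<Rightarrow> complex set \<Rightarrow> bool" where
  "bad n i j C \<longleftrightarrow> i \<in> {1..N} \<and> j \<in> {1..N} \<and> i \<noteq> j \<and> C \<in> components (- K) \<and> C \<inter> U \<noteq> {} \<and>
     iter i n ` K \<inter> (K \<union> C) = {} \<and>
     (\<forall>c\<in>C \<inter> U. iter j n ` K \<subseteq> side K i n c \<and> side K i n c \<inter> (K \<union> C) = {})"

lemma exists_bad:
  assumes n: "admissible n L" and nc: "\<not> plane_convex \<Omega> (\<Union>i\<le>N. iter i n ` K)"
  obtains i j C where "bad n i j C"
proof -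
  have cK: "compact K" "K \<subseteq> \<Omega>" "K \<subseteq> L" "U \<subseteq> \<Omega>" using K U L by (auto simp: plane_convex_def)
  have clK: "closed K" using cK by (simp add: compact_imp_closed)
  define A where "A i = iter i n ` K" for i
  define X where "X = (\<Union>i\<le>N. A i)"
  have A0: "A 0 = K" by (simp add: A_def)
  have A: "compact (A i)" "connected (A i)" "plane_convex \<Omega> (A i)" "A i \<noteq> {}" if "i \<le> N" for i
    using that iter_compact iter_connected K cK plane_convex_iter_mono[OF that K(1) L cK(3)] n
    unfolding A_def admissible_def by auto
  have disj: "A i \<inter> A j = {}" if "i \<le> N" "j \<le> N" "i \<noteq> j" for i j
    using admissible_disjoint[OF n that cK(3) cK(3)] by (simp add: A_def)
  have disj': "iter i n ` U \<inter> A j = {}" if "i \<le> N" "j \<le> N" "i \<noteq> j" for i j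
    using admissible_disjoint[OF n that U(4) cK(3)] by (simp add: A_def)
  have X: "compact X" "X \<subseteq> \<Omega>"
    unfolding X_def using A(1,3) by (auto intro!: compact_UN simp: plane_convex_def)
  obtain V where V: "V \<in> components (- X)" "bounded V" "V \<subseteq> \<Omega>"
    using nc X unfolding plane_convex_def X_def A_def by blast
  have Vp: "open V" "connected V" "V \<noteq> {}" "V \<subseteq> - X"
    using V(1) open_plane_component[OF compact_imp_closed[OF X(1)]] in_components_connected
      in_components_nonempty in_components_subset by blast+
  have AX: "A i \<subseteq> X" if "i \<le> N" for i using that by (auto simp: X_def)
  have VA: "V \<inter> A i = {}" if "i \<le> N" for i using Vp(4) AX[OF that] by auto
  have clV: "closure V \<subseteq> V \<union> X" using closure_component_subset[OF V(1) compact_imp_closed[OF X(1)]] .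
  have V_poor: "\<not> rich \<Omega> (N + 2) V"
  proof (rule not_rich_if_frontier_covered[OF Vp(1) V(3), where J = "{..N}" and A = A])
    show "frontier V \<subseteq> (\<Union>j\<in>{..N}. A j)"
      using clV interior_open[OF Vp(1)] unfolding frontier_def X_def by auto
    show "A j \<inter> V = {}" if "j \<in> {..N}" for j using VA that by auto
  qed (use A in auto)
  \<comment> \<open>The image of \<open>U\<close> is an open neighbourhood of \<open>A i\<close> and
    therefore enters \<open>V\<close>. The part of \<open>C\<close> in \<open>U\<close> is connected
    and its image misses \<open>X\<close>, so all of it lands in \<open>V\<close>; independent loops
    in it would make \<open>V\<close> rich.\<close>
  have touch: "\<exists>C\<in>components (- K). C \<inter> U \<noteq> {} \<and> iter i n ` (C \<inter> U) \<subseteq> V \<and> \<not> rich \<Omega> (N + 2) C"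
    if i: "i \<le> N" and cl: "closure V \<inter> A i \<noteq> {}" for i
  proof -
    note it = iter_self_map[OF i, of n]
    have itU: "iter i n holomorphic_on U" "inj_on (iter i n) U"
      using holomorphic_on_subset[OF it(1) cK(4)] inj_on_subset[OF it(3) cK(4)] by auto
    have "open (iter i n ` U)" by (rule open_mapping_thm3[OF itU(1) U(1) itU(2)])
    moreover have "iter i n ` U \<inter> closure V \<noteq> {}" using cl U(3) unfolding A_def by blast
    ultimately have "iter i n ` U \<inter> V \<noteq> {}" using open_Int_closure_eq_empty by blast
    then obtain x where x: "x \<in> U" "iter i n x \<in> V" by auto
    have xK: "x \<notin> K" using x VA[OF i] by (auto simp: A_def)
    obtain C where C: "C \<in> components (- K)" "x \<in> C" using component_containing[OF xK] .
    have CU: "connected (C \<inter> U)" "open (C \<inter> U)" "C \<inter> U \<subseteq> \<Omega>"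
      using connected_component_Int[OF cK(1) U(3,1,2) C(1)] open_plane_component[OF clK C(1)] U(1) cK(4) by auto
    have "iter i n ` (C \<inter> U) \<inter> A j = {}" if "j \<le> N" for j
    proof (cases "j = i")
      case True
      have "(C \<inter> U) \<inter> K = {}" using in_components_subset[OF C(1)] by auto
      then show ?thesis
        using inj_on_image_Int[OF it(3) CU(3) cK(2)] unfolding True A_def by auto
    next
      case False
      then show ?thesis using disj'[OF i that] by blast
    qed
    then have "iter i n ` (C \<inter> U) \<subseteq> - X" unfolding X_def by blast
    then have sub: "iter i n ` (C \<inter> U) \<subseteq> V"
      using x C(2) by (intro connected_subset_component[OF iter_connected[OF i CU(1,3)] _ V(1)]) auto
    have "\<not> rich \<Omega> (N + 2) C"
    proof
      assume "rich \<Omega> (N + 2) C"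
      then obtain \<gamma> where \<gamma>: "\<And>k. k < N + 2 \<Longrightarrow> loop_in (C \<inter> U) (\<gamma> k)" "indep_loops \<Omega> (N + 2) \<gamma>"
        using rich_component[OF C(1)] by blast
      have "rich \<Omega> (N + 2) V"
        by (rule rich_transfer[OF \<Omega>(1) it _ L(2) CU(2) _ \<gamma> sub])
          (use n i U(4) in \<open>auto simp: admissible_def\<close>)
      then show False using V_poor by simp
    qed
    then show ?thesis using C sub x(1) by blast
  qed
  \<comment> \<open>The image of \<open>U\<close> misses \<open>K\<close>, so it enters
    \<open>C\<close> as a whole and brings its independent loops along.\<close>
  have capture: "rich \<Omega> (N + 2) C" if i: "i \<le> N" "i \<noteq> 0" and C: "C \<in> components (- K)" and meet: "A i \<inter> C \<noteq> {}" for i C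
  proof -
    note it = iter_self_map[OF i(1), of n]
    have "iter i n ` U \<subseteq> - K" using disj'[OF i(1) _ i(2)] by (auto simp: A0)
    then have sub: "iter i n ` U \<subseteq> C"
      using meet U(3) by (intro connected_subset_component[OF iter_connected[OF i(1) U(2) cK(4)] _ C]) (auto simp: A_def)
    obtain \<gamma> where \<gamma>: "\<And>k. k < N + 2 \<Longrightarrow> loop_in U (\<gamma> k)" "indep_loops \<Omega> (N + 2) \<gamma>"
      using rich_U by blast
    show ?thesis
      by (rule rich_transfer[OF \<Omega>(1) it _ L(2) U(1,4) \<gamma> sub]) (use n i in \<open>auto simp: admissible_def\<close>)
  qed
  \<comment> \<open>Touching \<open>K\<close> would put \<open>C \<inter> U\<close> itself into
    \<open>V\<close>. As no image enters the poor component \<open>C\<close>, all of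
    \<open>C\<close> would lie in \<open>V\<close> and be a hole of \<open>K\<close> inside
    \<open>\<Omega>\<close>.\<close>
  have away: "closure V \<inter> K = {}"
  proof (rule ccontr)
    assume "closure V \<inter> K \<noteq> {}"
    then obtain C where C: "C \<in> components (- K)" "C \<inter> U \<noteq> {}" "C \<inter> U \<subseteq> V" "\<not> rich \<Omega> (N + 2) C"
      using touch[of 0] by (auto simp: A0)
    have "A i \<inter> C = {}" if "i \<le> N" for i
      using capture[OF that _ C(1)] C(4) in_components_subset[OF C(1)] A0 by (cases "i = 0") auto
    then have "C \<subseteq> - X" unfolding X_def by blast
    then have "C \<subseteq> V"
      using C by (intro connected_subset_component[OF in_components_connected[OF C(1)] _ V(1)]) auto
    then have "bounded C" "C \<subseteq> \<Omega>" using V bounded_subset by blast+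
    then show False using K(1) C(1) unfolding plane_convex_def by blast
  qed
  obtain x v where x: "x \<in> K" and v: "v \<in> V" using K(3) Vp(3) by auto
  \<comment> \<open>If no touched set separated \<open>x\<close> from \<open>v\<close>, neither
    would their disjoint union, and a connected set joining the two points off that union could not
    leave \<open>V\<close>.\<close>
  obtain i where i: "i \<le> N" "i \<noteq> 0" "closure V \<inter> A i \<noteq> {}" "\<not> connected_component (- A i) x v"
  proof (rule ccontr)
    assume neg: "\<not> thesis"
    define J where "J = {i \<in> {..N}. closure V \<inter> A i \<noteq> {}}"
    have "connected_component (- (\<Union>j\<in>J. A j)) x v"
    proof (rule not_separated_by_disjoint_union)
      show "connected_component (- A j) x v" if "j \<in> J" for j
        using that neg \<open>\<And>i. \<lbrakk>i \<le> N; i \<noteq> 0; closure V \<inter> A i \<noteq> {}; \<not> connected_component (- A i) x v\<rbrakk> \<Longrightarrow> thesis\<close> away A0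
        unfolding J_def by (cases "j = 0") auto
      show "disjoint_family_on A J" using disj unfolding disjoint_family_on_def J_def by auto
    qed (use A in \<open>auto simp: J_def\<close>)
    then obtain T where T: "connected T" "T \<subseteq> - (\<Union>j\<in>J. A j)" "x \<in> T" "v \<in> T"
      unfolding connected_component_def by blast
    have "closure V \<inter> X \<subseteq> (\<Union>j\<in>J. A j)" unfolding X_def J_def by blast
    then have "T \<inter> closure V \<subseteq> V" using T(2) clV by blast
    then have "T \<subseteq> V"
      using T v by (intro connected_subset_relatively_clopen[OF T(1) Vp(1)]) auto
    then show False using T(3) x VA[of 0] A0 by auto
  qed
  obtain C where C: "C \<in> components (- K)" "C \<inter> U \<noteq> {}" "iter i n ` (C \<inter> U) \<subseteq> V" "\<not> rich \<Omega> (N + 2) C"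
    using touch[OF i(1,3)] by blast
  define s where "s = connected_component_set (- A i) v"
  have "v \<notin> A i" using v VA[OF i(1)] by auto
  then have s: "s \<in> components (- A i)" "v \<in> s" by (auto simp: s_def components_def)
  have Vs: "V \<subseteq> s"
    using v s VA[OF i(1)] by (intro connected_subset_component[OF Vp(2) _ s(1)]) auto
  have xs: "x \<notin> s" using i(4) unfolding s_def by (auto dest: connected_component_sym)
  \<comment> \<open>Otherwise \<open>s\<close> would lie in \<open>V\<close> and be a hole of the
    convex set \<open>A i\<close> inside \<open>\<Omega>\<close>.\<close>
  obtain j where j: "j \<le> N" "j \<noteq> i" "A j \<inter> s \<noteq> {}"
  proof (rule ccontr)
    assume neg: "\<not> thesis"
    have "A j \<inter> s = {}" if "j \<le> N" for j
      using that neg \<open>\<And>j. \<lbrakk>j \<le> N; j \<noteq> i; A j \<inter> s \<noteq> {}\<rbrakk> \<Longrightarrow> thesis\<close> in_components_subset[OF s(1)] by (cases "j = i") auto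
    then have "s \<subseteq> - X" unfolding X_def by blast
    then have "s \<subseteq> V" using s v by (intro connected_subset_component[OF in_components_connected[OF s(1)] _ V(1)]) auto
    then have "bounded s" "s \<subseteq> \<Omega>" using V bounded_subset by blast+
    then show False using A(3)[OF i(1)] s(1) unfolding plane_convex_def by blast
  qed
  have js: "A j \<subseteq> s"
    using disj[OF j(1) i(1) j(2)] j(3) by (intro connected_subset_component[OF A(2)[OF j(1)] _ s(1)]) auto
  have "j \<noteq> 0"
  proof
    assume "j = 0"
    then show False using js xs x A0 by auto
  qed
  have AiK: "A i \<inter> (K \<union> C) = {}"
    using capture[OF i(1,2) C(1)] C(4) disj[OF i(1) _ i(2)] A0 by auto
  have "connected (K \<union> C)" by (rule connected_Un_component[OF cK(1) K(2) C(1)])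
  then have sKC: "s \<inter> (K \<union> C) = {}"
    using connected_subset_component[of "K \<union> C" "A i" s] AiK s(1) x xs by blast
  have side: "side K i n c = s" if "c \<in> C \<inter> U" for c
  proof -
    have "iter i n c \<in> s" using C(3) that Vs by auto
    then show ?thesis
      using s(1) unfolding side_def A_def[symmetric] by (metis components_iff connected_component_eq)
  qed
  have "bad n i j C"
    unfolding bad_def using i j \<open>j \<noteq> 0\<close> C(1,2) AiK js sKC side by (auto simp: A_def)
  then show thesis by (rule that)
qed

text \<open>Badness of \<open>p\<close>, transported by \<open>iter i y\<close>, makes the sides at
  \<open>y\<close> and \<open>y + p\<close> disjoint. The set \<open>F\<close> links the two images
  with index \<open>j\<close> without meeting those with index \<open>i\<close>, so it lies in both
  sides.\<close>

lemma no_bad_triangle: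
  assumes p: "bad p i j C" and y: "bad y i j C" and yp: "bad (y + p) i j C"
    and F: "connected F" "iter j y ` K \<subseteq> F" "iter j (y + p) ` K \<subseteq> F"
      "F \<inter> iter i y ` K = {}" "F \<inter> iter i (y + p) ` K = {}"
  shows False
proof -
  have cK: "compact K" "K \<subseteq> \<Omega>" using K by (auto simp: plane_convex_def)
  have i: "i \<le> N" and C: "C \<in> components (- K)" using p by (auto simp: bad_def)
  obtain c where c: "c \<in> C" "c \<in> U" using p by (auto simp: bad_def)
  then have c\<Omega>: "c \<in> \<Omega>" using U L by auto
  have eq: "iter i (y + p) ` K = iter i y ` iter i p ` K" "iter i (y + p) c = iter i y (iter i p c)"
    by (simp_all add: iter_add image_comp)
  have "iter i p ` K \<inter> (K \<union> C) = {}" "side K i p c \<inter> K = {}" using p c by (auto simp: bad_def)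
  then have "side K i y c \<inter> side K i (y + p) c = {}"
    using iterated_sides_disjoint[OF \<Omega>(1,2) iter_self_map(1,3)[OF i, of y] iter_self_map(1,3,2)[OF i, of p]
      cK K(3) C c(1) c\<Omega>] unfolding side_def eq by blast
  moreover have "F \<subseteq> side K i n c" if n: "bad n i j C" "iter j n ` K \<subseteq> F" "F \<inter> iter i n ` K = {}" for n
  proof (rule connected_subset_component[OF F(1)])
    show "F \<subseteq> - (iter i n ` K)" using n by auto
    have sub: "iter j n ` K \<subseteq> side K i n c" using n(1) c unfolding bad_def by blast
    then show "F \<inter> side K i n c \<noteq> {}" using n(2) K(3) by blast
    \<comment> \<open>\<open>connected_component_set\<close> is empty at a base point outside its
      set, so non-emptiness shows that \<open>iter i n c\<close> is off the image of
      \<open>K\<close>.\<close>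
    have "side K i n c \<noteq> {}" using sub K(3) by auto
    then have "iter i n c \<in> - (iter i n ` K)"
      unfolding side_def using connected_component_eq_empty by blast
    then show "side K i n c \<in> components (- (iter i n ` K))"
      unfolding side_def components_def by (rule imageI)
  qed
  ultimately show False using y yp F K(3) by blast
qed

end

section \<open>Choosing the exponent\<close>

text \<open>\<open>M\<close> precedes the colouring because the sequence of exponents is built to a
  length fixed in advance. For the colour of \<open>u b - u a\<close>, a monochromatic triangle
  yields exponents \<open>p\<close>, \<open>y\<close> and \<open>y + p\<close>.\<close>

lemma ramsey_triangle:
  fixes S :: "'a set"
  assumes S: "finite S"
  shows "\<exists>M :: nat. \<forall>col. (\<forall>a b. a < b \<longrightarrow> b < M \<longrightarrow> col a b \<in> S) \<longrightarrow>
     (\<exists>a b c. a < b \<and> b < c \<and> c < M \<and> col a b = col b c \<and> col a c = col b c)"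
proof -
  obtain h where h: "bij_betw h S {0..<card S}" using ex_bij_betw_finite_nat[OF S] by blast
  obtain M :: nat where M: "partn_lst {..<M} (replicate (card S) 3) 2" using ramsey_full by blast
  show ?thesis
  proof (rule exI[of _ M], intro allI impI)
    fix col :: "nat \<Rightarrow> nat \<Rightarrow> 'a" assume col: "\<forall>a b. a < b \<longrightarrow> b < M \<longrightarrow> col a b \<in> S"
    define f where "f X = h (col (Min X) (Max X))" for X :: "nat set"
    have f2: "f {a,b} = h (col a b)" if "a < b" for a b using that by (simp add: f_def)
    have "f \<in> nsets {..<M} 2 \<rightarrow> {..<card S}"
    proof
      fix X assume "X \<in> nsets {..<M} 2"
      then obtain a b where "X = {a,b}" "a < b" "b < M" by (auto simp: ordered_nsets_2_eq)
      then show "f X \<in> {..<card S}" using f2 col h by (auto simp: bij_betw_def)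
    qed
    then obtain i H where H: "i < card S" "H \<in> nsets {..<M} 3" "f ` (nsets H 2) \<subseteq> {i}"
      using partn_lstE[OF M] by (metis length_replicate nth_replicate)
    then obtain a b c where abc: "H = {a,b,c}" "a < b" "b < c" "c < M" by (auto simp: ordered_nsets_3_eq)
    have "f {a,b} = i" "f {b,c} = i" "f {a,c} = i" using H(3) abc by (auto simp: image_subset_iff)
    then have "h (col a b) = i" "h (col b c) = i" "h (col a c) = i" using f2 abc by auto
    moreover have "col a b \<in> S" "col b c \<in> S" "col a c \<in> S" using col abc by auto
    ultimately have "col a b = col b c" "col a c = col b c" using h by (auto simp: bij_betw_def inj_on_def)
    then show "\<exists>a b c. a < b \<and> b < c \<and> c < M \<and> col a b = col b c \<and> col a c = col b c" using abc by blast
  qed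
qed

section \<open>Simultaneous approximation and neighbourhoods of functions\<close>

lemma disjoint_open_neighbourhoods:
  fixes A :: "'i \<Rightarrow> 'a::euclidean_space set"
  assumes "finite I" "\<And>i. i \<in> I \<Longrightarrow> compact (A i)" "disjoint_family_on A I"
  obtains W where "\<And>i. i \<in> I \<Longrightarrow> open (W i)" "\<And>i. i \<in> I \<Longrightarrow> A i \<subseteq> W i" "disjoint_family_on W I"
proof -
  have "\<exists>W. (\<forall>i\<in>I. open (W i) \<and> A i \<subseteq> W i) \<and> disjoint_family_on W I"
    using assms
  proof (induction I rule: finite_induct)
    case empty
    show ?case by (auto simp: disjoint_family_on_def)
  next
    case (insert i I)
    have "\<exists>W. (\<forall>i\<in>I. open (W i) \<and> A i \<subseteq> W i) \<and> disjoint_family_on W I"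
      by (rule insert.IH) (use insert.prems in \<open>auto simp: disjoint_family_on_def\<close>)
    then obtain W where W: "\<And>j. j \<in> I \<Longrightarrow> open (W j) \<and> A j \<subseteq> W j" "disjoint_family_on W I"
      by blast
    have "compact (A i)" "compact (\<Union>j\<in>I. A j)" using insert by auto
    moreover have "A i \<inter> (\<Union>j\<in>I. A j) = {}" using insert.prems(2) insert.hyps by (fastforce simp: disjoint_family_on_def)
    ultimately obtain P Q where PQ: "open P" "open Q" "A i \<subseteq> P" "(\<Union>j\<in>I. A j) \<subseteq> Q" "P \<inter> Q = {}"
      using separation_normal_compact[of "A i" "\<Union>j\<in>I. A j"] by (metis compact_imp_closed)
    define W' where "W' j = (if j = i then P else W j \<inter> Q)" for j
    have "\<forall>j\<in>insert i I. open (W' j) \<and> A j \<subseteq> W' j" using W PQ unfolding W'_def by auto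
    moreover have "disjoint_family_on W' (insert i I)"
      unfolding disjoint_family_on_def
    proof (intro ballI impI)
      fix j k assume jk: "j \<in> insert i I" "k \<in> insert i I" "j \<noteq> k"
      then show "W' j \<inter> W' k = {}"
        using PQ(5) W(2) unfolding W'_def disjoint_family_on_def by auto
    qed
    ultimately show ?case by blast
  qed
  then show thesis using that by blast
qed

text \<open>After shrinking the domains to disjoint neighbourhoods the functions glue to one
  holomorphic function near the union, to which Runge's theorem applies.\<close>

lemma runge_disjoint_family:
  assumes I: "finite I" and A: "\<And>i. i \<in> I \<Longrightarrow> compact (A i)" "disjoint_family_on A I"
    and M: "plane_convex \<Omega> (\<Union>i\<in>I. A i)"
    and f: "\<And>i. i \<in> I \<Longrightarrow> open (W i)" "\<And>i. i \<in> I \<Longrightarrow> A i \<subseteq> W i" "\<And>i. i \<in> I \<Longrightarrow> f i holomorphic_on W i"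
    and e: "e > 0"
  obtains g where "g holomorphic_on \<Omega>" "\<And>i z. i \<in> I \<Longrightarrow> z \<in> A i \<Longrightarrow> norm (g z - f i z) < e"
proof -
  obtain V where V: "\<And>i. i \<in> I \<Longrightarrow> open (V i)" "\<And>i. i \<in> I \<Longrightarrow> A i \<subseteq> V i" "disjoint_family_on V I"
    using disjoint_open_neighbourhoods[OF I A] by metis
  define G where "G z = f (THE i. i \<in> I \<and> z \<in> V i) z" for z
  have G: "G z = f i z" if "i \<in> I" "z \<in> V i" for i z
  proof -
    have "(THE i. i \<in> I \<and> z \<in> V i) = i"
      using that V(3) by (intro the_equality) (auto simp: disjoint_family_on_def)
    then show ?thesis by (simp add: G_def)
  qed
  have "G holomorphic_on (\<Union>i\<in>I. V i \<inter> W i)"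
  proof (rule holomorphic_on_UN_open)
    fix i assume i: "i \<in> I"
    show "open (V i \<inter> W i)" using V f i by auto
    have "f i holomorphic_on V i \<inter> W i" using f(3)[OF i] by (rule holomorphic_on_subset) auto
    then show "G holomorphic_on V i \<inter> W i" by (rule holomorphic_transform) (use G i in auto)
  qed
  moreover have "open (\<Union>i\<in>I. V i \<inter> W i)" using V(1) f(1) by (intro open_UN ballI open_Int)
  moreover have "(\<Union>i\<in>I. A i) \<subseteq> (\<Union>i\<in>I. V i \<inter> W i)" using V(2) f(2) by blast
  ultimately have "approximable \<Omega> (\<Union>i\<in>I. A i) G" using runge[OF M] by blast
  then obtain g where g: "g holomorphic_on \<Omega>" "\<forall>z\<in>\<Union>i\<in>I. A i. norm (g z - G z) < e"
    using e unfolding approximable_def by blast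
  show thesis
  proof (rule that[OF g(1)])
    fix i z assume "i \<in> I" "z \<in> A i"
    then show "norm (g z - f i z) < e" using g(2) G V(2) by fastforce
  qed
qed

text \<open>The distance to \<open>h\<close> attains its maximum on the compact set
  \<open>M\<close>, so a strict bound leaves room for a smaller ball.\<close>

lemma openin_holo_topology_ball:
  assumes M: "compact M" "M \<subseteq> \<Omega>" and h: "h holomorphic_on \<Omega>"
  shows "openin (holo_topology \<Omega>) {f \<in> holo_fun \<Omega>. \<forall>z\<in>M. dist (f z) (h z) < e}"
  unfolding openin_holo_topology
proof (intro conjI ballI)
  fix f assume f: "f \<in> {f \<in> holo_fun \<Omega>. \<forall>z\<in>M. dist (f z) (h z) < e}"
  show "\<exists>K d. compact K \<and> K \<subseteq> \<Omega> \<and> d > 0 \<and>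
      {g \<in> holo_fun \<Omega>. \<forall>z\<in>K. dist (g z) (f z) < d} \<subseteq> {f \<in> holo_fun \<Omega>. \<forall>z\<in>M. dist (f z) (h z) < e}"
  proof (cases "M = {}")
    case True
    then show ?thesis by (intro exI[of _ "{}"] exI[of _ "1::real"]) auto
  next
    case False
    have "continuous_on M f" "continuous_on M h"
      using f h M(2) by (auto simp: holo_fun_def intro: holomorphic_on_imp_continuous_on holomorphic_on_subset)
    then have cont: "continuous_on M (\<lambda>z. dist (f z) (h z))" by (intro continuous_intros)
    then obtain z0 where z0: "z0 \<in> M" "\<And>z. z \<in> M \<Longrightarrow> dist (f z) (h z) \<le> dist (f z0) (h z0)"
      using continuous_attains_sup[OF M(1) False cont] by blast
    define d where "d = e - dist (f z0) (h z0)"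
    have d: "d > 0" using f z0(1) by (simp add: d_def)
    have "dist (g z) (h z) < e" if "dist (g z) (f z) < d" "z \<in> M" for g z
      using dist_triangle[of "g z" "h z" "f z"] z0(2)[OF that(2)] that(1) by (simp add: d_def)
    then show ?thesis using M d by (intro exI[of _ M] exI[of _ d]) auto
  qed
qed auto

text \<open>A plane domain stays connected when one point is removed, so each new component of the
  complement contains some \<open>C - {p C}\<close>; if it were a hole inside
  \<open>\<Omega>\<close>, so would be \<open>C\<close>.\<close>

lemma plane_convex_Un_finite:
  assumes K: "plane_convex \<Omega> K" and P: "\<And>C. C \<in> components (- K) \<Longrightarrow> p C \<in> C" "\<And>C. C \<in> components (- K) \<Longrightarrow> p C \<in> \<Omega>"
    and \<Omega>: "open \<Omega>"
  shows "plane_convex \<Omega> (K \<union> p ` components (- K))"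
  unfolding plane_convex_def
proof (intro conjI ballI impI notI)
  let ?P = "p ` components (- K)"
  have cK: "compact K" "K \<subseteq> \<Omega>" using K by (auto simp: plane_convex_def)
  have fin: "finite (components (- K))" using finite_components_plane_convex[OF K \<Omega>] .
  then show "compact (K \<union> ?P)" by (intro compact_Un cK(1) finite_imp_compact finite_imageI)
  show "K \<union> ?P \<subseteq> \<Omega>" using cK P by auto
  fix D assume D: "D \<in> components (- (K \<union> ?P))" "bounded D" "D \<subseteq> \<Omega>"
  obtain x where x: "x \<in> D" "x \<in> - (K \<union> ?P)"
    using in_components_nonempty[OF D(1)] in_components_subset[OF D(1)] by blast
  obtain C where C: "C \<in> components (- K)" "x \<in> C" using component_containing[of x K] x(2) by auto
  have "connected (C - {p C})"
    by (rule connected_open_delete[OF open_plane_component[OF compact_imp_closed[OF cK(1)] C(1)] in_components_connected[OF C(1)]]) simp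
  moreover have "C - {p C} \<subseteq> - (K \<union> ?P)"
  proof -
    have "p C' \<in> C \<Longrightarrow> C' = C" if "C' \<in> components (- K)" for C'
      using components_eq[OF that C(1)] P(1)[OF that] by auto
    then show ?thesis using in_components_subset[OF C(1)] by auto
  qed
  moreover have "x \<in> C - {p C}" using C x(2) by auto
  ultimately have sub: "C - {p C} \<subseteq> D"
    using x(1) by (intro connected_subset_component[OF _ _ D(1)]) auto
  then have "C \<subseteq> insert (p C) D" by auto
  then have "bounded C" "C \<subseteq> \<Omega>" using D(2,3) P(2)[OF C(1)] by (auto intro: bounded_subset[of "insert (p C) D"])
  then show False using K C(1) unfolding plane_convex_def by blast
qed

lemma component_Int_nonempty:
  fixes K :: "complex set"
  assumes K: "compact K" "K \<noteq> {}" "K \<subseteq> U" "open U" and C: "C \<in> components (- K)"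
  shows "C \<inter> U \<noteq> {}"
proof
  assume "C \<inter> U = {}"
  then have "closure C \<inter> U = {}" using open_Int_closure_eq_empty[OF K(4), of C] by auto
  then have "closure C \<subseteq> C" using closure_component_subset[OF C compact_imp_closed[OF K(1)]] K(3) by auto
  then show False using component_not_closed[OF compact_imp_closed[OF K(1)] K(2) C] by simp
qed

section \<open>Sequences of exponents with admissible differences\<close>

context self_maps
begin

lemma admissible_iff:
  assumes "plane_convex \<Omega> K"
  shows "admissible n K \<longleftrightarrow> n \<ge> 1 \<and> (\<forall>i\<in>{1..N}. plane_convex \<Omega> ((\<phi> i ^^ n) ` K)) \<and>
    (\<forall>i\<in>{1..N}. K \<inter> (\<phi> i ^^ n) ` K = {}) \<and> disjoint_family_on (\<lambda>i. (\<phi> i ^^ n) ` K) {1..N}"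
proof -
  have iter: "iter i n = \<phi> i ^^ n" if "i \<in> {1..N}" for i using that by (simp add: iter_def)
  have atMost: "{..N} = insert 0 {1..N}" by auto
  have "(\<forall>i\<le>N. plane_convex \<Omega> (iter i n ` K)) \<longleftrightarrow> (\<forall>i\<in>{1..N}. plane_convex \<Omega> ((\<phi> i ^^ n) ` K))"
  proof -
    have "(\<forall>i\<le>N. Q i) \<longleftrightarrow> Q 0 \<and> (\<forall>i\<in>{1..N}. Q i)" for Q
      using atMost by (metis atMost_iff insert_iff)
    then show ?thesis using assms iter by simp
  qed
  moreover have "disjoint_family_on (\<lambda>i. iter i n ` K) {..N} \<longleftrightarrow>
    (\<forall>i\<in>{1..N}. K \<inter> (\<phi> i ^^ n) ` K = {}) \<and> disjoint_family_on (\<lambda>i. (\<phi> i ^^ n) ` K) {1..N}"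
  proof -
    have "disjoint_family_on (\<lambda>i. iter i n ` K) {1..N} \<longleftrightarrow> disjoint_family_on (\<lambda>i. (\<phi> i ^^ n) ` K) {1..N}"
      by (simp add: disjoint_family_on_def iter)
    moreover have "disjoint_family_on (\<lambda>i. iter i n ` K) {..N} \<longleftrightarrow>
      (\<forall>i\<in>{1..N}. K \<inter> iter i n ` K = {}) \<and> disjoint_family_on (\<lambda>i. iter i n ` K) {1..N}"
    proof -
      have e: "disjoint_family_on (\<lambda>i. iter i n ` K) (insert 0 {1..N}) \<longleftrightarrow>
        iter 0 n ` K \<inter> (\<Union>i\<in>{1..N}. iter i n ` K) = {} \<and> disjoint_family_on (\<lambda>i. iter i n ` K) {1..N}"
        by (rule disjoint_family_on_insert) simp
      have e': "iter 0 n ` K = K" by simp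
      have "K \<inter> (\<Union>i\<in>I. A i) = {} \<longleftrightarrow> (\<forall>i\<in>I. K \<inter> A i = {})" for A :: "nat \<Rightarrow> complex set" and I
        by blast
      then show ?thesis unfolding atMost e e' by (rule arg_cong)
    qed
    ultimately show ?thesis by (simp add: iter)
  qed
  ultimately show ?thesis unfolding admissible_def by blast
qed

lemma admissible_subset:
  assumes "admissible n L" "plane_convex \<Omega> K" "K \<subseteq> L" "plane_convex \<Omega> L"
  shows "admissible n K"
  unfolding admissible_def
proof (intro conjI allI impI)
  show "n \<ge> 1" using assms by (simp add: admissible_def)
  show "plane_convex \<Omega> (iter i n ` K)" if "i \<le> N" for i
  proof (rule plane_convex_iter_mono[OF that assms(2) _ _ assms(3)])
    show "compact L" "L \<subseteq> \<Omega>" using assms(4) by (auto simp: plane_convex_def)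
    show "plane_convex \<Omega> (iter i n ` L)" using assms(1) that by (simp add: admissible_def)
  qed
  show "disjoint_family_on (\<lambda>i. iter i n ` K) {..N}"
    unfolding disjoint_family_on_def using admissible_disjoint[OF assms(1) _ _ _ assms(3,3)] by auto
qed

text \<open>Besides admissibility of the differences ending at \<open>u b\<close>, disjoint
  connected sets \<open>F i\<close> are required that contain all the corresponding images of
  \<open>L\<close>. They link images for two differences with a common end.\<close>

definition chain_step :: "complex set \<Rightarrow> (nat \<Rightarrow> nat) \<Rightarrow> nat \<Rightarrow> bool" where
  "chain_step L u b \<longleftrightarrow> (\<forall>a<b. u a < u b \<and> admissible (u b - u a) L) \<and>
    (\<exists>F. (\<forall>i\<le>N. connected (F i)) \<and> disjoint_family_on F {..N} \<and> (\<forall>i\<le>N. \<forall>a<b. iter i (u b - u a) ` L \<subseteq> F i))"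

text \<open>The step to the new term is admissible for a connected convex \<open>L'\<close> that
  already contains the images of \<open>L\<close> for all differences ending at the last term.
  Differences ending at the new term then map \<open>L\<close> into the images of \<open>L'\<close>,
  which serve as the sets \<open>F i\<close>.\<close>

lemma admissible_sequence:
  assumes ex: "\<And>K. plane_convex \<Omega> K \<Longrightarrow> \<exists>n. admissible n K" and L: "plane_convex \<Omega> L"
  shows "\<exists>u :: nat \<Rightarrow> nat. \<forall>b<M. chain_step L u b"
proof (induction M)
  case 0
  then show ?case by simp
next
  case (Suc M)
  from Suc.IH obtain u :: "nat \<Rightarrow> nat" where uP: "\<forall>b<M. chain_step L u b" ..
  have u: "u a < u b \<and> admissible (u b - u a) L" if "b < M" "a < b" for a b
    using uP that by (simp add: chain_step_def)
  have uF: "\<exists>F. (\<forall>i\<le>N. connected (F i)) \<and> disjoint_family_on F {..N} \<and> (\<forall>i\<le>N. \<forall>a<b. iter i (u b - u a) ` L \<subseteq> F i)" if "b < M" for b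
    using uP that by (simp add: chain_step_def)
  have cL: "compact L" "L \<subseteq> \<Omega>" using L by (auto simp: plane_convex_def)
  \<comment> \<open>\<open>k (M - 1)\<close> is zero and hence no admissible exponent, which
    explains the case distinction in \<open>ka\<close>. For \<open>M = 0\<close> the set
    \<open>B\<close> is empty.\<close>
  define k where "k a = u (M - 1) - u a" for a
  define B where "B = (\<Union>i\<le>N. \<Union>a<M. iter i (k a) ` L)"
  have ka: "k a = 0 \<or> admissible (k a) L" if "a < M" for a
  proof (cases "a = M - 1")
    case False
    then have "M - 1 < M" "a < M - 1" using that by auto
    then show ?thesis using u by (simp add: k_def)
  qed (simp add: k_def)
  have "compact B" "B \<subseteq> \<Omega>"
    unfolding B_def using iter_compact[OF _ cL] iter_self_map(2) cL(2) by (auto intro!: compact_UN) blast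
  then obtain L' where L': "plane_convex \<Omega> L'" "connected L'" "B \<subseteq> interior L'"
    using plane_convex_connected_superset[OF _ _ \<Omega>] by metis
  then have BL: "B \<subseteq> L'" and cL': "compact L'" "L' \<subseteq> \<Omega>"
    using interior_subset by (auto simp: plane_convex_def)
  have iBL: "iter i (k a) ` L \<subseteq> L'" if "i \<le> N" "a < M" for i a using BL that unfolding B_def by blast
  obtain n where n: "admissible n L'" using ex[OF L'(1)] by blast
  define u' where "u' = u(M := u (M - 1) + n)"
  have u'M: "u' M - u' a = n + k a" "u' a < u' M" if "a < M" for a
  proof -
    have "u a \<le> u (M - 1)"
    proof (cases "a = M - 1")
      case False
      then have "M - 1 < M" "a < M - 1" using that by auto
      then show ?thesis using u by (simp add: less_imp_le)
    qed simp
    then show "u' M - u' a = n + k a" "u' a < u' M"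
      using that n by (auto simp: u'_def k_def admissible_def)
  qed
  have im: "iter i (n + k a) ` L = iter i n ` iter i (k a) ` L" for i a by (simp add: iter_add image_comp)
  have im_sub: "iter i (n + k a) ` L \<subseteq> iter i n ` L'" if "i \<le> N" "a < M" for i a
    unfolding im using iBL[OF that] by blast
  have adm: "admissible (n + k a) L" if a: "a < M" for a
    unfolding admissible_def
  proof (intro conjI allI impI)
    show "n + k a \<ge> 1" using n by (simp add: admissible_def)
    show "plane_convex \<Omega> (iter i (n + k a) ` L)" if i: "i \<le> N" for i
      unfolding im
    proof (rule plane_convex_iter_mono[OF i _ cL' iBL[OF i a]])
      show "plane_convex \<Omega> (iter i (k a) ` L)"
        using ka[OF a] L i by (auto simp: admissible_def)
      show "plane_convex \<Omega> (iter i n ` L')" using n i by (simp add: admissible_def)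
    qed
    show "disjoint_family_on (\<lambda>i. iter i (n + k a) ` L) {..N}"
      unfolding disjoint_family_on_def
    proof (intro ballI impI)
      fix i j assume "i \<in> {..N}" "j \<in> {..N}" "i \<noteq> j"
      then show "iter i (n + k a) ` L \<inter> iter j (n + k a) ` L = {}"
        using im_sub[of i a] im_sub[of j a] a admissible_disjoint[OF n, of i j L' L'] by fastforce
    qed
  qed
  have "chain_step L u' b"
    if b: "b < Suc M" for b
  proof (cases "b = M")
    case True
    have "\<forall>i\<le>N. connected (iter i n ` L')" using iter_connected[OF _ L'(2) cL'(2)] by blast
    moreover have "disjoint_family_on (\<lambda>i. iter i n ` L') {..N}" using n by (simp add: admissible_def)
    moreover have "\<forall>i\<le>N. \<forall>a<b. iter i (u' b - u' a) ` L \<subseteq> iter i n ` L'"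
      unfolding True using u'M(1) im_sub by simp
    moreover have "\<forall>a<b. u' a < u' b \<and> admissible (u' b - u' a) L"
      unfolding True using u'M adm by simp
    ultimately show ?thesis
      unfolding chain_step_def by (intro conjI exI[of _ "\<lambda>i. iter i n ` L'"])
  next
    case False
    then have "b < M" using b by simp
    then have "u' b = u b" "\<And>a. a < b \<Longrightarrow> u' a = u a" by (auto simp: u'_def)
    then show ?thesis using uP \<open>b < M\<close> by (simp add: chain_step_def)
  qed
  then show ?case by blast
qed

lemma exists_plane_convex_union:
  assumes ex: "\<And>K. plane_convex \<Omega> K \<Longrightarrow> \<exists>n. admissible n K" and inf: "\<not> finitely_connected \<Omega>"
    and K0: "compact K0" "K0 \<subseteq> \<Omega>"
  obtains n K where "K0 \<subseteq> K" "plane_convex \<Omega> K" "admissible n K" "plane_convex \<Omega> (\<Union>i\<le>N. iter i n ` K)"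
proof (rule ccontr)
  note witness = that
  assume neg: "\<not> thesis"
  obtain z0 where z0: "z0 \<in> \<Omega>" using \<Omega>(3) by auto
  obtain K where K: "plane_convex \<Omega> K" "connected K" "insert z0 K0 \<subseteq> interior K"
    using plane_convex_connected_superset[OF _ _ \<Omega>, of "insert z0 K0"] K0 z0 by auto
  have K': "K0 \<subseteq> K" "z0 \<in> K" "K \<noteq> {}" "compact K" "K \<subseteq> \<Omega>"
    using K interior_subset by (auto simp: plane_convex_def)
  let ?m = "N + 2"
  have "\<exists>\<gamma>. rich \<Omega> ?m C \<longrightarrow> (\<forall>k<?m. loop_in (C \<inter> \<Omega>) (\<gamma> k)) \<and> indep_loops \<Omega> ?m \<gamma>" for C
    unfolding rich_def by blast
  then obtain g where g: "\<And>C. rich \<Omega> ?m C \<Longrightarrow> (\<forall>k<?m. loop_in (C \<inter> \<Omega>) (g C k)) \<and> indep_loops \<Omega> ?m (g C)"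
    by metis
  \<comment> \<open>Including \<open>\<Omega>\<close> treats the loops for \<open>rich_U\<close>
    together with those for \<open>rich_component\<close>; finiteness of \<open>R\<close> makes
    \<open>Z\<close> compact.\<close>
  define R where "R = insert \<Omega> {C \<in> components (- K). rich \<Omega> ?m C}"
  have R: "rich \<Omega> ?m C" if "C \<in> R" for C using that rich_infinitely_connected[OF dom inf] by (auto simp: R_def)
  have finR: "finite R" using finite_components_plane_convex[OF K(1) \<Omega>(1)] by (simp add: R_def)
  define Z where "Z = K \<union> (\<Union>C\<in>R. \<Union>k<?m. path_image (g C k))"
  have gl: "loop_in (C \<inter> \<Omega>) (g C k)" if "C \<in> R" "k < ?m" for C k using g[OF R[OF that(1)]] that(2) by blast
  have "compact Z"
    unfolding Z_def using K'(4) finR gl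
    by (intro compact_Un compact_UN compact_path_image finite_lessThan) (auto simp: loop_in_def valid_path_imp_path)
  moreover have "Z \<subseteq> \<Omega>" unfolding Z_def using K'(5) gl by (fastforce simp: loop_in_def)
  ultimately obtain L0 where L0: "plane_convex \<Omega> L0" "connected L0" "Z \<subseteq> interior L0"
    using plane_convex_connected_superset[OF _ _ \<Omega>] by metis
  obtain L where LL: "plane_convex \<Omega> L" "connected L" "L0 \<subseteq> interior L"
    using plane_convex_connected_superset[OF _ _ \<Omega>, of L0] L0(1) unfolding plane_convex_def by metis
  \<comment> \<open>\<open>interior L\<close> may be disconnected. The connected set
    \<open>L0\<close> between \<open>Z\<close> and \<open>interior L\<close> forces \<open>Z\<close>
    into a single component of it.\<close>
  define U where "U = connected_component_set (interior L) z0"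
  have "z0 \<in> L0" using K'(2) L0(3) interior_subset unfolding Z_def by blast
  then have "L0 \<subseteq> U" unfolding U_def using L0(2) LL(3) by (intro connected_component_maximal) auto
  then have ZU: "Z \<subseteq> U" using L0(3) interior_subset by blast
  have loopU: "loop_in (C \<inter> U) (g C k)" if "C \<in> R" "k < ?m" for C k
    using gl[OF that] ZU that unfolding loop_in_def Z_def by blast
  have U: "open U" "connected U" "K \<subseteq> U" "U \<subseteq> L"
    using ZU connected_component_subset[of "interior L" z0] interior_subset[of L]
    by (auto simp: U_def Z_def open_connected_component)
  have cL: "compact L" "L \<subseteq> \<Omega>" using LL(1) by (auto simp: plane_convex_def)
  interpret test_sets \<Omega> N \<phi> K U L
  proof
    show "\<exists>\<gamma>. (\<forall>k<?m. loop_in (C \<inter> U) (\<gamma> k)) \<and> indep_loops \<Omega> ?m \<gamma>"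
      if "C \<in> components (- K)" "rich \<Omega> ?m C" for C
      using loopU[of C] g[OF that(2)] that by (intro exI[of _ "g C"]) (auto simp: R_def)
    show "\<exists>\<gamma>. (\<forall>k<?m. loop_in U (\<gamma> k)) \<and> indep_loops \<Omega> ?m \<gamma>"
      using loopU[of \<Omega>] g[OF R[of \<Omega>]] loop_in_mono[of "\<Omega> \<inter> U" _ U] by (intro exI[of _ "g \<Omega>"]) (auto simp: R_def)
  qed (use K K' U cL in auto)
  have KL: "K \<subseteq> L" using U by auto
  have "\<exists>i j C. bad n i j C" if "admissible n L" for n
  proof -
    have "admissible n K" by (rule admissible_subset[OF that K(1) KL LL(1)])
    then have "\<not> plane_convex \<Omega> (\<Union>i\<le>N. iter i n ` K)" using neg witness[OF K'(1) K(1)] by blast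
    then show ?thesis using exists_bad[OF that] by metis
  qed
  then have "\<exists>q. admissible n L \<longrightarrow> bad n (fst q) (fst (snd q)) (snd (snd q))" for n by (metis fst_conv snd_conv)
  then obtain q where q: "\<And>n. admissible n L \<Longrightarrow> bad n (fst (q n)) (fst (snd (q n))) (snd (snd (q n)))" by metis
  define S where "S = {1..N} \<times> {1..N} \<times> components (- K)"
  have "finite S" using finite_components_plane_convex[OF K(1) \<Omega>(1)] by (simp add: S_def)
  from ramsey_triangle[OF this] obtain M :: nat where
    M: "\<forall>col. (\<forall>a b. a < b \<longrightarrow> b < M \<longrightarrow> col a b \<in> S) \<longrightarrow>
      (\<exists>a b c. a < b \<and> b < c \<and> c < M \<and> col a b = col b c \<and> col a c = col b c)" ..
  from admissible_sequence[OF ex LL(1), of M] obtain u :: "nat \<Rightarrow> nat" where uP: "\<forall>b<M. chain_step L u b" ..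
  have u: "u a < u b \<and> admissible (u b - u a) L" if "b < M" "a < b" for a b
    using uP that by (simp add: chain_step_def)
  have uF: "\<exists>F. (\<forall>i\<le>N. connected (F i)) \<and> disjoint_family_on F {..N} \<and> (\<forall>i\<le>N. \<forall>a<b. iter i (u b - u a) ` L \<subseteq> F i)" if "b < M" for b
    using uP that by (simp add: chain_step_def)
  have "q (u b - u a) \<in> S" if "a < b" "b < M" for a b
    using q[of "u b - u a"] u[OF that(2,1)] unfolding bad_def S_def by (cases "q (u b - u a)") auto
  then obtain a b c where abc: "a < b" "b < c" "c < M"
    and qe: "q (u b - u a) = q (u c - u b)" "q (u c - u a) = q (u c - u b)"
    using M[rule_format, of "\<lambda>a b. q (u b - u a)"] by blast
  obtain i j C where ijC: "q (u c - u b) = (i,j,C)" by (cases "q (u c - u b)")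
  define p where "p = u b - u a"
  define y where "y = u c - u b"
  have lt: "u a < u b" "u b < u c" "u a < u c" using u abc by (meson less_trans)+
  then have yp: "u c - u a = y + p" by (simp add: p_def y_def)
  have bads: "bad p i j C" "bad y i j C" "bad (y + p) i j C"
    using q[of p] q[of y] q[of "y + p"] u[of b a] u[of c b] u[of c a] abc qe ijC unfolding yp[symmetric] p_def y_def
    by auto
  obtain F where F: "\<forall>i\<le>N. connected (F i)" "disjoint_family_on F {..N}" "\<forall>i\<le>N. \<forall>a<c. iter i (u c - u a) ` L \<subseteq> F i"
    using uF[OF abc(3)] by blast
  have ij: "i \<le> N" "j \<le> N" "i \<noteq> j" using bads(1) by (auto simp: bad_def)
  have sub: "iter k y ` K \<subseteq> F k" "iter k (y + p) ` K \<subseteq> F k" if "k \<le> N" for k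
  proof -
    have "a < c" using abc by simp
    then have "iter k (u c - u b) ` L \<subseteq> F k" "iter k (u c - u a) ` L \<subseteq> F k"
      using F(3) that abc(2) by auto
    then have "iter k y ` L \<subseteq> F k" "iter k (y + p) ` L \<subseteq> F k"
      by (simp_all only: yp y_def[symmetric])
    then show "iter k y ` K \<subseteq> F k" "iter k (y + p) ` K \<subseteq> F k" using KL by blast+
  qed
  have "F j \<inter> F i = {}" using F(2) ij unfolding disjoint_family_on_def by auto
  then show False
    using no_bad_triangle[OF bads, of "F j"] F(1) ij sub[OF ij(1)] sub[OF ij(2)] by blast
qed

end

section \<open>Composition operators\<close>

context self_maps
begin

lemma restrict_in_holo_fun: "g holomorphic_on \<Omega> \<Longrightarrow> restrict g \<Omega> \<in> holo_fun \<Omega>"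
  by (auto simp: holo_fun_def intro: holomorphic_transform)

lemma comp_operator_funpow:
  assumes i: "i \<in> {1..N}" and f: "f \<in> holo_fun \<Omega>"
  shows "(comp_operator \<Omega> (\<phi> i) ^^ n) f = restrict (f \<circ> iter i n) \<Omega>"
proof (induction n)
  case 0
  then show ?case using f by (simp add: holo_fun_def extensional_restrict)
next
  case (Suc n)
  have "iter i (Suc n) = iter i n \<circ> \<phi> i"
    using i by (simp add: iter_def funpow_Suc_right del: funpow.simps)
  then show ?case
    using Suc maps[OF i] by (auto simp: comp_operator_def restrict_def fun_eq_iff)
qed

lemma comp_operator_funpow_in_holo_fun:
  assumes i: "i \<in> {1..N}" and f: "f \<in> holo_fun \<Omega>"
  shows "(comp_operator \<Omega> (\<phi> i) ^^ n) f \<in> holo_fun \<Omega>"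
proof -
  have "i \<le> N" using i by simp
  then have "(f \<circ> iter i n) holomorphic_on \<Omega>"
    using f iter_self_map[of i n] by (intro holomorphic_on_compose_gen[where t = \<Omega>]) (auto simp: holo_fun_def)
  then show ?thesis
    unfolding comp_operator_funpow[OF i f] by (rule restrict_in_holo_fun)
qed

definition ball_inside ::
    "(complex \<Rightarrow> complex) set \<Rightarrow> (complex \<Rightarrow> complex) \<times> complex set \<times> real \<Rightarrow> bool" where
  "ball_inside W = (\<lambda>(f, H, e). f \<in> holo_fun \<Omega> \<and> compact H \<and> H \<subseteq> \<Omega> \<and> e > 0 \<and>
     {g \<in> holo_fun \<Omega>. \<forall>z\<in>H. dist (g z) (f z) < e} \<subseteq> W)"

lemma exists_ball_inside:
  assumes "openin (holo_topology \<Omega>) W" "W \<noteq> {}"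
  shows "\<exists>q. ball_inside W q"
proof -
  obtain f where f: "f \<in> W" using assms(2) by blast
  note W_open = assms(1)[unfolded openin_holo_topology]
  from f have "f \<in> holo_fun \<Omega>" using W_open by (rule subsetD[OF conjunct1, rotated])
  with bspec[OF conjunct2[OF W_open] f] show ?thesis
    unfolding ball_inside_def by (auto intro: exI[of _ "(f, H, e)" for H e])
qed

text \<open>On the image of \<open>K\<close> under \<open>iter i n\<close> the wanted function has
  to resemble \<open>f i\<close> composed with the inverse of that iterate. Convexity of the union
  allows this for all indices at once, and index \<open>0\<close> takes care of
  \<open>W 0\<close>.\<close>

lemma transitive_if_admissible:
  assumes ex: "\<And>K. plane_convex \<Omega> K \<Longrightarrow> \<exists>n. admissible n K" and inf: "\<not> finitely_connected \<Omega>"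
  shows "d_topologically_transitive (holo_topology \<Omega>) N (\<lambda>i. comp_operator \<Omega> (\<phi> i))"
  unfolding d_topologically_transitive_def
proof (intro allI impI)
  fix W :: "nat \<Rightarrow> (complex \<Rightarrow> complex) set"
  assume W: "\<forall>i\<in>{0..N}. openin (holo_topology \<Omega>) (W i) \<and> W i \<noteq> {}"
  have "\<exists>q. ball_inside (W i) q" if "i \<le> N" for i
  proof (rule exists_ball_inside)
    show "openin (holo_topology \<Omega>) (W i)" "W i \<noteq> {}" using W \<open>i \<le> N\<close> by simp_all
  qed
  then obtain q where q: "\<And>i. i \<le> N \<Longrightarrow> ball_inside (W i) (q i)" by metis
  define f where "f i = fst (q i)" for i
  define H where "H i = fst (snd (q i))" for i
  define e where "e i = snd (snd (q i))" for i
  have f: "f i \<in> holo_fun \<Omega>" and H: "compact (H i)" "H i \<subseteq> \<Omega>" and e: "e i > 0"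
    and sub: "{g \<in> holo_fun \<Omega>. \<forall>z\<in>H i. dist (g z) (f i z) < e i} \<subseteq> W i" if "i \<le> N" for i
    using q[OF that] by (simp_all add: f_def H_def e_def ball_inside_def case_prod_unfold)
  have "compact (\<Union>i\<le>N. H i)" "(\<Union>i\<le>N. H i) \<subseteq> \<Omega>" using H by auto
  then obtain n K where K: "(\<Union>i\<le>N. H i) \<subseteq> K" "plane_convex \<Omega> K" "admissible n K" "plane_convex \<Omega> (\<Union>i\<le>N. iter i n ` K)"
    using exists_plane_convex_union[OF ex inf] by metis
  have cK: "compact K" "K \<subseteq> \<Omega>" using K(2) by (auto simp: plane_convex_def)
  have "\<exists>\<psi>. \<psi> holomorphic_on iter i n ` \<Omega> \<and> (\<forall>z\<in>\<Omega>. \<psi> (iter i n z) = z)" if "i \<le> N" for i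
    using holomorphic_has_inverse[OF iter_self_map(1)[OF that] \<Omega>(1) iter_self_map(3)[OF that]] by metis
  then obtain \<psi> where \<psi>: "\<And>i. i \<le> N \<Longrightarrow> \<psi> i holomorphic_on iter i n ` \<Omega>"
    "\<And>i z. i \<le> N \<Longrightarrow> z \<in> \<Omega> \<Longrightarrow> \<psi> i (iter i n z) = z"
    by metis
  define \<epsilon> where "\<epsilon> = Min (e ` {..N})"
  have \<epsilon>: "\<epsilon> > 0" "\<And>i. i \<le> N \<Longrightarrow> \<epsilon> \<le> e i"
    unfolding \<epsilon>_def using e by (auto intro!: Min_le)
  obtain g where g: "g holomorphic_on \<Omega>"
    "\<And>i z. i \<in> {..N} \<Longrightarrow> z \<in> iter i n ` K \<Longrightarrow> norm (g z - (f i \<circ> \<psi> i) z) < \<epsilon>"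
  proof (rule runge_disjoint_family[where I = "{..N}" and A = "\<lambda>i. iter i n ` K" and \<Omega> = \<Omega>
        and W = "\<lambda>i. iter i n ` \<Omega>" and f = "\<lambda>i. f i \<circ> \<psi> i" and e = \<epsilon>])
    fix i assume "i \<in> {..N}"
    then have i: "i \<le> N" by simp
    show "compact (iter i n ` K)" by (rule iter_compact[OF i cK])
    show "open (iter i n ` \<Omega>)" by (rule open_mapping_thm3[OF iter_self_map(1)[OF i] \<Omega>(1) iter_self_map(3)[OF i]])
    show "iter i n ` K \<subseteq> iter i n ` \<Omega>" using cK by blast
    show "f i \<circ> \<psi> i holomorphic_on iter i n ` \<Omega>"
      using \<psi>[OF i] f[OF i] by (intro holomorphic_on_compose_gen[where t = \<Omega>]) (auto simp: holo_fun_def)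
  qed (use K \<epsilon> in \<open>auto simp: admissible_def\<close>)
  have close: "dist (g (iter i n z)) (f i z) < e i" if "i \<le> N" "z \<in> H i" for i z
  proof -
    have "z \<in> K" using K(1) that by auto
    then show ?thesis
      using g(2)[of i "iter i n z"] \<psi>(2)[of i z] \<epsilon>(2)[OF that(1)] that cK(2) by (auto simp: dist_norm)
  qed
  let ?g = "restrict g \<Omega>"
  have gh: "?g \<in> holo_fun \<Omega>" by (rule restrict_in_holo_fun[OF g(1)])
  have "?g \<in> W 0"
    by (rule subsetD[OF sub[of 0]]) (use close[of 0] H(2)[of 0] gh in auto)
  moreover have "?g \<in> {x \<in> topspace (holo_topology \<Omega>). (comp_operator \<Omega> (\<phi> i) ^^ n) x \<in> W i}"
    if i: "i \<in> {1..N}" for i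
  proof -
    have iN: "i \<le> N" using i by simp
    have "dist ((comp_operator \<Omega> (\<phi> i) ^^ n) ?g z) (f i z) < e i" if "z \<in> H i" for z
    proof -
      have "z \<in> \<Omega>" using H(2)[OF iN] that by auto
      then have "iter i n z \<in> \<Omega>" using iter_self_map(2)[OF iN] by auto
      then show ?thesis
        using close[OF iN that] \<open>z \<in> \<Omega>\<close> by (simp add: comp_operator_funpow[OF i gh])
    qed
    then have "(comp_operator \<Omega> (\<phi> i) ^^ n) ?g \<in> W i"
      using comp_operator_funpow_in_holo_fun[OF i gh] by (intro subsetD[OF sub[OF iN]]) simp
    then show ?thesis using gh by simp
  qed
  ultimately have "?g \<in> W 0 \<inter> (\<Inter>i\<in>{1..N}. {x \<in> topspace (holo_topology \<Omega>). (comp_operator \<Omega> (\<phi> i) ^^ n) x \<in> W i})"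
    by blast
  moreover have "n \<ge> 1" using K(3) by (simp add: admissible_def)
  ultimately show "\<exists>n\<ge>1. W 0 \<inter> (\<Inter>i\<in>{1..N}. {x \<in> topspace (holo_topology \<Omega>). (comp_operator \<Omega> (\<phi> i) ^^ n) x \<in> W i}) \<noteq> {}"
    by blast
qed

text \<open>Test functions that are small on \<open>K\<close> but not at one point \<open>p C\<close> of each component \<open>C\<close> of \<open>- K\<close>
  detect convexity: a component of \<open>- iter i n ` K\<close> inside \<open>\<Omega>\<close> would contain some
  \<open>iter i n (p C)\<close>, against the maximum principle.\<close>

lemma admissible_if_transitive:
  assumes trans: "d_topologically_transitive (holo_topology \<Omega>) N (\<lambda>i. comp_operator \<Omega> (\<phi> i))"
    and K0: "plane_convex \<Omega> K0"
  shows "\<exists>n. admissible n K0"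
proof -
  obtain z0 where z0: "z0 \<in> \<Omega>" using \<Omega>(3) by auto
  have cK0: "compact K0" "K0 \<subseteq> \<Omega>" using K0 by (auto simp: plane_convex_def)
  obtain K where K: "plane_convex \<Omega> K" "connected K" "insert z0 K0 \<subseteq> interior K"
    using plane_convex_connected_superset[OF _ _ \<Omega>, of "insert z0 K0"] cK0 z0 by auto
  have cK: "K0 \<subseteq> K" "K \<noteq> {}" "compact K" "K \<subseteq> \<Omega>"
    using K interior_subset by (auto simp: plane_convex_def)
  have "\<exists>c. c \<in> C \<and> c \<in> \<Omega>" if "C \<in> components (- K)" for C
    using component_Int_nonempty[OF cK(3,2,4) \<Omega>(1) that] by blast
  then obtain p where p: "\<And>C. C \<in> components (- K) \<Longrightarrow> p C \<in> C" "\<And>C. C \<in> components (- K) \<Longrightarrow> p C \<in> \<Omega>"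
    by metis
  define P where "P = p ` components (- K)"
  have finP: "finite P" using finite_components_plane_convex[OF K(1) \<Omega>(1)] by (simp add: P_def)
  have PK: "P \<inter> K = {}" "P \<subseteq> \<Omega>" using p in_components_subset[of _ "- K"] unfolding P_def by blast+
  have M: "plane_convex \<Omega> (K \<union> P)" unfolding P_def by (rule plane_convex_Un_finite[OF K(1) p \<Omega>(1)])
  have cM: "compact (K \<union> P)" "K \<union> P \<subseteq> \<Omega>" using M by (auto simp: plane_convex_def)
  obtain g where g: "g holomorphic_on \<Omega>" "\<And>z. z \<in> K \<Longrightarrow> norm (g z) < 1/4" "\<And>z. z \<in> P \<Longrightarrow> norm (g z - 1) < 1/4"
  proof -
    define A where "A b = (if b then P else K)" for b :: bool
    obtain g where g: "g holomorphic_on \<Omega>" "\<And>b z. b \<in> UNIV \<Longrightarrow> z \<in> A b \<Longrightarrow> norm (g z - (\<lambda>z. if b then 1 else 0) z) < 1/4"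
    proof (rule runge_disjoint_family[where I = UNIV and A = A and \<Omega> = \<Omega> and W = "\<lambda>_. UNIV"
          and f = "\<lambda>b z. if b then 1 else 0" and e = "1/4"])
      show "plane_convex \<Omega> (\<Union>b\<in>UNIV. A b)" using M by (simp add: A_def UNIV_bool Un_commute)
      show "disjoint_family_on A UNIV" using PK by (auto simp: A_def disjoint_family_on_def)
    qed (use finP cK in \<open>auto simp: A_def finite_imp_compact\<close>)
    show thesis
      by (rule that[OF g(1)]) (use g(2)[of False] g(2)[of True] in \<open>auto simp: A_def\<close>)
  qed
  \<comment> \<open>With errors 1/4 for \<open>f\<close> and 1/4 for \<open>g\<close>, the values on
    the image of \<open>K\<close> lie within 1/2 of \<open>2 * of_nat i\<close>, in disjoint discs.
    At the images of the points \<open>p C\<close> they are near \<open>2 * of_nat i + 1\<close>.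
    Index \<open>0\<close> has no such points because \<open>K\<close> is convex by choice.\<close>
  define H where "H i = (if i = 0 then K else K \<union> P)" for i :: nat
  define h where "h i = (if i = 0 then (\<lambda>_. 0) else (\<lambda>z. 2 * of_nat i + g z))" for i :: nat
  have h: "h i holomorphic_on \<Omega>" for i using g(1) by (auto simp: h_def intro!: holomorphic_intros)
  define W where "W i = {f \<in> holo_fun \<Omega>. \<forall>z\<in>H i. dist (f z) (h i z) < 1/4}" for i
  have "openin (holo_topology \<Omega>) (W i)" for i
    unfolding W_def by (rule openin_holo_topology_ball[OF _ _ h]) (use cK cM in \<open>auto simp: H_def\<close>)
  moreover have "restrict (h i) \<Omega> \<in> W i" for i
    unfolding W_def using restrict_in_holo_fun[OF h[of i]] cK(4) cM(2) by (auto simp: H_def)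
  ultimately have "\<forall>i\<in>{0..N}. openin (holo_topology \<Omega>) (W i) \<and> W i \<noteq> {}" by blast
  then obtain n f where n: "n \<ge> 1" and f0: "f \<in> W 0"
    and fi: "\<And>i. i \<in> {1..N} \<Longrightarrow> f \<in> holo_fun \<Omega> \<and> (comp_operator \<Omega> (\<phi> i) ^^ n) f \<in> W i"
    using trans[unfolded d_topologically_transitive_def, rule_format, of W] by fastforce
  have fh: "f \<in> holo_fun \<Omega>" and fhol: "f holomorphic_on \<Omega>" using f0 by (auto simp: W_def holo_fun_def)
  have near: "norm (f (iter i n z) - (2 * of_nat i + g z)) < 1/4" if i: "i \<in> {1..N}" and z: "z \<in> K \<union> P" for i z
  proof -
    have "z \<in> \<Omega>" using z cM by auto
    moreover have "dist ((comp_operator \<Omega> (\<phi> i) ^^ n) f z) (h i z) < 1/4"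
      using fi[OF i] i z by (auto simp: W_def H_def)
    ultimately show ?thesis
      using i by (simp add: comp_operator_funpow[OF i fh] dist_norm h_def)
  qed
  have nearK: "norm (f (iter i n z) - 2 * of_nat i) < 1/2" if i: "i \<le> N" and z: "z \<in> K" for i z
  proof (cases "i = 0")
    case True
    then show ?thesis using f0 z by (auto simp: W_def H_def h_def)
  next
    case False
    then have "i \<in> {1..N}" using i by auto
    from near[OF this, of z] z have "norm (f (iter i n z) - (2 * of_nat i + g z)) < 1/4" by auto
    then show ?thesis
      using norm_triangle_ineq[of "f (iter i n z) - (2 * of_nat i + g z)" "g z"] g(2)[OF z] by simp
  qed
  have "admissible n K"
    unfolding admissible_def
  proof (intro conjI allI impI n)
    show "disjoint_family_on (\<lambda>i. iter i n ` K) {..N}"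
      unfolding disjoint_family_on_def
    proof (intro ballI impI equals0I)
      fix i j w assume ij: "i \<in> {..N}" "j \<in> {..N}" "i \<noteq> j" and w: "w \<in> iter i n ` K \<inter> iter j n ` K"
      have "norm (f w - 2 * of_nat i) < 1/2" "norm (f w - 2 * of_nat j) < 1/2"
        using nearK ij w by auto
      then have lt: "norm ((2 * of_nat j :: complex) - 2 * of_nat i) < 1"
        using norm_triangle_ineq4[of "f w - 2 * of_nat i" "f w - 2 * of_nat j"] by simp
      have "norm ((2 * of_nat j :: complex) - 2 * of_nat i) = 2 * \<bar>real j - real i\<bar>"
        by (metis norm_mult norm_numeral norm_of_real of_real_diff of_real_of_nat_eq right_diff_distrib)
      with lt have "2 * \<bar>real j - real i\<bar> < 1" by (simp only:)
      moreover have "1 \<le> \<bar>real j - real i\<bar>" using ij(3) by (cases i j rule: linorder_cases) auto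
      ultimately show False by simp
    qed
    fix i assume i: "i \<le> N"
    note it = iter_self_map[OF i, of n]
    have cpt: "compact (iter i n ` K)" by (rule iter_compact[OF i cK(3,4)])
    show "plane_convex \<Omega> (iter i n ` K)"
    proof (cases "i = 0")
      case True
      then show ?thesis using K(1) by simp
    next
      case False
      then have i1: "i \<in> {1..N}" using i by auto
      show ?thesis
        unfolding plane_convex_def
      proof (intro conjI cpt ballI impI notI)
        show "iter i n ` K \<subseteq> \<Omega>" using it(2) cK(4) by auto
        fix Q assume Q: "Q \<in> components (- (iter i n ` K))" "bounded Q" "Q \<subseteq> \<Omega>"
        have opQ: "open Q" by (rule open_plane_component[OF compact_imp_closed[OF cpt] Q(1)])
        have clQ: "closure Q \<subseteq> Q \<union> iter i n ` K" by (rule closure_component_subset[OF Q(1) compact_imp_closed[OF cpt]])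
        \<comment> \<open>\<open>Q\<close> accumulates at the image of \<open>K\<close>, so it meets
          the open image of \<open>\<Omega>\<close>. Some component \<open>C\<close> of
          \<open>- K\<close> is then mapped into \<open>Q\<close> as far as it lies in
          \<open>\<Omega>\<close>, and with it the point \<open>p C\<close>.\<close>
        have "\<not> closure Q \<subseteq> Q"
          using component_not_closed[OF compact_imp_closed[OF cpt] _ Q(1)] cK(2) by blast
        then have "iter i n ` \<Omega> \<inter> closure Q \<noteq> {}" using clQ cK(4) by blast
        moreover have "open (iter i n ` \<Omega>)" by (rule open_mapping_thm3[OF it(1) \<Omega>(1) it(3)])
        ultimately have "iter i n ` \<Omega> \<inter> Q \<noteq> {}" using open_Int_closure_eq_empty by blast
        then obtain x where x: "x \<in> \<Omega>" "iter i n x \<in> Q" by auto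
        have xK: "x \<notin> K" using x in_components_subset[OF Q(1)] by auto
        obtain C where C: "C \<in> components (- K)" "x \<in> C" using component_containing[OF xK] .
        have con: "connected (C \<inter> \<Omega>)" by (rule connected_component_Int[OF cK(3,4) \<Omega>(1,2) C(1)])
        have "iter i n ` (C \<inter> \<Omega>) \<inter> iter i n ` K = iter i n ` (C \<inter> \<Omega> \<inter> K)"
          by (rule inj_on_image_Int[OF it(3) Int_lower2 cK(4), symmetric])
        then have "iter i n ` (C \<inter> \<Omega>) \<subseteq> - (iter i n ` K)" using in_components_subset[OF C(1)] by blast
        then have "iter i n ` (C \<inter> \<Omega>) \<subseteq> Q"
          using x C(2) by (intro connected_subset_component[OF iter_connected[OF i con] _ Q(1)]) auto
        then have pQ: "iter i n (p C) \<in> Q" using p C(1) by auto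
        have "norm (f (iter i n (p C)) - 2 * of_nat i) \<le> 1/2"
        proof (rule maximum_modulus_frontier[of "\<lambda>w. f w - 2 * of_nat i" Q])
          have fO: "(\<lambda>w. f w - 2 * of_nat i) holomorphic_on \<Omega>" using fhol by (intro holomorphic_intros)
          show "(\<lambda>w. f w - 2 * of_nat i) holomorphic_on interior Q"
            using fO Q(3) interior_subset by (meson holomorphic_on_subset order_trans)
          have "closure Q \<subseteq> \<Omega>" using clQ Q(3) it(2) cK(4) by blast
          then show "continuous_on (closure Q) (\<lambda>w. f w - 2 * of_nat i)"
            using fO by (meson continuous_on_subset holomorphic_on_imp_continuous_on)
          show "norm (f w - 2 * of_nat i) \<le> 1/2" if "w \<in> frontier Q" for w
          proof -
            have "w \<in> iter i n ` K" using that clQ interior_open[OF opQ] by (auto simp: frontier_def)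
            then show ?thesis using nearK[OF i] by (auto intro: less_imp_le)
          qed
        qed (use Q pQ in auto)
        moreover have "p C \<in> P" using C(1) by (simp add: P_def)
        then have "norm (f (iter i n (p C)) - (2 * of_nat i + g (p C))) < 1/4" "norm (g (p C) - 1) < 1/4"
          using near[OF i1] g(3) by auto
        \<comment> \<open>The three norms are at most 1/2, less than 1/4 and less than 1/4, so their
          sum stays below 1.\<close>
        moreover have "norm (1::complex) \<le> norm (f (iter i n (p C)) - 2 * of_nat i)
            + norm (f (iter i n (p C)) - (2 * of_nat i + g (p C))) + norm (g (p C) - 1)"
        proof -
          have "1 = (f (iter i n (p C)) - 2 * of_nat i) - (f (iter i n (p C)) - (2 * of_nat i + g (p C))) - (g (p C) - 1)"
            by simp
          then show ?thesis by (metis norm_triangle_le_diff add_right_mono norm_triangle_ineq4)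
        qed
        ultimately show False by simp
      qed
    qed
  qed
  then have "admissible n K0" by (rule admissible_subset[OF _ K0 cK(1) K(1)])
  then show ?thesis by blast
qed

end

theorem theorem2p6:
  fixes \<Omega> :: "complex set" and N :: nat and \<phi> :: "nat \<Rightarrow> complex \<Rightarrow> complex"
  assumes "domain_in_plane \<Omega>" and "\<not> finitely_connected \<Omega>"
    and "N \<ge> 2"
    and "\<And>i. i \<in> {1..N} \<Longrightarrow> \<phi> i holomorphic_on \<Omega>"
    and "\<And>i. i \<in> {1..N} \<Longrightarrow> \<phi> i ` \<Omega> \<subseteq> \<Omega>"
    and "\<And>i. i \<in> {1..N} \<Longrightarrow> inj_on (\<phi> i) \<Omega>"
  shows "d_topologically_transitive (holo_topology \<Omega>) N (\<lambda>i. comp_operator \<Omega> (\<phi> i)) \<longleftrightarrow>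
    (\<forall>K. convex_relative \<Omega> K \<longrightarrow>
      (\<exists>n\<ge>1. (\<forall>i\<in>{1..N}. convex_relative \<Omega> ((\<phi> i ^^ n) ` K)) \<and>
        (\<forall>i\<in>{1..N}. K \<inter> (\<phi> i ^^ n) ` K = {}) \<and>
        disjoint_family_on (\<lambda>i. (\<phi> i ^^ n) ` K) {1..N}))"
proof -
  interpret self_maps \<Omega> N \<phi>
    by (unfold_locales) (use assms in auto)
  have "d_topologically_transitive (holo_topology \<Omega>) N (\<lambda>i. comp_operator \<Omega> (\<phi> i)) \<longleftrightarrow>
    (\<forall>K. plane_convex \<Omega> K \<longrightarrow> (\<exists>n. admissible n K))"
    using transitive_if_admissible[OF _ assms(2)] admissible_if_transitive by blast
  also have "\<dots> \<longleftrightarrow> (\<forall>K. convex_relative \<Omega> K \<longrightarrow>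
      (\<exists>n\<ge>1. (\<forall>i\<in>{1..N}. convex_relative \<Omega> ((\<phi> i ^^ n) ` K)) \<and>
        (\<forall>i\<in>{1..N}. K \<inter> (\<phi> i ^^ n) ` K = {}) \<and>
        disjoint_family_on (\<lambda>i. (\<phi> i ^^ n) ` K) {1..N}))"
    unfolding convex_relative_iff using admissible_iff by simp
  finally show ?thesis .
qed

end
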